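(* Let $K$ be a field, $R=L_K(\mathcal{T})$, and let $C$ denote the left $R$-module $Y\oplus\big(\bigoplus_{f(x)\in\mathcal{F}}U^f\big)$. Then a left $R$-module $M$ is injective if and only if $M$ is isomorphic to a direct summand of a direct product of copies of $C$.
   Context: $R=L_K(\mathcal{T})$ is the Leavitt path algebra over the field $K$ of the graph $\mathcal{T}$ with two vertices $v,w$, a loop $c$ at $v$, and one edge $d$ from $v$ to $w$. That is, $R$ is the unital associative $K$-algebra generated by $v,w,c,d,c^*,d^*$ with relations $v^2=v$, $w^2=w$, $vw=wv=0$, $v+w=1_R$, $c=vc=cv$, $c^*=vc^*=c^*v$, $d=vd=dw$, $d^*=wd^*=d^*v$, $c^*c=v$, $d^*d=w$, $c^*d=d^*c=0$, $cc^*+dd^*=v$. "Module" means left module. For $g(x)=\sum_{i=0}^m k_ix^i\in K[x]$, set $g(c):=k_01_R+k_1c+\cdots+k_mc^m\in R$. $\mathcal{F}$ is the set of polynomials $f(x)\in K[x]$ that are irreducible in $K[x]$ with $f(0)=-1$. $f^n$ denotes the $n$-th power of $f$; $\mathbb N=\{1,2,\dots\}$. For $f\in\mathcal{F}$ and $n\in\mathbb N$, $M_n^f:=R/Rf^n(c)$; for $i\le \ell$, $\psi_{i,\ell}:M_i^f\to M_\ell^f$ is the ($R$-linear, injective) map $1+Rf^i(c)\mapsto f^{\ell-i}(c)+Rf^\ell(c)$; and $U^f:=\varinjlim\{M_i^f,\psi_{i,j}\}_{i\le j}$. $Y$ is the $K$-space of all formal series $y=k_{-1}w+k_0d+k_1cd+\cdots+k_ic^id+\cdots$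 with $k_i\in K$ (no finiteness condition), made into a left $R$-module by $c\cdot y=k_0cd+k_1c^2d+\cdots+k_ic^{i+1}d+\cdots$; $c^*\cdot y=k_1d+k_2cd+\cdots+k_ic^{i-1}d+\cdots$; $d\cdot y=k_{-1}d$; $d^*\cdot y=k_0w$; $v\cdot y=k_0d+k_1cd+\cdots+k_ic^id+\cdots$; $w\cdot y=k_{-1}w$. *)

theory Defs
  imports
    "HOL-Algebra.Module"
    "HOL-Algebra.AbelCoset"
    "HOL-Computational_Algebra.Polynomial"
    "HOL-Computational_Algebra.Factorial_Ring"
    "HOL-Library.Poly_Mapping"
begin

section \<open>Left modules\<close>

text \<open>
  The locale \<^locale>\<open>module\<close> requires a commutative ring of scalars, so left modules over a
  possibly noncommutative ring are introduced here.  The scalars form a type of class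
  \<^class>\<open>ring_1\<close>; modules are records of type \<^typ>\<open>('r, 'a) module\<close> with an explicit carrier.  The
  fields \<^const>\<open>monoid.mult\<close> and \<^const>\<open>monoid.one\<close> of such a record play no role.
\<close>

locale left_module = abelian_group M
  for M :: "('r::ring_1, 'a, 'z) module_scheme" (structure) +
  assumes smult_closed: "x \<in> carrier M \<Longrightarrow> r \<odot> x \<in> carrier M"
    and smult_l_distr: "x \<in> carrier M \<Longrightarrow> (r + s) \<odot> x = r \<odot> x \<oplus> s \<odot> x"
    and smult_r_distr:
      "\<lbrakk>x \<in> carrier M; y \<in> carrier M\<rbrakk> \<Longrightarrow> r \<odot> (x \<oplus> y) = r \<odot> x \<oplus> r \<odot> y"
    and smult_assoc: "x \<in> carrier M \<Longrightarrow> (r * s) \<odot> x = r \<odot> (s \<odot> x)"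
    and smult_one: "x \<in> carrier M \<Longrightarrow> 1 \<odot> x = x"

definition module_hom ::
    "('r, 'a, 'y) module_scheme \<Rightarrow> ('r, 'b, 'z) module_scheme \<Rightarrow> ('a \<Rightarrow> 'b) set" where
  "module_hom M N = {h \<in> carrier M \<rightarrow> carrier N.
     (\<forall>x\<in>carrier M. \<forall>y\<in>carrier M. h (x \<oplus>\<^bsub>M\<^esub> y) = h x \<oplus>\<^bsub>N\<^esub> h y) \<and>
     (\<forall>r. \<forall>x\<in>carrier M. h (r \<odot>\<^bsub>M\<^esub> x) = r \<odot>\<^bsub>N\<^esub> h x)}"

definition module_isomorphic ::
    "('r, 'a, 'y) module_scheme \<Rightarrow> ('r, 'b, 'z) module_scheme \<Rightarrow> bool" where
  "module_isomorphic M N \<longleftrightarrow> (\<exists>h\<in>module_hom M N. bij_betw h (carrier M) (carrier N))"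

text \<open>
  Injectivity quantifies over all pairs of modules.  Since one cannot quantify over types inside a
  formula, the type \<^typ>\<open>'b\<close> in which the carriers of the test modules live is a parameter;
  it must be large enough (at least as large as the ring) for the notion to be meaningful.
\<close>

definition injective_module ::
    "'b itself \<Rightarrow> ('r::ring_1, 'm, 'z) module_scheme \<Rightarrow> bool" where
  "injective_module _ M \<longleftrightarrow> left_module M \<and>
     (\<forall>(A :: ('r, 'b) module) (B :: ('r, 'b) module) i g.
        left_module A \<and> left_module B \<and>
        i \<in> module_hom A B \<and> inj_on i (carrier A) \<and> g \<in> module_hom A M \<longrightarrow>
        (\<exists>h\<in>module_hom B M. \<forall>x\<in>carrier A. h (i x) = g x))"

definition left_submodule :: "'a set \<Rightarrow> ('r, 'a, 'z) module_scheme \<Rightarrow> bool" where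
  "left_submodule N M \<longleftrightarrow>
     additive_subgroup N M \<and> (\<forall>r. \<forall>x\<in>N. r \<odot>\<^bsub>M\<^esub> x \<in> N)"

definition direct_summand :: "'a set \<Rightarrow> ('r, 'a, 'z) module_scheme \<Rightarrow> bool" where
  "direct_summand N M \<longleftrightarrow> left_submodule N M \<and>
     (\<exists>N'. left_submodule N' M \<and> N <+>\<^bsub>M\<^esub> N' = carrier M \<and> N \<inter> N' = {\<zero>\<^bsub>M\<^esub>})"

definition quotient_module ::
    "('r, 'a, 'z) module_scheme \<Rightarrow> 'a set \<Rightarrow> ('r, 'a set) module" where
  "quotient_module M N = \<lparr>
     carrier = a_rcosets\<^bsub>M\<^esub> N, monoid.mult = undefined, monoid.one = undefined,
     zero = N, add = set_add M,
     module.smult = (\<lambda>r X. \<Union>x\<in>X. N +>\<^bsub>M\<^esub> (r \<odot>\<^bsub>M\<^esub> x))\<rparr>"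

definition regular_module :: "('r::ring_1, 'r) module" where
  "regular_module = \<lparr>
     carrier = UNIV, monoid.mult = (*), monoid.one = 1, zero = 0, add = (+), module.smult = (*)\<rparr>"

definition binary_direct_sum ::
    "('r, 'a, 'y) module_scheme \<Rightarrow> ('r, 'b, 'z) module_scheme \<Rightarrow> ('r, 'a \<times> 'b) module" where
  "binary_direct_sum M N = \<lparr>
     carrier = carrier M \<times> carrier N, monoid.mult = undefined, monoid.one = undefined,
     zero = (\<zero>\<^bsub>M\<^esub>, \<zero>\<^bsub>N\<^esub>),
     add = (\<lambda>(x, y) (x', y'). (x \<oplus>\<^bsub>M\<^esub> x', y \<oplus>\<^bsub>N\<^esub> y')),
     module.smult = (\<lambda>r (x, y). (r \<odot>\<^bsub>M\<^esub> x, r \<odot>\<^bsub>N\<^esub> y))\<rparr>"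

definition direct_product ::
    "'i set \<Rightarrow> ('i \<Rightarrow> ('r, 'a, 'z) module_scheme) \<Rightarrow> ('r, 'i \<Rightarrow> 'a) module" where
  "direct_product I M = \<lparr>
     carrier = (\<Pi>\<^sub>E i\<in>I. carrier (M i)), monoid.mult = undefined, monoid.one = undefined,
     zero = (\<lambda>i\<in>I. \<zero>\<^bsub>M i\<^esub>),
     add = (\<lambda>x y. \<lambda>i\<in>I. x i \<oplus>\<^bsub>M i\<^esub> y i),
     module.smult = (\<lambda>r x. \<lambda>i\<in>I. r \<odot>\<^bsub>M i\<^esub> x i)\<rparr>"

definition direct_sum ::
    "'i set \<Rightarrow> ('i \<Rightarrow> ('r, 'a, 'z) module_scheme) \<Rightarrow> ('r, 'i \<Rightarrow> 'a) module" where
  "direct_sum I M = (direct_product I M)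
     \<lparr>carrier := {x \<in> \<Pi>\<^sub>E i\<in>I. carrier (M i). finite {i\<in>I. x i \<noteq> \<zero>\<^bsub>M i\<^esub>}}\<rparr>"

text \<open>
  Direct limits over a directed index set: the disjoint union of the modules modulo the relation
  of becoming equal at a later stage.
\<close>

definition limit_rel ::
    "'i::order set \<Rightarrow> ('i \<Rightarrow> ('r, 'a, 'z) module_scheme) \<Rightarrow> ('i \<Rightarrow> 'i \<Rightarrow> 'a \<Rightarrow> 'a)
      \<Rightarrow> (('i \<times> 'a) \<times> ('i \<times> 'a)) set" where
  "limit_rel I M \<psi> = {((i, x), (j, y)).
     i \<in> I \<and> x \<in> carrier (M i) \<and> j \<in> I \<and> y \<in> carrier (M j) \<and>
     (\<exists>l\<in>I. i \<le> l \<and> j \<le> l \<and> \<psi> i l x = \<psi> j l y)}"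

definition direct_limit ::
    "'i::order set \<Rightarrow> ('i \<Rightarrow> ('r, 'a, 'z) module_scheme) \<Rightarrow> ('i \<Rightarrow> 'i \<Rightarrow> 'a \<Rightarrow> 'a)
      \<Rightarrow> ('r, ('i \<times> 'a) set) module" where
  "direct_limit I M \<psi> = \<lparr>
     carrier = (SIGMA i:I. carrier (M i)) // limit_rel I M \<psi>,
     monoid.mult = undefined, monoid.one = undefined,
     zero = (\<Union>i\<in>I. limit_rel I M \<psi> `` {(i, \<zero>\<^bsub>M i\<^esub>)}),
     add = (\<lambda>X Y. \<Union>(i, x)\<in>X. \<Union>(j, y)\<in>Y. \<Union>l\<in>{l\<in>I. i \<le> l \<and> j \<le> l}.
       limit_rel I M \<psi> `` {(l, \<psi> i l x \<oplus>\<^bsub>M l\<^esub> \<psi> j l y)}),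
     module.smult = (\<lambda>r X. \<Union>(i, x)\<in>X. limit_rel I M \<psi> `` {(i, r \<odot>\<^bsub>M i\<^esub> x)})\<rparr>"


section \<open>The Leavitt path algebra of the Toeplitz graph\<close>

text \<open>
  The free unital algebra on a set of letters is the monoid algebra of the free monoid of words,
  with the convolution product of \<^typ>\<open>'a \<Rightarrow>\<^sub>0 'b\<close>.  Addition of words is concatenation.
\<close>

datatype gen = Gv | Gw | Gc | Gd | Gcs | Gds

datatype word = Word (letters: "gen list")

instantiation word :: monoid_add
begin

definition zero_word :: word where "0 = Word []"

definition plus_word :: "word \<Rightarrow> word \<Rightarrow> word" where
  "p + q = Word (letters p @ letters q)"

instance
  by standard (simp_all add: zero_word_def plus_word_def)

end

definition letter :: "gen \<Rightarrow> word \<Rightarrow>\<^sub>0 'k::field" where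
  "letter g = Poly_Mapping.single (Word [g]) 1"

text \<open>Each relation \<open>p = q\<close> of the presentation contributes the relator \<open>p - q\<close>.\<close>

definition relators :: "(word \<Rightarrow>\<^sub>0 'k::field) set" where
  "relators =
    (let v = letter Gv; w = letter Gw; c = letter Gc; d = letter Gd;
         c' = letter Gcs; d' = letter Gds
     in {v * v - v, w * w - w, v * w, w * v, v + w - 1,
         c - v * c, c - c * v, c' - v * c', c' - c' * v,
         d - v * d, d - d * w, d' - w * d', d' - d' * v,
         c' * c - v, d' * d - w, c' * d, d' * c, c * c' + d * d' - v})"

inductive_set two_sided_ideal :: "'a::ring_1 set \<Rightarrow> 'a set" for S where
  zero: "0 \<in> two_sided_ideal S"
| generator: "s \<in> S \<Longrightarrow> a * s * b \<in> two_sided_ideal S"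
| add: "p \<in> two_sided_ideal S \<Longrightarrow> q \<in> two_sided_ideal S \<Longrightarrow> p + q \<in> two_sided_ideal S"

lemma two_sided_ideal_mult:
  assumes "p \<in> two_sided_ideal S"
  shows "a * p * b \<in> two_sided_ideal S"
  using assms
proof induction
  case (generator s a' b')
  then show ?case
    using two_sided_ideal.generator[of s S "a * a'" "b' * b"] by (simp add: mult.assoc)
qed (auto simp: distrib_left distrib_right intro: two_sided_ideal.intros)

lemma two_sided_ideal_uminus: "p \<in> two_sided_ideal S \<Longrightarrow> - p \<in> two_sided_ideal S"
  using two_sided_ideal_mult[of p S "-1" 1] by simp

lemma two_sided_ideal_lmult: "p \<in> two_sided_ideal S \<Longrightarrow> a * p \<in> two_sided_ideal S"
  using two_sided_ideal_mult[of p S a 1] by simp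

lemma two_sided_ideal_rmult: "p \<in> two_sided_ideal S \<Longrightarrow> p * b \<in> two_sided_ideal S"
  using two_sided_ideal_mult[of p S 1 b] by simp

definition leavitt_rel :: "(word \<Rightarrow>\<^sub>0 'k::field) \<Rightarrow> (word \<Rightarrow>\<^sub>0 'k) \<Rightarrow> bool" where
  "leavitt_rel p q \<longleftrightarrow> p - q \<in> two_sided_ideal relators"

lemma equivp_leavitt_rel: "equivp leavitt_rel"
proof (rule equivpI)
  show "reflp leavitt_rel"
    by (simp add: reflp_def leavitt_rel_def two_sided_ideal.zero)
  show "symp leavitt_rel"
    using two_sided_ideal_uminus by (fastforce simp: symp_def leavitt_rel_def)
  show "transp leavitt_rel"
    using two_sided_ideal.add by (fastforce simp: transp_def leavitt_rel_def)
qed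

quotient_type (overloaded) 'k leavitt = "word \<Rightarrow>\<^sub>0 'k::field" / leavitt_rel
  by (rule equivp_leavitt_rel)


subsection \<open>The space of formal series as a representation of the free algebra\<close>

text \<open>
  The series \<open>k\<^sub>-\<^sub>1 w + k\<^sub>0 d + k\<^sub>1 c d + k\<^sub>2 c\<^sup>2 d + \<dots>\<close> is encoded by the function \<open>y\<close> with
  \<open>y 0 = k\<^sub>-\<^sub>1\<close> and \<open>y (Suc i) = k\<^sub>i\<close>.
\<close>

fun series_gen :: "gen \<Rightarrow> (nat \<Rightarrow> 'k::field) \<Rightarrow> nat \<Rightarrow> 'k" where
  "series_gen Gc y n = (case n of 0 \<Rightarrow> 0 | Suc 0 \<Rightarrow> 0 | Suc (Suc i) \<Rightarrow> y (Suc i))"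
| "series_gen Gcs y n = (case n of 0 \<Rightarrow> 0 | Suc i \<Rightarrow> y (Suc (Suc i)))"
| "series_gen Gd y n = (if n = Suc 0 then y 0 else 0)"
| "series_gen Gds y n = (if n = 0 then y (Suc 0) else 0)"
| "series_gen Gv y n = (if n = 0 then 0 else y n)"
| "series_gen Gw y n = (if n = 0 then y 0 else 0)"

definition series_word :: "word \<Rightarrow> (nat \<Rightarrow> 'k::field) \<Rightarrow> nat \<Rightarrow> 'k" where
  "series_word u y = foldr series_gen (letters u) y"

definition series_free :: "(word \<Rightarrow>\<^sub>0 'k::field) \<Rightarrow> (nat \<Rightarrow> 'k) \<Rightarrow> nat \<Rightarrow> 'k" where
  "series_free p y n =
     (\<Sum>u\<in>Poly_Mapping.keys p. Poly_Mapping.lookup p u * series_word u y n)"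

lemma series_gen_add:
  "series_gen g (\<lambda>n. y n + z n) = (\<lambda>n. series_gen g y n + series_gen g z n)"
  by (cases g) (auto simp: fun_eq_iff split: nat.splits)

lemma series_gen_scale: "series_gen g (\<lambda>n. a * y n) = (\<lambda>n. a * series_gen g y n)"
  by (cases g) (auto simp: fun_eq_iff split: nat.splits)

lemma series_word_zero [simp]: "series_word 0 y = y"
  by (simp add: series_word_def zero_word_def)

lemma series_word_plus: "series_word (p + q) y = series_word p (series_word q y)"
  by (simp add: series_word_def plus_word_def)

lemma series_word_add:
  "series_word u (\<lambda>n. y n + z n) = (\<lambda>n. series_word u y n + series_word u z n)"
proof -
  have "foldr series_gen gs (\<lambda>n. y n + z n) =
      (\<lambda>n. foldr series_gen gs y n + foldr series_gen gs z n)" for gs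
    by (induction gs) (simp_all add: series_gen_add)
  then show ?thesis by (simp add: series_word_def)
qed

lemma series_word_scale: "series_word u (\<lambda>n. a * y n) = (\<lambda>n. a * series_word u y n)"
proof -
  have "foldr series_gen gs (\<lambda>n. a * y n) = (\<lambda>n. a * foldr series_gen gs y n)" for gs
    by (induction gs) (simp_all add: series_gen_scale)
  then show ?thesis by (simp add: series_word_def)
qed

lemma series_free_superset:
  assumes "finite U" "Poly_Mapping.keys p \<subseteq> U"
  shows "series_free p y n = (\<Sum>u\<in>U. Poly_Mapping.lookup p u * series_word u y n)"
  unfolding series_free_def
  by (rule sum.mono_neutral_left) (use assms in \<open>auto simp: in_keys_iff\<close>)

lemma series_free_zero [simp]: "series_free 0 y = (\<lambda>_. 0)"
  by (simp add: series_free_def fun_eq_iff)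

lemma series_free_add: "series_free (p + q) y = (\<lambda>n. series_free p y n + series_free q y n)"
proof
  fix n
  let ?U = "Poly_Mapping.keys p \<union> Poly_Mapping.keys q"
  have "Poly_Mapping.keys (p + q) \<subseteq> ?U" by (rule keys_add)
  then show "series_free (p + q) y n = series_free p y n + series_free q y n"
    by (simp add: series_free_superset[of ?U] lookup_add distrib_right sum.distrib)
qed

lemma series_free_single:
  "series_free (Poly_Mapping.single u a) y = (\<lambda>n. a * series_word u y n)"
  by (simp add: series_free_def fun_eq_iff)

lemma series_free_one [simp]: "series_free 1 y = y"
  using series_free_single[of 0 1 y] by simp

lemma series_free_uminus: "series_free (- p) y = (\<lambda>n. - series_free p y n)"
  using series_free_add[of p "- p" y] by (simp add: fun_eq_iff eq_neg_iff_add_eq_0 add.commute)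

lemma series_free_diff: "series_free (p - q) y = (\<lambda>n. series_free p y n - series_free q y n)"
  using series_free_add[of p "- q" y] by (simp add: series_free_uminus)

lemma free_algebra_induct [case_names zero single add]:
  assumes "P 0" "\<And>u a. P (Poly_Mapping.single u a)" "\<And>p q. P p \<Longrightarrow> P q \<Longrightarrow> P (p + q)"
  shows "P (p :: 'w \<Rightarrow>\<^sub>0 'k::field)"
proof -
  have "P (\<Sum>u\<in>U. Poly_Mapping.single u (Poly_Mapping.lookup p u))" if "finite U" for U
    using that by induction (simp_all add: assms)
  then have "P (\<Sum>u\<in>Poly_Mapping.keys p. Poly_Mapping.single u (Poly_Mapping.lookup p u))"
    by simp
  also have "(\<Sum>u\<in>Poly_Mapping.keys p. Poly_Mapping.single u (Poly_Mapping.lookup p u)) = p"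
    by (rule poly_mapping_eqI)
      (simp add: lookup_sum lookup_single when_def in_keys_iff)
  finally show ?thesis .
qed

lemma series_free_add_right:
  "series_free p (\<lambda>n. y n + z n) = (\<lambda>n. series_free p y n + series_free p z n)"
  by (simp add: series_free_def series_word_add distrib_left sum.distrib fun_eq_iff)

lemma series_free_scale_right: "series_free p (\<lambda>n. a * y n) = (\<lambda>n. a * series_free p y n)"
  by (simp add: series_free_def series_word_scale sum_distrib_left mult.left_commute fun_eq_iff)

lemma series_free_zero_right [simp]: "series_free p (\<lambda>_. 0) = (\<lambda>_. 0)"
  using series_free_scale_right[of p 0 "\<lambda>_. 0"] by simp

lemma series_free_mult: "series_free (p * q) y = series_free p (series_free q y)"
proof (induction p rule: free_algebra_induct)
  case (single u a)
  show ?case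
  proof (induction q rule: free_algebra_induct)
    case (single u' b)
    show ?case
      by (simp add: mult_single series_free_single series_word_plus series_word_scale mult.assoc)
  qed (simp_all add: distrib_left series_free_add series_free_add_right)
qed (simp_all add: distrib_right series_free_add)

lemma series_free_relator:
  assumes "p \<in> relators"
  shows "series_free p y = (\<lambda>_. 0)"
proof -
  have *: "series_free (letter g) y = series_gen g y" for g y
    by (simp add: letter_def series_free_single series_word_def)
  show ?thesis
    using assms unfolding relators_def Let_def
    by (auto simp: series_free_diff series_free_add series_free_mult * fun_eq_iff
        split: nat.splits)
qed

lemma series_free_ideal:
  assumes "p \<in> two_sided_ideal relators"
  shows "series_free p y = (\<lambda>_. 0)"
  using assms by induction (simp_all add: series_free_mult series_free_relator series_free_add)

instantiation leavitt :: (field) ring_1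
begin

lift_definition zero_leavitt :: "'a leavitt" is 0 .

lift_definition one_leavitt :: "'a leavitt" is 1 .

lift_definition plus_leavitt :: "'a leavitt \<Rightarrow> 'a leavitt \<Rightarrow> 'a leavitt" is "(+)"
  unfolding leavitt_rel_def by (metis add_diff_add two_sided_ideal.add)

lift_definition uminus_leavitt :: "'a leavitt \<Rightarrow> 'a leavitt" is uminus
  unfolding leavitt_rel_def by (metis minus_diff_minus two_sided_ideal_uminus)

lift_definition minus_leavitt :: "'a leavitt \<Rightarrow> 'a leavitt \<Rightarrow> 'a leavitt" is "(-)"
proof -
  fix p p' q q' :: "word \<Rightarrow>\<^sub>0 'a"
  assume "leavitt_rel p p'" "leavitt_rel q q'"
  then have "(p - p') + - (q - q') \<in> two_sided_ideal relators"
    unfolding leavitt_rel_def by (metis two_sided_ideal.add two_sided_ideal_uminus)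
  then show "leavitt_rel (p - q) (p' - q')"
    by (simp add: leavitt_rel_def algebra_simps)
qed

lift_definition times_leavitt :: "'a leavitt \<Rightarrow> 'a leavitt \<Rightarrow> 'a leavitt" is "(*)"
proof -
  fix p p' q q' :: "word \<Rightarrow>\<^sub>0 'a"
  assume "leavitt_rel p p'" "leavitt_rel q q'"
  then have "(p - p') * q + p' * (q - q') \<in> two_sided_ideal relators"
    unfolding leavitt_rel_def
    by (metis two_sided_ideal.add two_sided_ideal_lmult two_sided_ideal_rmult)
  then show "leavitt_rel (p * q) (p' * q')"
    by (simp add: leavitt_rel_def algebra_simps)
qed

instance
proof
  fix a b c :: "'a leavitt"
  have eq: "leavitt_rel p p" for p :: "word \<Rightarrow>\<^sub>0 'a"
    using equivp_leavitt_rel by (rule equivp_reflp)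
  show "a + b + c = a + (b + c)" by transfer (simp add: eq add.assoc)
  show "a + b = b + a" by transfer (simp add: eq add.commute)
  show "0 + a = a" by transfer (simp add: eq)
  show "- a + a = 0" by transfer (simp add: eq)
  show "a - b = a + - b" by transfer (simp add: eq)
  show "a * b * c = a * (b * c)" by transfer (simp add: eq mult.assoc)
  show "1 * a = a" by transfer (simp add: eq)
  show "a * 1 = a" by transfer (simp add: eq)
  show "(a + b) * c = a * c + b * c" by transfer (simp add: eq distrib_right)
  show "a * (b + c) = a * b + a * c" by transfer (simp add: eq distrib_left)
  show "(0 :: 'a leavitt) \<noteq> 1"
  proof transfer
    show "\<not> leavitt_rel (0 :: word \<Rightarrow>\<^sub>0 'a) 1"
    proof
      assume "leavitt_rel (0 :: word \<Rightarrow>\<^sub>0 'a) 1"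
      then have "- (0 - 1) \<in> two_sided_ideal (relators :: (word \<Rightarrow>\<^sub>0 'a) set)"
        unfolding leavitt_rel_def by (rule two_sided_ideal_uminus)
      then show False
        using series_free_ideal[of 1 "\<lambda>_. 1 :: 'a"] by (simp add: fun_eq_iff)
    qed
  qed
qed

end

lift_definition leavitt_scalar :: "'k::field \<Rightarrow> 'k leavitt" is "Poly_Mapping.single 0" .

lift_definition leavitt_c :: "'k::field leavitt" is "letter Gc" .

definition eval_c :: "'k::field poly \<Rightarrow> 'k leavitt" where
  "eval_c g = (\<Sum>i\<le>degree g. leavitt_scalar (coeff g i) * leavitt_c ^ i)"


section \<open>The module \<open>C\<close>\<close>

lift_definition series_smult :: "'k::field leavitt \<Rightarrow> (nat \<Rightarrow> 'k) \<Rightarrow> nat \<Rightarrow> 'k" is series_free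
proof -
  fix p q :: "word \<Rightarrow>\<^sub>0 'k"
  assume "leavitt_rel p q"
  then have "series_free (p - q) y = (\<lambda>_. 0)" for y
    unfolding leavitt_rel_def by (rule series_free_ideal)
  then show "series_free p = series_free q"
    by (simp add: series_free_diff fun_eq_iff)
qed

definition Y_module :: "('k::field leavitt, nat \<Rightarrow> 'k) module" where
  "Y_module = \<lparr>
     carrier = UNIV, monoid.mult = undefined, monoid.one = undefined,
     zero = (\<lambda>_. 0), add = (\<lambda>y z n. y n + z n), module.smult = series_smult\<rparr>"

definition F_polys :: "'k::field poly set" where
  "F_polys = {f. irreducible f \<and> poly f 0 = -1}"

definition left_ideal_of :: "'k::field poly \<Rightarrow> nat \<Rightarrow> 'k leavitt set" where
  "left_ideal_of f n = range (\<lambda>r. r * eval_c (f ^ n))"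

definition M_module :: "'k::field poly \<Rightarrow> nat \<Rightarrow> ('k leavitt, 'k leavitt set) module" where
  "M_module f n = quotient_module regular_module (left_ideal_of f n)"

text \<open>
  The \<open>R\<close>-linear map with \<open>1 + R f\<^sup>i(c) \<mapsto> f\<^sup>l\<^sup>-\<^sup>i(c) + R f\<^sup>l(c)\<close> sends \<open>r + R f\<^sup>i(c)\<close> to
  \<open>r f\<^sup>l\<^sup>-\<^sup>i(c) + R f\<^sup>l(c)\<close>; all representatives \<open>r\<close> of a coset yield the same value.
\<close>

definition M_map ::
    "'k::field poly \<Rightarrow> nat \<Rightarrow> nat \<Rightarrow> 'k leavitt set \<Rightarrow> 'k leavitt set" where
  "M_map f i l X =
     (\<Union>r\<in>X. left_ideal_of f l +>\<^bsub>regular_module\<^esub> (r * eval_c (f ^ (l - i))))"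

definition U_module :: "'k::field poly \<Rightarrow> ('k leavitt, (nat \<times> 'k leavitt set) set) module" where
  "U_module f = direct_limit {1..} (M_module f) (M_map f)"

definition C_module ::
    "('k::field leavitt, (nat \<Rightarrow> 'k) \<times> ('k poly \<Rightarrow> (nat \<times> 'k leavitt set) set)) module" where
  "C_module = binary_direct_sum Y_module (direct_sum F_polys U_module)"

end

theory Submission
  imports Defs
begin

text \<open>
  Put \<open>y = c + d\<close> and \<open>x = c\<^sup>* + d\<^sup>*\<close>.  Then \<open>x y = 1\<close> and \<open>y x = 1 - w\<close>, and these two elements
  generate the algebra \<open>R\<close>: it is \<open>K\<langle>x, y | x y = 1\<rangle>\<close>, the algebra of an injective shift and its
  left inverse.  On a module that \<open>w\<close> annihilates, \<open>y\<close> is invertible, and the module is one over the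
  Laurent polynomials in \<open>y\<close>; what \<open>w\<close> does not annihilate is governed by the simple module \<open>R w\<close>.
  The two parts of \<open>C\<close> take care of these two kinds of behaviour.

  The theorem follows from two properties of \<open>C\<close>.  It is injective, and it is a cogenerator: an
  element \<open>m \<noteq> 0\<close> of any module is mapped to something nonzero by some homomorphism into \<open>C\<close>.  The
  second property embeds every module in a power of \<open>C\<close>, and an injective module splits off where it
  is embedded.  Conversely, products and direct summands of injective modules are injective.
  Injectivity is used throughout in the form of Baer's condition (\<open>baer_module\<close>), which refers only to
  left ideals; this makes it independent of the type in which the test modules live, provided that
  the ring fits into that type.

  Injectivity of \<open>Y\<close> (\<open>baer_Y\<close>): a homomorphism into \<open>Y\<close> is determined by the linear functional that
  reads off the coefficient of \<open>w\<close>, because \<open>x\<close> shifts the other coefficients there.  So extending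
  homomorphisms amounts to extending linear functionals.

  Injectivity of the sum of the \<open>U\<^sup>f\<close> (\<open>baer_if_divisible\<close>): \<open>R\<close> is not left noetherian, so direct
  sums need not inherit injectivity.  Divisibility is inherited, however, and it suffices for a
  module on which \<open>y\<close> is invertible.  Indeed, for every \<open>r\<close> some \<open>x\<^sup>n r\<close> is a polynomial in \<open>x\<close>, so
  a homomorphism on a left ideal is controlled by its values on the polynomials in \<open>x\<close> that the ideal
  contains; they form a principal ideal of \<open>K[x]\<close>, and one division yields the required element.

  Cogeneration (\<open>C_cogenerator\<close>): if \<open>w r m \<noteq> 0\<close> for some \<open>r\<close>, then \<open>w r m\<close> has the same annihilator
  as \<open>w \<in> Y\<close>.  Otherwise \<open>y\<close> is invertible on \<open>R m\<close>; the polynomials \<open>p\<close> with \<open>p(y) m = 0\<close> form a proper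
  ideal, and an irreducible factor \<open>f\<close> of its generator provides an element of \<open>U\<^sup>f\<close> that is
  annihilated by everything that annihilates \<open>m\<close>.
\<close>

section \<open>Left modules\<close>

text \<open>
  Negatives need not be supplied: \<open>(- 1) x\<close> is one as soon as \<open>0 x = 0\<close>.
\<close>

lemma left_moduleI:
  fixes M :: "('r::ring_1, 'a, 'z) module_scheme" (structure)
  assumes add_closed: "\<And>x y. \<lbrakk>x \<in> carrier M; y \<in> carrier M\<rbrakk> \<Longrightarrow> x \<oplus> y \<in> carrier M"
    and zero_closed: "\<zero> \<in> carrier M"
    and add_assoc: "\<And>x y z. \<lbrakk>x \<in> carrier M; y \<in> carrier M; z \<in> carrier M\<rbrakk>
      \<Longrightarrow> (x \<oplus> y) \<oplus> z = x \<oplus> (y \<oplus> z)"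
    and add_comm: "\<And>x y. \<lbrakk>x \<in> carrier M; y \<in> carrier M\<rbrakk> \<Longrightarrow> x \<oplus> y = y \<oplus> x"
    and add_zero: "\<And>x. x \<in> carrier M \<Longrightarrow> \<zero> \<oplus> x = x"
    and closed: "\<And>r x. x \<in> carrier M \<Longrightarrow> r \<odot> x \<in> carrier M"
    and l_distr: "\<And>r s x. x \<in> carrier M \<Longrightarrow> (r + s) \<odot> x = r \<odot> x \<oplus> s \<odot> x"
    and r_distr: "\<And>r x y. \<lbrakk>x \<in> carrier M; y \<in> carrier M\<rbrakk>
      \<Longrightarrow> r \<odot> (x \<oplus> y) = r \<odot> x \<oplus> r \<odot> y"
    and assoc: "\<And>r s x. x \<in> carrier M \<Longrightarrow> (r * s) \<odot> x = r \<odot> (s \<odot> x)"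
    and one: "\<And>x. x \<in> carrier M \<Longrightarrow> 1 \<odot> x = x"
    and zero: "\<And>x. x \<in> carrier M \<Longrightarrow> 0 \<odot> x = \<zero>"
  shows "left_module M"
proof -
  have "\<exists>y\<in>carrier M. y \<oplus> x = \<zero>" if "x \<in> carrier M" for x
  proof
    show "(- 1) \<odot> x \<oplus> x = \<zero>"
      using l_distr[of x "- 1" 1] one zero that by simp
  qed (use closed that in auto)
  then have "abelian_group M"
    by (intro abelian_groupI) (use assms in auto)
  then show ?thesis
    by (intro left_module.intro left_module_axioms.intro) (use assms in auto)
qed

context left_module
begin

lemma smult_zero_left: "x \<in> carrier M \<Longrightarrow> 0 \<odot> x = \<zero>"
  using smult_l_distr[of x 0 0] by (simp add: smult_closed)

lemma smult_zero_right: "r \<odot> \<zero> = \<zero>"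
  using smult_assoc[of \<zero> r 0] by (simp add: smult_zero_left)

lemma smult_minus_one: "x \<in> carrier M \<Longrightarrow> (- 1) \<odot> x = \<ominus> x"
  using smult_l_distr[of x "- 1" 1] smult_closed[of x "- 1"]
  by (simp add: smult_zero_left smult_one minus_equality)

lemma smult_uminus: "x \<in> carrier M \<Longrightarrow> (- r) \<odot> x = \<ominus> (r \<odot> x)"
  using smult_assoc[of x "- 1" r] by (simp add: smult_minus_one smult_closed)

lemma smult_diff: "x \<in> carrier M \<Longrightarrow> (r - s) \<odot> x = r \<odot> x \<ominus> s \<odot> x"
  using smult_l_distr[of x r "- s"] by (simp add: smult_uminus a_minus_def)

lemma minus_eq_zeroD:
  assumes "x \<ominus> y = \<zero>" "x \<in> carrier M" "y \<in> carrier M"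
  shows "x = y"
  using minus_equality[of x "\<ominus> y"] assms by (simp add: a_minus_def)

lemma left_submoduleI:
  assumes "N \<subseteq> carrier M" "\<zero> \<in> N"
    and "\<And>x y. \<lbrakk>x \<in> N; y \<in> N\<rbrakk> \<Longrightarrow> x \<oplus> y \<in> N"
    and "\<And>r x. x \<in> N \<Longrightarrow> r \<odot> x \<in> N"
  shows "left_submodule N M"
proof -
  have "\<ominus> x \<in> N" if "x \<in> N" for x
    using assms(1) assms(4)[of x "- 1"] smult_minus_one[of x] that by auto
  then have "subgroup N (add_monoid M)"
    using assms by (intro subgroup.intro) (auto simp: a_inv_def[symmetric])
  then show ?thesis
    using assms by (simp add: left_submodule_def additive_subgroup_def)
qed

end

lemma left_submoduleD:
  assumes "left_submodule N M"
  shows "N \<subseteq> carrier M" "\<zero>\<^bsub>M\<^esub> \<in> N"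
    and "\<And>x y. \<lbrakk>x \<in> N; y \<in> N\<rbrakk> \<Longrightarrow> x \<oplus>\<^bsub>M\<^esub> y \<in> N"
    and "\<And>r x. x \<in> N \<Longrightarrow> r \<odot>\<^bsub>M\<^esub> x \<in> N"
proof -
  interpret additive_subgroup N M using assms by (simp add: left_submodule_def)
  show "N \<subseteq> carrier M" "\<zero>\<^bsub>M\<^esub> \<in> N"
    "\<And>x y. \<lbrakk>x \<in> N; y \<in> N\<rbrakk> \<Longrightarrow> x \<oplus>\<^bsub>M\<^esub> y \<in> N"
    by (auto simp: a_subset)
  show "\<And>r x. x \<in> N \<Longrightarrow> r \<odot>\<^bsub>M\<^esub> x \<in> N"
    using assms by (simp add: left_submodule_def)
qed

lemma left_module_restrict:
  assumes "left_module M" "left_submodule N M"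
  shows "left_module (M\<lparr>carrier := N\<rparr>)"
proof -
  interpret left_module M by fact
  note N = left_submoduleD[OF assms(2)]
  then have "x \<in> carrier M" if "x \<in> N" for x using that by auto
  with N show ?thesis
    by (intro left_moduleI) (auto simp: a_ac smult_l_distr smult_r_distr
        smult_assoc smult_one smult_zero_left)
qed

lemma module_homI:
  assumes "\<And>x. x \<in> carrier M \<Longrightarrow> h x \<in> carrier N"
    and "\<And>x y. \<lbrakk>x \<in> carrier M; y \<in> carrier M\<rbrakk> \<Longrightarrow> h (x \<oplus>\<^bsub>M\<^esub> y) = h x \<oplus>\<^bsub>N\<^esub> h y"
    and "\<And>r x. x \<in> carrier M \<Longrightarrow> h (r \<odot>\<^bsub>M\<^esub> x) = r \<odot>\<^bsub>N\<^esub> h x"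
  shows "h \<in> module_hom M N"
  using assms by (auto simp: module_hom_def)

lemma module_homD:
  assumes "h \<in> module_hom M N"
  shows "x \<in> carrier M \<Longrightarrow> h x \<in> carrier N"
    and "\<lbrakk>x \<in> carrier M; y \<in> carrier M\<rbrakk> \<Longrightarrow> h (x \<oplus>\<^bsub>M\<^esub> y) = h x \<oplus>\<^bsub>N\<^esub> h y"
    and "x \<in> carrier M \<Longrightarrow> h (r \<odot>\<^bsub>M\<^esub> x) = r \<odot>\<^bsub>N\<^esub> h x"
  using assms by (auto simp: module_hom_def)

lemma module_hom_compose:
  assumes "h \<in> module_hom A B" "g \<in> module_hom B C"
  shows "(\<lambda>x. g (h x)) \<in> module_hom A C"
  using assms by (auto simp: module_hom_def Pi_iff)

lemma module_hom_zero:
  assumes "left_module M" "left_module N" "h \<in> module_hom M N"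
  shows "h \<zero>\<^bsub>M\<^esub> = \<zero>\<^bsub>N\<^esub>"
proof -
  interpret M: left_module M by fact
  interpret N: left_module N by fact
  show ?thesis
    using module_homD[OF assms(3)] M.smult_zero_left N.smult_zero_left
    by (metis M.zero_closed)
qed

lemma module_hom_minus:
  assumes "left_module M" "left_module N" "h \<in> module_hom M N"
    and "x \<in> carrier M" "y \<in> carrier M"
  shows "h (x \<ominus>\<^bsub>M\<^esub> y) = h x \<ominus>\<^bsub>N\<^esub> h y"
proof -
  interpret M: left_module M by fact
  interpret N: left_module N by fact
  show ?thesis
    using assms(4,5) module_homD[OF assms(3)] M.smult_closed
    by (simp add: a_minus_def flip: M.smult_minus_one N.smult_minus_one)
qed

lemma regular_module_sel [simp]:
  "carrier regular_module = UNIV" "zero regular_module = 0" "add regular_module = (+)"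
  "module.smult regular_module = (*)"
  by (simp_all add: regular_module_def)

lemma left_module_regular: "left_module regular_module"
  by (rule left_moduleI) (simp_all add: algebra_simps)

lemma left_ideal_minus:
  assumes "left_submodule I regular_module" "r \<in> I" "s \<in> I"
  shows "r - s \<in> I"
  using left_submoduleD(3)[OF assms(1,2), of "- s"] left_submoduleD(4)[OF assms(1,3), of "- 1"]
  by simp

lemma direct_product_sel [simp]:
  "carrier (direct_product I M) = (\<Pi>\<^sub>E i\<in>I. carrier (M i))"
  "zero (direct_product I M) = (\<lambda>i\<in>I. \<zero>\<^bsub>M i\<^esub>)"
  "add (direct_product I M) = (\<lambda>x y. \<lambda>i\<in>I. x i \<oplus>\<^bsub>M i\<^esub> y i)"
  "module.smult (direct_product I M) = (\<lambda>r x. \<lambda>i\<in>I. r \<odot>\<^bsub>M i\<^esub> x i)"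
  by (simp_all add: direct_product_def)

lemma left_module_direct_product:
  assumes "\<And>i. i \<in> I \<Longrightarrow> left_module (M i)"
  shows "left_module (direct_product I M)"
proof -
  have grp: "abelian_group (M i)" if "i \<in> I" for i
    using assms[OF that] by (rule left_module.axioms)
  have mon: "abelian_monoid (M i)" if "i \<in> I" for i
    using grp[OF that] by (rule abelian_group.axioms)
  have l_zero: "\<zero>\<^bsub>M i\<^esub> \<oplus>\<^bsub>M i\<^esub> x i = x i" and one: "1 \<odot>\<^bsub>M i\<^esub> x i = x i"
    if "x \<in> (\<Pi>\<^sub>E i\<in>I. carrier (M i))" "i \<in> I" for x i
    using abelian_monoid.l_zero[OF mon] left_module.smult_one[OF assms] PiE_mem[OF that] that(2)
    by blast+
  show ?thesis
  proof (rule left_moduleI, goal_cases)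
    case (4 x y)
    then show ?case by (auto simp: fun_eq_iff PiE_iff intro: abelian_monoid.a_comm[OF mon])
  next
    case (5 x)
    then have x: "x \<in> (\<Pi>\<^sub>E i\<in>I. carrier (M i))" by simp
    show ?case using l_zero[OF x] PiE_arb[OF x] by (simp add: fun_eq_iff)
  next
    case (10 x)
    then have x: "x \<in> (\<Pi>\<^sub>E i\<in>I. carrier (M i))" by simp
    show ?case using one[OF x] PiE_arb[OF x] by (simp add: fun_eq_iff)
  qed (auto simp: fun_eq_iff PiE_iff assms left_module.smult_closed left_module.smult_l_distr
      left_module.smult_r_distr left_module.smult_assoc left_module.smult_zero_left
      abelian_monoid.a_closed[OF mon] abelian_monoid.zero_closed[OF mon]
      abelian_monoid.a_assoc[OF mon])
qed

lemma direct_sum_sel [simp]: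
  "carrier (direct_sum I M) =
    {x \<in> \<Pi>\<^sub>E i\<in>I. carrier (M i). finite {i\<in>I. x i \<noteq> \<zero>\<^bsub>M i\<^esub>}}"
  "zero (direct_sum I M) = (\<lambda>i\<in>I. \<zero>\<^bsub>M i\<^esub>)"
  "add (direct_sum I M) = (\<lambda>x y. \<lambda>i\<in>I. x i \<oplus>\<^bsub>M i\<^esub> y i)"
  "module.smult (direct_sum I M) = (\<lambda>r x. \<lambda>i\<in>I. r \<odot>\<^bsub>M i\<^esub> x i)"
  by (simp_all add: direct_sum_def)

lemma left_module_direct_sum:
  assumes M: "\<And>i. i \<in> I \<Longrightarrow> left_module (M i)"
  shows "left_module (direct_sum I M)"
proof -
  have grp: "abelian_group (M i)" if "i \<in> I" for i
    using assms[OF that] by (rule left_module.axioms)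
  have mon: "abelian_monoid (M i)" if "i \<in> I" for i
    using grp[OF that] by (rule abelian_group.axioms)
  let ?P = "direct_product I M"
  let ?S = "{x \<in> \<Pi>\<^sub>E i\<in>I. carrier (M i). finite {i\<in>I. x i \<noteq> \<zero>\<^bsub>M i\<^esub>}}"
  interpret P: left_module ?P by (rule left_module_direct_product) (rule M)
  have "left_submodule ?S ?P"
  proof (rule P.left_submoduleI)
    show "\<zero>\<^bsub>?P\<^esub> \<in> ?S" using mon by (auto simp: abelian_monoid.zero_closed)
  next
    fix x y assume x: "x \<in> ?S" and y: "y \<in> ?S"
    have "finite ({i\<in>I. x i \<noteq> \<zero>\<^bsub>M i\<^esub>} \<union> {i\<in>I. y i \<noteq> \<zero>\<^bsub>M i\<^esub>})" using x y by blast
    then have "finite {i\<in>I. (x \<oplus>\<^bsub>?P\<^esub> y) i \<noteq> \<zero>\<^bsub>M i\<^esub>}"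
      by (rule rev_finite_subset)
        (use mon in \<open>auto simp: abelian_monoid.l_zero abelian_monoid.zero_closed\<close>)
    then show "x \<oplus>\<^bsub>?P\<^esub> y \<in> ?S" using P.a_closed[of x y] x y by auto
  next
    fix r x assume x: "x \<in> ?S"
    then have "finite {i\<in>I. x i \<noteq> \<zero>\<^bsub>M i\<^esub>}" by blast
    then have "finite {i\<in>I. (r \<odot>\<^bsub>?P\<^esub> x) i \<noteq> \<zero>\<^bsub>M i\<^esub>}"
      by (rule rev_finite_subset) (auto simp: left_module.smult_zero_right M)
    then show "r \<odot>\<^bsub>?P\<^esub> x \<in> ?S" using P.smult_closed[of x r] x by auto
  qed auto
  then show ?thesis
    unfolding direct_sum_def by (rule left_module_restrict[OF P.left_module_axioms])
qed

lemma binary_direct_sum_sel [simp]: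
  "carrier (binary_direct_sum M N) = carrier M \<times> carrier N"
  "zero (binary_direct_sum M N) = (\<zero>\<^bsub>M\<^esub>, \<zero>\<^bsub>N\<^esub>)"
  "add (binary_direct_sum M N) (x, y) (x', y') = (x \<oplus>\<^bsub>M\<^esub> x', y \<oplus>\<^bsub>N\<^esub> y')"
  "module.smult (binary_direct_sum M N) r (x, y) = (r \<odot>\<^bsub>M\<^esub> x, r \<odot>\<^bsub>N\<^esub> y)"
  by (simp_all add: binary_direct_sum_def)

lemma left_module_binary_direct_sum:
  assumes "left_module M" "left_module N"
  shows "left_module (binary_direct_sum M N)"
proof -
  interpret M: left_module M by fact
  interpret N: left_module N by fact
  show ?thesis
    by (rule left_moduleI)
      (auto simp: M.a_ac N.a_ac M.smult_closed N.smult_closed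
        M.smult_l_distr N.smult_l_distr M.smult_r_distr N.smult_r_distr M.smult_assoc
        N.smult_assoc M.smult_one N.smult_one M.smult_zero_left N.smult_zero_left)
qed

section \<open>Baer's criterion\<close>

definition baer_module :: "('r::ring_1, 'a, 'z) module_scheme \<Rightarrow> bool" where
  "baer_module M \<longleftrightarrow> left_module M \<and>
     (\<forall>I. \<forall>\<phi>\<in>module_hom (regular_module\<lparr>carrier := I\<rparr>) M. left_submodule I regular_module \<longrightarrow>
        (\<exists>m\<in>carrier M. \<forall>r\<in>I. \<phi> r = r \<odot>\<^bsub>M\<^esub> m))"

lemma ideal_homD:
  assumes "\<phi> \<in> module_hom (regular_module\<lparr>carrier := I\<rparr>) M"
  shows "r \<in> I \<Longrightarrow> \<phi> r \<in> carrier M"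
    and "\<lbrakk>r \<in> I; s \<in> I\<rbrakk> \<Longrightarrow> \<phi> (r + s) = \<phi> r \<oplus>\<^bsub>M\<^esub> \<phi> s"
    and "r \<in> I \<Longrightarrow> \<phi> (a * r) = a \<odot>\<^bsub>M\<^esub> \<phi> r"
  using module_homD[OF assms] by auto

lemma ideal_hom_zero:
  assumes "left_module M" "left_submodule I regular_module"
    and "\<phi> \<in> module_hom (regular_module\<lparr>carrier := I\<rparr>) M"
  shows "\<phi> 0 = \<zero>\<^bsub>M\<^esub>"
  using module_hom_zero[OF left_module_restrict[OF left_module_regular assms(2)] assms(1,3)]
  by simp

lemma baer_moduleD:
  assumes "baer_module M" "left_submodule I regular_module"
    and "\<phi> \<in> module_hom (regular_module\<lparr>carrier := I\<rparr>) M"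
  obtains m where "m \<in> carrier M" "\<And>r. r \<in> I \<Longrightarrow> \<phi> r = r \<odot>\<^bsub>M\<^esub> m"
  using assms unfolding baer_module_def by blast

text \<open>
  A partial homomorphism is handled through its graph, a submodule of the product that meets
  \<open>0 \<times> M\<close> only in \<open>0\<close>: unions of chains of graphs are graphs again, so Zorn's lemma applies to them
  directly, and a partial homomorphism need not be given with an explicit domain.
\<close>

definition linear_graph ::
    "('r, 'b, 'y) module_scheme \<Rightarrow> ('r, 'm, 'z) module_scheme \<Rightarrow> ('b \<times> 'm) set \<Rightarrow> bool" where
  "linear_graph B M G \<longleftrightarrow> G \<subseteq> carrier B \<times> carrier M \<and> (\<zero>\<^bsub>B\<^esub>, \<zero>\<^bsub>M\<^esub>) \<in> G \<and>
     (\<forall>x y x' y'. (x, y) \<in> G \<longrightarrow> (x', y') \<in> G \<longrightarrow> (x \<oplus>\<^bsub>B\<^esub> x', y \<oplus>\<^bsub>M\<^esub> y') \<in> G) \<and>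
     (\<forall>r x y. (x, y) \<in> G \<longrightarrow> (r \<odot>\<^bsub>B\<^esub> x, r \<odot>\<^bsub>M\<^esub> y) \<in> G) \<and>
     (\<forall>y. (\<zero>\<^bsub>B\<^esub>, y) \<in> G \<longrightarrow> y = \<zero>\<^bsub>M\<^esub>)"

lemma linear_graphD:
  assumes "linear_graph B M G"
  shows "(x, y) \<in> G \<Longrightarrow> x \<in> carrier B" "(x, y) \<in> G \<Longrightarrow> y \<in> carrier M"
    and "(\<zero>\<^bsub>B\<^esub>, \<zero>\<^bsub>M\<^esub>) \<in> G"
    and "\<lbrakk>(x, y) \<in> G; (x', y') \<in> G\<rbrakk> \<Longrightarrow> (x \<oplus>\<^bsub>B\<^esub> x', y \<oplus>\<^bsub>M\<^esub> y') \<in> G"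
    and "(x, y) \<in> G \<Longrightarrow> (r \<odot>\<^bsub>B\<^esub> x, r \<odot>\<^bsub>M\<^esub> y) \<in> G"
    and "(\<zero>\<^bsub>B\<^esub>, y) \<in> G \<Longrightarrow> y = \<zero>\<^bsub>M\<^esub>"
  using assms unfolding linear_graph_def by blast+

lemma linear_graph_unique:
  assumes "left_module B" "left_module M" "linear_graph B M G" "(x, y) \<in> G" "(x, y') \<in> G"
  shows "y = y'"
proof -
  interpret B: left_module B by fact
  interpret M: left_module M by fact
  note G = linear_graphD[OF assms(3)]
  have c: "x \<in> carrier B" "y \<in> carrier M" "y' \<in> carrier M" using G assms(4,5) by blast+
  have "(x \<oplus>\<^bsub>B\<^esub> \<ominus>\<^bsub>B\<^esub> x, y \<oplus>\<^bsub>M\<^esub> \<ominus>\<^bsub>M\<^esub> y') \<in> G"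
    using G(4)[OF assms(4) G(5)[OF assms(5), of "- 1"]] c
    by (simp add: B.smult_minus_one M.smult_minus_one)
  then have "y \<ominus>\<^bsub>M\<^esub> y' = \<zero>\<^bsub>M\<^esub>" using G(6) c by (simp add: B.r_neg a_minus_def)
  then show ?thesis using c M.minus_eq_zeroD by blast
qed

text \<open>
  To enlarge the domain of a graph by an element \<open>b\<close>, its value at \<open>b\<close> has to be compatible
  with the values already prescribed on the multiples of \<open>b\<close>.  These multiples are indexed by a left
  ideal, and Baer's condition on that ideal supplies the value.
\<close>

lemma linear_graph_extend:
  fixes M :: "('r::ring_1, 'm, 'z) module_scheme"
  assumes "baer_module M" "left_module B" "linear_graph B M G" "b \<in> carrier B"
  shows "\<exists>G' m. linear_graph B M G' \<and> G \<subseteq> G' \<and> (b, m) \<in> G'"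
proof -
  interpret B: left_module B by fact
  interpret M: left_module M using assms(1) by (simp add: baer_module_def)
  note G = linear_graphD[OF assms(3)]
  note uniq = linear_graph_unique[OF B.left_module_axioms M.left_module_axioms assms(3)]
  define I where "I = {r. \<exists>y. (r \<odot>\<^bsub>B\<^esub> b, y) \<in> G}"
  define \<phi> where "\<phi> r = (THE y. (r \<odot>\<^bsub>B\<^esub> b, y) \<in> G)" for r
  have \<phi>: "\<phi> r = y" if "(r \<odot>\<^bsub>B\<^esub> b, y) \<in> G" for r y
    unfolding \<phi>_def using that uniq by blast
  have \<phi>_in: "(r \<odot>\<^bsub>B\<^esub> b, \<phi> r) \<in> G" if "r \<in> I" for r
    using that \<phi> unfolding I_def by blast
  have sum_in: "((r + s) \<odot>\<^bsub>B\<^esub> b, \<phi> r \<oplus>\<^bsub>M\<^esub> \<phi> s) \<in> G" if "r \<in> I" "s \<in> I" for r s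
    using G(4)[OF \<phi>_in[OF that(1)] \<phi>_in[OF that(2)]] assms(4) by (simp add: B.smult_l_distr)
  have prod_in: "((a * r) \<odot>\<^bsub>B\<^esub> b, a \<odot>\<^bsub>M\<^esub> \<phi> r) \<in> G" if "r \<in> I" for a r
    using G(5)[OF \<phi>_in[OF that]] assms(4) by (simp add: B.smult_assoc)
  interpret R: left_module "regular_module :: ('r, 'r) module" by (rule left_module_regular)
  have "left_submodule I regular_module"
  proof (rule R.left_submoduleI)
    show "\<zero>\<^bsub>regular_module\<^esub> \<in> I"
      using G(3) assms(4) by (auto simp: I_def B.smult_zero_left)
    show "\<And>x y. \<lbrakk>x \<in> I; y \<in> I\<rbrakk> \<Longrightarrow> x \<oplus>\<^bsub>regular_module\<^esub> y \<in> I"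
      "\<And>r x. x \<in> I \<Longrightarrow> r \<odot>\<^bsub>regular_module\<^esub> x \<in> I"
      using sum_in prod_in unfolding I_def regular_module_sel by blast+
  qed simp
  moreover have "\<phi> \<in> module_hom (regular_module\<lparr>carrier := I\<rparr>) M"
    by (rule module_homI) (use \<phi>_in G(2) \<phi>[OF sum_in] \<phi>[OF prod_in] in auto)
  ultimately obtain m where m: "m \<in> carrier M" "\<And>r. r \<in> I \<Longrightarrow> \<phi> r = r \<odot>\<^bsub>M\<^esub> m"
    using baer_moduleD[OF assms(1)] by blast
  define G' where
    "G' = {(x \<oplus>\<^bsub>B\<^esub> r \<odot>\<^bsub>B\<^esub> b, y \<oplus>\<^bsub>M\<^esub> r \<odot>\<^bsub>M\<^esub> m) | x y r. (x, y) \<in> G}"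
  have G'I: "(x \<oplus>\<^bsub>B\<^esub> r \<odot>\<^bsub>B\<^esub> b, y \<oplus>\<^bsub>M\<^esub> r \<odot>\<^bsub>M\<^esub> m) \<in> G'" if "(x, y) \<in> G" for x y r
    using that by (auto simp: G'_def)
  have "linear_graph B M G'"
    unfolding linear_graph_def
  proof (intro conjI allI impI)
    have "x \<oplus>\<^bsub>B\<^esub> r \<odot>\<^bsub>B\<^esub> b \<in> carrier B \<and> y \<oplus>\<^bsub>M\<^esub> r \<odot>\<^bsub>M\<^esub> m \<in> carrier M"
      if xy: "(x, y) \<in> G" for x y r
      using G(1,2)[OF xy] m(1) assms(4) by (simp add: B.smult_closed M.smult_closed)
    then show "G' \<subseteq> carrier B \<times> carrier M" unfolding G'_def by blast
    show "(\<zero>\<^bsub>B\<^esub>, \<zero>\<^bsub>M\<^esub>) \<in> G'"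
      using G'I[OF G(3), of 0] m(1) assms(4) by (simp add: B.smult_zero_left M.smult_zero_left)
  next
    fix x y x' y' assume "(x, y) \<in> G'" "(x', y') \<in> G'"
    then obtain a c r a' c' r' where *: "(a, c) \<in> G" "(a', c') \<in> G"
      "x = a \<oplus>\<^bsub>B\<^esub> r \<odot>\<^bsub>B\<^esub> b" "y = c \<oplus>\<^bsub>M\<^esub> r \<odot>\<^bsub>M\<^esub> m"
      "x' = a' \<oplus>\<^bsub>B\<^esub> r' \<odot>\<^bsub>B\<^esub> b" "y' = c' \<oplus>\<^bsub>M\<^esub> r' \<odot>\<^bsub>M\<^esub> m"
      unfolding G'_def by blast
    have c: "a \<in> carrier B" "a' \<in> carrier B" "c \<in> carrier M" "c' \<in> carrier M"
      using G(1,2) *(1,2) by blast+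
    have "x \<oplus>\<^bsub>B\<^esub> x' = (a \<oplus>\<^bsub>B\<^esub> a') \<oplus>\<^bsub>B\<^esub> (r + r') \<odot>\<^bsub>B\<^esub> b"
      unfolding *(3,5) using c(1,2) assms(4)
      by (simp add: B.smult_l_distr B.smult_closed B.a_ac)
    moreover have "y \<oplus>\<^bsub>M\<^esub> y' = (c \<oplus>\<^bsub>M\<^esub> c') \<oplus>\<^bsub>M\<^esub> (r + r') \<odot>\<^bsub>M\<^esub> m"
      unfolding *(4,6) using c(3,4) m(1)
      by (simp add: M.smult_l_distr M.smult_closed M.a_ac)
    ultimately show "(x \<oplus>\<^bsub>B\<^esub> x', y \<oplus>\<^bsub>M\<^esub> y') \<in> G'" using G'I[OF G(4)[OF *(1,2)]] by simp
  next
    fix s x y assume "(x, y) \<in> G'"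
    then obtain a c r where *: "(a, c) \<in> G"
      "x = a \<oplus>\<^bsub>B\<^esub> r \<odot>\<^bsub>B\<^esub> b" "y = c \<oplus>\<^bsub>M\<^esub> r \<odot>\<^bsub>M\<^esub> m"
      unfolding G'_def by blast
    have c: "a \<in> carrier B" "c \<in> carrier M" using G(1,2) *(1) by blast+
    have "s \<odot>\<^bsub>B\<^esub> x = s \<odot>\<^bsub>B\<^esub> a \<oplus>\<^bsub>B\<^esub> (s * r) \<odot>\<^bsub>B\<^esub> b"
      unfolding *(2) using c(1) assms(4) by (simp add: B.smult_r_distr B.smult_closed B.smult_assoc)
    moreover have "s \<odot>\<^bsub>M\<^esub> y = s \<odot>\<^bsub>M\<^esub> c \<oplus>\<^bsub>M\<^esub> (s * r) \<odot>\<^bsub>M\<^esub> m"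
      unfolding *(3) using c(2) m(1) by (simp add: M.smult_r_distr M.smult_closed M.smult_assoc)
    ultimately show "(s \<odot>\<^bsub>B\<^esub> x, s \<odot>\<^bsub>M\<^esub> y) \<in> G'" using G'I[OF G(5)[OF *(1)]] by simp
  next
    fix y assume "(\<zero>\<^bsub>B\<^esub>, y) \<in> G'"
    then obtain a c r where *: "(a, c) \<in> G"
      "\<zero>\<^bsub>B\<^esub> = a \<oplus>\<^bsub>B\<^esub> r \<odot>\<^bsub>B\<^esub> b" "y = c \<oplus>\<^bsub>M\<^esub> r \<odot>\<^bsub>M\<^esub> m"
      unfolding G'_def by blast
    have c: "a \<in> carrier B" "c \<in> carrier M" using G(1,2) *(1) by blast+
    have "a = \<ominus>\<^bsub>B\<^esub> (r \<odot>\<^bsub>B\<^esub> b)"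
      using B.minus_equality[OF *(2)[symmetric]] c(1) assms(4) by (simp add: B.smult_closed)
    also have "\<dots> = (- r) \<odot>\<^bsub>B\<^esub> b" using assms(4) by (simp add: B.smult_uminus)
    finally have "((- r) \<odot>\<^bsub>B\<^esub> b, c) \<in> G" using *(1) by simp
    then have "c = (- r) \<odot>\<^bsub>M\<^esub> m" using \<phi> m(2) unfolding I_def by blast
    then have "c = \<ominus>\<^bsub>M\<^esub> (r \<odot>\<^bsub>M\<^esub> m)" using m(1) by (simp add: M.smult_uminus)
    then show "y = \<zero>\<^bsub>M\<^esub>" using *(3) m(1) by (simp add: M.l_neg M.smult_closed)
  qed
  moreover have "G \<subseteq> G'"
  proof (clarify)
    fix x y assume xy: "(x, y) \<in> G"
    then show "(x, y) \<in> G'"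
      using G'I[OF xy, of 0] G(1,2)[OF xy] m(1) assms(4)
      by (simp add: B.smult_zero_left M.smult_zero_left)
  qed
  moreover have "(b, m) \<in> G'"
    using G'I[OF G(3), of 1] m(1) assms(4) by (simp add: B.smult_one M.smult_one)
  ultimately show ?thesis by blast
qed

lemma linear_graph_Union:
  assumes "\<C> \<noteq> {}" "subset.chain {G. linear_graph B M G} \<C>"
  shows "linear_graph B M (\<Union>\<C>)"
proof -
  have g: "\<And>G. G \<in> \<C> \<Longrightarrow> linear_graph B M G"
    and tot: "\<And>G G'. \<lbrakk>G \<in> \<C>; G' \<in> \<C>\<rbrakk> \<Longrightarrow> G \<subseteq> G' \<or> G' \<subseteq> G"
    using assms(2) by (auto simp: subset_chain_def)
  note D = linear_graphD[OF g]
  show ?thesis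
    unfolding linear_graph_def
  proof (intro conjI allI impI)
    have "G \<subseteq> carrier B \<times> carrier M" if "G \<in> \<C>" for G
      using g[OF that] by (simp add: linear_graph_def)
    then show "\<Union>\<C> \<subseteq> carrier B \<times> carrier M" by blast
    obtain G where "G \<in> \<C>" using assms(1) by blast
    then show "(\<zero>\<^bsub>B\<^esub>, \<zero>\<^bsub>M\<^esub>) \<in> \<Union>\<C>" using D(3) by blast
  next
    fix x y x' y' assume "(x, y) \<in> \<Union>\<C>" "(x', y') \<in> \<Union>\<C>"
    then obtain G\<^sub>1 G\<^sub>2 where "G\<^sub>1 \<in> \<C>" "(x, y) \<in> G\<^sub>1" "G\<^sub>2 \<in> \<C>" "(x', y') \<in> G\<^sub>2" by blast
    then obtain G where "G \<in> \<C>" "(x, y) \<in> G" "(x', y') \<in> G" using tot[of G\<^sub>1 G\<^sub>2] by blast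
    then show "(x \<oplus>\<^bsub>B\<^esub> x', y \<oplus>\<^bsub>M\<^esub> y') \<in> \<Union>\<C>" using D(4) by blast
  next
    fix r x y assume "(x, y) \<in> \<Union>\<C>"
    then show "(r \<odot>\<^bsub>B\<^esub> x, r \<odot>\<^bsub>M\<^esub> y) \<in> \<Union>\<C>" using D(5) by blast
  next
    fix y assume "(\<zero>\<^bsub>B\<^esub>, y) \<in> \<Union>\<C>"
    then show "y = \<zero>\<^bsub>M\<^esub>" using D(6) by blast
  qed
qed

text \<open>
  Baer's criterion in its general form: by Zorn's lemma there is a maximal graph above the given one,
  and by \<open>linear_graph_extend\<close> its domain is all of \<open>B\<close>.
\<close>

lemma baer_extends_graph:
  assumes "baer_module M" "left_module B" "linear_graph B M G\<^sub>0"
  shows "\<exists>h\<in>module_hom B M. \<forall>x y. (x, y) \<in> G\<^sub>0 \<longrightarrow> h x = y"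
proof -
  interpret B: left_module B by fact
  interpret M: left_module M using assms(1) by (simp add: baer_module_def)
  define \<A> where "\<A> = {G. linear_graph B M G \<and> G\<^sub>0 \<subseteq> G}"
  have "\<Union>\<C> \<in> \<A>" if "\<C> \<noteq> {}" "subset.chain \<A> \<C>" for \<C>
    using that linear_graph_Union[of \<C> B M] by (fastforce simp: subset_chain_def \<A>_def)
  moreover have "G\<^sub>0 \<in> \<A>" using assms(3) by (simp add: \<A>_def)
  ultimately obtain G where "G \<in> \<A>" and max: "\<And>G'. \<lbrakk>G' \<in> \<A>; G \<subseteq> G'\<rbrakk> \<Longrightarrow> G' = G"
    using subset_Zorn_nonempty[of \<A>] by blast
  then have G: "linear_graph B M G" "G\<^sub>0 \<subseteq> G" by (simp_all add: \<A>_def)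
  note D = linear_graphD[OF G(1)]
  have total: "\<exists>y. (b, y) \<in> G" if "b \<in> carrier B" for b
  proof -
    obtain G' m where "linear_graph B M G'" "G \<subseteq> G'" "(b, m) \<in> G'"
      using linear_graph_extend[OF assms(1,2) G(1) \<open>b \<in> carrier B\<close>] by blast
    then show ?thesis using max[of G'] G(2) by (auto simp: \<A>_def)
  qed
  define h where "h b = (THE y. (b, y) \<in> G)" for b
  have h: "h b = y" if "(b, y) \<in> G" for b y
    unfolding h_def
    using that linear_graph_unique[OF B.left_module_axioms M.left_module_axioms G(1)] by blast
  have hG: "(b, h b) \<in> G" if "b \<in> carrier B" for b
    using total[OF that] h by blast
  have "h \<in> module_hom B M"
  proof (rule module_homI)
    show "h x \<in> carrier M" if "x \<in> carrier B" for x using D(2) hG that by blast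
    show "h (x \<oplus>\<^bsub>B\<^esub> y) = h x \<oplus>\<^bsub>M\<^esub> h y" if "x \<in> carrier B" "y \<in> carrier B" for x y
      using h[OF D(4)[OF hG hG]] that by simp
    show "h (r \<odot>\<^bsub>B\<^esub> x) = r \<odot>\<^bsub>M\<^esub> h x" if "x \<in> carrier B" for r x
      using h[OF D(5)[OF hG]] that by simp
  qed
  then show ?thesis using G(2) h by blast
qed

lemma baer_extends:
  assumes "baer_module M" "left_module A" "left_module B"
    and "i \<in> module_hom A B" "inj_on i (carrier A)" "g \<in> module_hom A M"
  shows "\<exists>h\<in>module_hom B M. \<forall>x\<in>carrier A. h (i x) = g x"
proof -
  interpret A: left_module A by fact
  interpret B: left_module B by fact
  interpret M: left_module M using assms(1) by (simp add: baer_module_def)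
  note i = module_homD[OF assms(4)] and g = module_homD[OF assms(6)]
  have i0: "i \<zero>\<^bsub>A\<^esub> = \<zero>\<^bsub>B\<^esub>" and g0: "g \<zero>\<^bsub>A\<^esub> = \<zero>\<^bsub>M\<^esub>"
    using module_hom_zero A.left_module_axioms B.left_module_axioms M.left_module_axioms
      assms(4,6) by blast+
  let ?G = "{(i x, g x) | x. x \<in> carrier A}"
  have "linear_graph B M ?G"
    unfolding linear_graph_def
  proof (intro conjI allI impI)
    show "?G \<subseteq> carrier B \<times> carrier M" using i(1) g(1) by auto
    show "(\<zero>\<^bsub>B\<^esub>, \<zero>\<^bsub>M\<^esub>) \<in> ?G"
      unfolding i0[symmetric] g0[symmetric] using A.zero_closed by blast
  next
    fix x y x' y' assume "(x, y) \<in> ?G" "(x', y') \<in> ?G"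
    then obtain a a' where *: "a \<in> carrier A" "a' \<in> carrier A"
      and "x = i a" "y = g a" "x' = i a'" "y' = g a'" by blast
    then have "x \<oplus>\<^bsub>B\<^esub> x' = i (a \<oplus>\<^bsub>A\<^esub> a')" "y \<oplus>\<^bsub>M\<^esub> y' = g (a \<oplus>\<^bsub>A\<^esub> a')"
      by (simp_all add: i(2) g(2))
    then show "(x \<oplus>\<^bsub>B\<^esub> x', y \<oplus>\<^bsub>M\<^esub> y') \<in> ?G" using * by auto
  next
    fix r x y assume "(x, y) \<in> ?G"
    then obtain a where *: "a \<in> carrier A" and "x = i a" "y = g a" by blast
    then have "r \<odot>\<^bsub>B\<^esub> x = i (r \<odot>\<^bsub>A\<^esub> a)" "r \<odot>\<^bsub>M\<^esub> y = g (r \<odot>\<^bsub>A\<^esub> a)"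
      by (simp_all add: i(3) g(3))
    then show "(r \<odot>\<^bsub>B\<^esub> x, r \<odot>\<^bsub>M\<^esub> y) \<in> ?G" using A.smult_closed[OF *] by auto
  next
    fix y assume "(\<zero>\<^bsub>B\<^esub>, y) \<in> ?G"
    then obtain a where a: "a \<in> carrier A" "i a = i \<zero>\<^bsub>A\<^esub>" "y = g a" using i0 by fastforce
    then show "y = \<zero>\<^bsub>M\<^esub>" using g0 inj_onD[OF assms(5) a(2)] by simp
  qed
  then obtain h where h: "h \<in> module_hom B M" "\<And>x y. (x, y) \<in> ?G \<Longrightarrow> h x = y"
    using baer_extends_graph[OF assms(1,3)] by blast
  have "h (i x) = g x" if "x \<in> carrier A" for x
  proof -
    have "(i x, g x) \<in> ?G" using that by blast
    then show ?thesis by (rule h(2))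
  qed
  then show ?thesis using h(1) by blast
qed

text \<open>
  A homomorphism from a cyclic module is determined by the image of the generator, and any element
  whose annihilator is large enough may be that image.
\<close>

lemma baer_extends_cyclic:
  assumes "baer_module M" "left_module B" "b \<in> carrier B" "m \<in> carrier M"
    and ann: "\<And>r. r \<odot>\<^bsub>B\<^esub> b = \<zero>\<^bsub>B\<^esub> \<Longrightarrow> r \<odot>\<^bsub>M\<^esub> m = \<zero>\<^bsub>M\<^esub>"
  shows "\<exists>h\<in>module_hom B M. h b = m"
proof -
  interpret B: left_module B by fact
  interpret M: left_module M using assms(1) by (simp add: baer_module_def)
  let ?G = "{(r \<odot>\<^bsub>B\<^esub> b, r \<odot>\<^bsub>M\<^esub> m) | r. True}"
  have "linear_graph B M ?G"
    unfolding linear_graph_def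
  proof (intro conjI allI impI)
    show "?G \<subseteq> carrier B \<times> carrier M" using assms by (auto simp: B.smult_closed M.smult_closed)
    show "(\<zero>\<^bsub>B\<^esub>, \<zero>\<^bsub>M\<^esub>) \<in> ?G"
      unfolding B.smult_zero_left[OF assms(3), symmetric] M.smult_zero_left[OF assms(4), symmetric]
      by blast
  next
    fix x y x' y' assume "(x, y) \<in> ?G" "(x', y') \<in> ?G"
    then show "(x \<oplus>\<^bsub>B\<^esub> x', y \<oplus>\<^bsub>M\<^esub> y') \<in> ?G"
      by (auto simp flip: B.smult_l_distr[OF assms(3)] M.smult_l_distr[OF assms(4)])
  next
    fix r x y assume "(x, y) \<in> ?G"
    then show "(r \<odot>\<^bsub>B\<^esub> x, r \<odot>\<^bsub>M\<^esub> y) \<in> ?G"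
      by (auto simp flip: B.smult_assoc[OF assms(3)] M.smult_assoc[OF assms(4)])
  next
    fix y assume "(\<zero>\<^bsub>B\<^esub>, y) \<in> ?G"
    then obtain r where "r \<odot>\<^bsub>B\<^esub> b = \<zero>\<^bsub>B\<^esub>" "y = r \<odot>\<^bsub>M\<^esub> m" by auto
    then show "y = \<zero>\<^bsub>M\<^esub>" using ann by simp
  qed
  then obtain h where h: "h \<in> module_hom B M" "\<And>x y. (x, y) \<in> ?G \<Longrightarrow> h x = y"
    using baer_extends_graph[OF assms(1,2)] by blast
  moreover have "(1 \<odot>\<^bsub>B\<^esub> b, 1 \<odot>\<^bsub>M\<^esub> m) \<in> ?G" by blast
  ultimately have "h (1 \<odot>\<^bsub>B\<^esub> b) = 1 \<odot>\<^bsub>M\<^esub> m" by blast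
  then show ?thesis using h(1) assms(3,4) by (auto simp: B.smult_one M.smult_one)
qed

lemma baer_imp_injective:
  assumes "baer_module M"
  shows "injective_module TYPE('b) M"
  unfolding injective_module_def
proof (intro conjI allI impI)
  show "left_module M" using assms by (simp add: baer_module_def)
qed (elim conjE, rule baer_extends[OF assms])

text \<open>
  The ring and its left ideal are copied into the type of the test modules along an injection.
\<close>

lemma injective_imp_baer:
  fixes M :: "('r::ring_1, 'm, 'z) module_scheme"
  assumes "injective_module TYPE('b) M" and e: "inj (e :: 'r \<Rightarrow> 'b)"
  shows "baer_module M"
  unfolding baer_module_def
proof (intro conjI allI ballI impI)
  show M: "left_module M" using assms(1) by (simp add: injective_module_def)
  interpret M: left_module M by fact
  fix I \<phi> assume \<phi>: "\<phi> \<in> module_hom (regular_module\<lparr>carrier := I\<rparr>) M"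
    and I: "left_submodule I (regular_module :: ('r, 'r) module)"
  let ?d = "inv_into UNIV e"
  have d [simp]: "?d (e x) = x" for x using e by (rule inv_f_f)
  let ?T = "\<lambda>J. \<lparr>carrier = e ` J, monoid.mult = undefined, monoid.one = undefined,
     zero = e 0, add = (\<lambda>x y. e (?d x + ?d y)),
     module.smult = (\<lambda>r x. e (r * ?d x))\<rparr> :: ('r, 'b) module"
  have T: "left_module (?T J)" if "left_submodule J (regular_module :: ('r, 'r) module)" for J
    using left_submoduleD[OF that] by (intro left_moduleI) (auto simp: algebra_simps)
  have "left_submodule UNIV (regular_module :: ('r, 'r) module)"
    by (rule left_module.left_submoduleI[OF left_module_regular]) auto
  with T I have AB: "left_module (?T I)" "left_module (?T UNIV)" by blast+
  have "(\<lambda>x. x) \<in> module_hom (?T I) (?T UNIV)" by (rule module_homI) auto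
  moreover have "(\<lambda>x. \<phi> (?d x)) \<in> module_hom (?T I) M"
    by (rule module_homI) (use ideal_homD[OF \<phi>] in auto)
  moreover have "inj_on (\<lambda>x. x) (carrier (?T I))" by simp
  ultimately obtain h where h: "h \<in> module_hom (?T UNIV) M"
    "\<forall>x\<in>carrier (?T I). h x = \<phi> (?d x)"
    using assms(1) AB unfolding injective_module_def by blast
  have "\<phi> r = r \<odot>\<^bsub>M\<^esub> h (e 1)" if "r \<in> I" for r
    using module_homD(3)[OF h(1), of "e 1" r] h(2) that by auto
  moreover have "h (e 1) \<in> carrier M" using module_homD(1)[OF h(1)] by simp
  ultimately show "\<exists>m\<in>carrier M. \<forall>r\<in>I. \<phi> r = r \<odot>\<^bsub>M\<^esub> m" by blast
qed

text \<open>
  A homomorphism into the retract is represented by an element of the larger module, which is then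
  projected back.
\<close>

lemma baer_retract:
  assumes "baer_module P" "left_module M"
    and i: "i \<in> module_hom M P" and t: "t \<in> module_hom P M"
    and ti: "\<And>x. x \<in> carrier M \<Longrightarrow> t (i x) = x"
  shows "baer_module M"
  unfolding baer_module_def
proof (intro conjI allI ballI impI)
  fix I \<phi> assume \<phi>: "\<phi> \<in> module_hom (regular_module\<lparr>carrier := I\<rparr>) M"
    and I: "left_submodule I regular_module"
  obtain m where m: "m \<in> carrier P" "\<And>r. r \<in> I \<Longrightarrow> i (\<phi> r) = r \<odot>\<^bsub>P\<^esub> m"
    using baer_moduleD[OF assms(1) I module_hom_compose[OF \<phi> i]] by blast
  have "\<phi> r = r \<odot>\<^bsub>M\<^esub> t m" if "r \<in> I" for r
    using m that ti[of "\<phi> r"] ideal_homD(1)[OF \<phi>] module_homD(3)[OF t] by metis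
  then show "\<exists>m\<in>carrier M. \<forall>r\<in>I. \<phi> r = r \<odot>\<^bsub>M\<^esub> m" using m(1) module_homD(1)[OF t] by blast
qed fact

lemma baer_direct_product:
  assumes "\<And>i. i \<in> I \<Longrightarrow> baer_module (M i)"
  shows "baer_module (direct_product I M)"
  unfolding baer_module_def
proof (intro conjI allI ballI impI)
  show "left_module (direct_product I M)"
    using assms by (intro left_module_direct_product) (simp add: baer_module_def)
  fix J \<phi> assume \<phi>: "\<phi> \<in> module_hom (regular_module\<lparr>carrier := J\<rparr>) (direct_product I M)"
    and J: "left_submodule J regular_module"
  have \<phi>_ext: "\<phi> r \<in> (\<Pi>\<^sub>E i\<in>I. carrier (M i))" if "r \<in> J" for r
    using ideal_homD(1)[OF \<phi> that] by simp
  have "\<exists>m\<in>carrier (M i). \<forall>r\<in>J. \<phi> r i = r \<odot>\<^bsub>M i\<^esub> m" if i: "i \<in> I" for i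
  proof -
    have "(\<lambda>r. \<phi> r i) \<in> module_hom (regular_module\<lparr>carrier := J\<rparr>) (M i)"
      by (rule module_homI) (use ideal_homD[OF \<phi>] i in \<open>auto simp: PiE_iff\<close>)
    then show ?thesis using baer_moduleD[OF assms[OF i] J] by metis
  qed
  then obtain m where m: "\<And>i. i \<in> I \<Longrightarrow> m i \<in> carrier (M i)"
    "\<And>i r. \<lbrakk>i \<in> I; r \<in> J\<rbrakk> \<Longrightarrow> \<phi> r i = r \<odot>\<^bsub>M i\<^esub> m i"
    by metis
  have "\<phi> r = r \<odot>\<^bsub>direct_product I M\<^esub> restrict m I" if "r \<in> J" for r
    using \<phi>_ext[OF that] m that by (auto simp: fun_eq_iff PiE_iff extensional_def)
  then show "\<exists>m\<in>carrier (direct_product I M). \<forall>r\<in>J. \<phi> r = r \<odot>\<^bsub>direct_product I M\<^esub> m"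
    using m(1) by (intro bexI[of _ "restrict m I"]) auto
qed

lemma baer_binary_direct_sum:
  assumes "baer_module M" "baer_module N"
  shows "baer_module (binary_direct_sum M N)"
  unfolding baer_module_def
proof (intro conjI allI ballI impI)
  show "left_module (binary_direct_sum M N)"
    using assms by (intro left_module_binary_direct_sum) (simp_all add: baer_module_def)
  fix J \<phi> assume \<phi>: "\<phi> \<in> module_hom (regular_module\<lparr>carrier := J\<rparr>) (binary_direct_sum M N)"
    and J: "left_submodule J regular_module"
  have "fst \<in> module_hom (binary_direct_sum M N) M" "snd \<in> module_hom (binary_direct_sum M N) N"
    by (auto intro!: module_homI)
  note \<phi>' = this[THEN module_hom_compose[OF \<phi>]]
  obtain m where m: "m \<in> carrier M" "\<And>r. r \<in> J \<Longrightarrow> fst (\<phi> r) = r \<odot>\<^bsub>M\<^esub> m"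
    using baer_moduleD[OF assms(1) J \<phi>'(1)] by blast
  obtain n where n: "n \<in> carrier N" "\<And>r. r \<in> J \<Longrightarrow> snd (\<phi> r) = r \<odot>\<^bsub>N\<^esub> n"
    using baer_moduleD[OF assms(2) J \<phi>'(2)] by blast
  have "\<phi> r = r \<odot>\<^bsub>binary_direct_sum M N\<^esub> (m, n)" if "r \<in> J" for r
    using m n that by (simp add: prod_eq_iff)
  then show "\<exists>x\<in>carrier (binary_direct_sum M N). \<forall>r\<in>J. \<phi> r = r \<odot>\<^bsub>binary_direct_sum M N\<^esub> x"
    using m(1) n(1) by (intro bexI[of _ "(m, n)"]) auto
qed

text \<open>
  The complement of a direct summand gives the projection that makes it a retract.
\<close>

lemma baer_direct_summand:
  assumes "baer_module P" "direct_summand N P"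
  shows "baer_module (P\<lparr>carrier := N\<rparr>)"
proof -
  interpret P: left_module P using assms(1) by (simp add: baer_module_def)
  obtain N' where N: "left_submodule N P" and N': "left_submodule N' P"
    and sum: "N <+>\<^bsub>P\<^esub> N' = carrier P" and int: "N \<inter> N' = {\<zero>\<^bsub>P\<^esub>}"
    using assms(2) unfolding direct_summand_def by blast
  note D = left_submoduleD[OF N] and D' = left_submoduleD[OF N']
  have uniq: "x = y" if "x \<in> N" "y \<in> N" "x' \<in> N'" "y' \<in> N'" "x \<oplus>\<^bsub>P\<^esub> x' = y \<oplus>\<^bsub>P\<^esub> y'"
    for x y x' y'
  proof -
    have c: "x \<in> carrier P" "y \<in> carrier P" "x' \<in> carrier P" "y' \<in> carrier P"
      using that D(1) D'(1) by auto
    have "x \<oplus>\<^bsub>P\<^esub> (\<ominus>\<^bsub>P\<^esub> y) = (x \<oplus>\<^bsub>P\<^esub> x') \<oplus>\<^bsub>P\<^esub> (\<ominus>\<^bsub>P\<^esub> x') \<oplus>\<^bsub>P\<^esub> (\<ominus>\<^bsub>P\<^esub> y)"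
      using c by (simp add: P.a_assoc P.r_neg)
    also have "\<dots> = (\<ominus>\<^bsub>P\<^esub> y) \<oplus>\<^bsub>P\<^esub> (y \<oplus>\<^bsub>P\<^esub> (y' \<oplus>\<^bsub>P\<^esub> (\<ominus>\<^bsub>P\<^esub> x')))"
      unfolding that(5) using c by (simp add: P.a_ac)
    also have "\<dots> = y' \<oplus>\<^bsub>P\<^esub> (\<ominus>\<^bsub>P\<^esub> x')" using c by (simp add: P.r_neg1)
    finally have "x \<oplus>\<^bsub>P\<^esub> (\<ominus>\<^bsub>P\<^esub> y) = y' \<oplus>\<^bsub>P\<^esub> (\<ominus>\<^bsub>P\<^esub> x')" .
    moreover have "x \<oplus>\<^bsub>P\<^esub> (\<ominus>\<^bsub>P\<^esub> y) \<in> N"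
      using D(3)[OF that(1) D(4)[OF that(2), of "- 1"]] c by (simp add: P.smult_minus_one)
    moreover have "y' \<oplus>\<^bsub>P\<^esub> (\<ominus>\<^bsub>P\<^esub> x') \<in> N'"
      using D'(3)[OF that(4) D'(4)[OF that(3), of "- 1"]] c by (simp add: P.smult_minus_one)
    ultimately have "x \<ominus>\<^bsub>P\<^esub> y = \<zero>\<^bsub>P\<^esub>" using int by (auto simp: a_minus_def)
    then show ?thesis using c P.minus_eq_zeroD by blast
  qed
  define t where "t z = (THE x. x \<in> N \<and> (\<exists>y\<in>N'. z = x \<oplus>\<^bsub>P\<^esub> y))" for z
  have t: "t (x \<oplus>\<^bsub>P\<^esub> y) = x" if "x \<in> N" "y \<in> N'" for x y
    unfolding t_def using that uniq by (intro the_equality) blast+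
  have split: "\<exists>x\<in>N. \<exists>y\<in>N'. z = x \<oplus>\<^bsub>P\<^esub> y" if "z \<in> carrier P" for z
  proof -
    have "z \<in> N <+>\<^bsub>P\<^esub> N'" using that sum by simp
    then show ?thesis by (auto simp: set_add_def set_mult_def)
  qed
  have "t \<in> module_hom P (P\<lparr>carrier := N\<rparr>)"
  proof (rule module_homI)
    fix z assume "z \<in> carrier P"
    then show "t z \<in> carrier (P\<lparr>carrier := N\<rparr>)" using split t by fastforce
  next
    fix z z' assume "z \<in> carrier P" "z' \<in> carrier P"
    then obtain x y x' y' where *: "x \<in> N" "y \<in> N'" "z = x \<oplus>\<^bsub>P\<^esub> y"
      "x' \<in> N" "y' \<in> N'" "z' = x' \<oplus>\<^bsub>P\<^esub> y'" using split by metis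
    then have "x \<in> carrier P" "y \<in> carrier P" "x' \<in> carrier P" "y' \<in> carrier P"
      using D(1) D'(1) by auto
    then have "z \<oplus>\<^bsub>P\<^esub> z' = (x \<oplus>\<^bsub>P\<^esub> x') \<oplus>\<^bsub>P\<^esub> (y \<oplus>\<^bsub>P\<^esub> y')"
      using * by (simp add: P.a_ac)
    then show "t (z \<oplus>\<^bsub>P\<^esub> z') = t z \<oplus>\<^bsub>P\<lparr>carrier := N\<rparr>\<^esub> t z'"
      using * t D(3) D'(3) by simp
  next
    fix r z assume "z \<in> carrier P"
    then obtain x y where *: "x \<in> N" "y \<in> N'" "z = x \<oplus>\<^bsub>P\<^esub> y" using split by metis
    then have "x \<in> carrier P" "y \<in> carrier P" using D(1) D'(1) by blast+
    then have "r \<odot>\<^bsub>P\<^esub> z = r \<odot>\<^bsub>P\<^esub> x \<oplus>\<^bsub>P\<^esub> r \<odot>\<^bsub>P\<^esub> y"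
      using * by (simp add: P.smult_r_distr)
    then show "t (r \<odot>\<^bsub>P\<^esub> z) = r \<odot>\<^bsub>P\<lparr>carrier := N\<rparr>\<^esub> t z"
      using * t D(4) D'(4) by simp
  qed
  moreover have "(\<lambda>x. x) \<in> module_hom (P\<lparr>carrier := N\<rparr>) P"
    by (rule module_homI) (use D(1) in auto)
  moreover have "t x = x" if "x \<in> N" for x
    using t[OF that D'(2)] that D(1) by auto
  ultimately show ?thesis
    using baer_retract[OF assms(1) left_module_restrict[OF P.left_module_axioms N]] by simp
qed

lemma baer_isomorphic:
  assumes "baer_module P" "left_module M" "module_isomorphic M P"
  shows "baer_module M"
proof -
  interpret M: left_module M by fact
  obtain h where h: "h \<in> module_hom M P" and bij: "bij_betw h (carrier M) (carrier P)"
    using assms(3) unfolding module_isomorphic_def by blast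
  let ?g = "the_inv_into (carrier M) h"
  have inj: "inj_on h (carrier M)" using bij by (rule bij_betw_imp_inj_on)
  have gh: "?g (h x) = x" if "x \<in> carrier M" for x
    using that by (rule the_inv_into_f_f[OF inj])
  have surj: "\<exists>x\<in>carrier M. y = h x" if "y \<in> carrier P" for y
    using bij that by (auto simp: bij_betw_def)
  have "?g \<in> module_hom P M"
  proof (rule module_homI)
    fix y y' assume "y \<in> carrier P" "y' \<in> carrier P"
    then obtain x x' where *: "x \<in> carrier M" "y = h x" "x' \<in> carrier M" "y' = h x'"
      using surj by metis
    then have "y \<oplus>\<^bsub>P\<^esub> y' = h (x \<oplus>\<^bsub>M\<^esub> x')" using module_homD(2)[OF h] by simp
    then show "?g (y \<oplus>\<^bsub>P\<^esub> y') = ?g y \<oplus>\<^bsub>M\<^esub> ?g y'" using * gh by simp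
  next
    fix r y assume "y \<in> carrier P"
    then obtain x where *: "x \<in> carrier M" "y = h x" using surj by metis
    then have "r \<odot>\<^bsub>P\<^esub> y = h (r \<odot>\<^bsub>M\<^esub> x)" using module_homD(3)[OF h] by simp
    then show "?g (r \<odot>\<^bsub>P\<^esub> y) = r \<odot>\<^bsub>M\<^esub> ?g y" using * gh by (simp add: M.smult_closed)
  qed (use surj gh in fastforce)
  with h gh show ?thesis using baer_retract[OF assms(1,2)] by blast
qed

text \<open>
  The identity of \<open>M\<close> extends along the embedding to a projection, whose kernel is the complement.
\<close>

lemma baer_embedding_splits:
  assumes "baer_module M" "left_module P"
    and h: "h \<in> module_hom M P" and inj: "inj_on h (carrier M)"
  shows "direct_summand (h ` carrier M) P"
    and "module_isomorphic M (P\<lparr>carrier := h ` carrier M\<rparr>)"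
proof -
  interpret P: left_module P by fact
  interpret M: left_module M using assms(1) by (simp add: baer_module_def)
  note hD = module_homD[OF h]
  have h0: "h \<zero>\<^bsub>M\<^esub> = \<zero>\<^bsub>P\<^esub>"
    using module_hom_zero[OF M.left_module_axioms P.left_module_axioms h] .
  have "(\<lambda>x. x) \<in> module_hom M M" by (rule module_homI) auto
  then obtain t where t: "t \<in> module_hom P M" "\<And>x. x \<in> carrier M \<Longrightarrow> t (h x) = x"
    using baer_extends[OF assms(1) M.left_module_axioms assms(2) h inj, of "\<lambda>x. x"] by blast
  note tD = module_homD[OF t(1)]
  let ?N = "h ` carrier M" and ?N' = "{y \<in> carrier P. t y = \<zero>\<^bsub>M\<^esub>}"
  have N: "left_submodule ?N P"
  proof (rule P.left_submoduleI)
    show "?N \<subseteq> carrier P" using hD(1) by blast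
    show "\<zero>\<^bsub>P\<^esub> \<in> ?N" unfolding h0[symmetric] by simp
  next
    fix x y assume "x \<in> ?N" "y \<in> ?N"
    then obtain a b where *: "a \<in> carrier M" "b \<in> carrier M" "x = h a" "y = h b" by blast
    then have "x \<oplus>\<^bsub>P\<^esub> y = h (a \<oplus>\<^bsub>M\<^esub> b)" using hD(2) by simp
    then show "x \<oplus>\<^bsub>P\<^esub> y \<in> ?N" using * by simp
  next
    fix r x assume "x \<in> ?N"
    then obtain a where *: "a \<in> carrier M" "x = h a" by blast
    then have "r \<odot>\<^bsub>P\<^esub> x = h (r \<odot>\<^bsub>M\<^esub> a)" using hD(3) by simp
    then show "r \<odot>\<^bsub>P\<^esub> x \<in> ?N" using M.smult_closed[OF *(1)] by simp
  qed
  have t0: "t \<zero>\<^bsub>P\<^esub> = \<zero>\<^bsub>M\<^esub>" using t(2)[of "\<zero>\<^bsub>M\<^esub>"] h0 by simp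
  have N': "left_submodule ?N' P"
    by (rule P.left_submoduleI)
      (use tD t0 in \<open>auto simp: M.smult_zero_right P.smult_closed\<close>)
  have "?N \<inter> ?N' = {\<zero>\<^bsub>P\<^esub>}" using t(2) h0 t0 hD(1) by force
  moreover have "?N <+>\<^bsub>P\<^esub> ?N' = carrier P"
  proof (intro equalityI subsetI)
    fix y assume "y \<in> ?N <+>\<^bsub>P\<^esub> ?N'"
    then show "y \<in> carrier P" using hD(1) by (auto simp: set_add_def set_mult_def)
  next
    fix y assume y: "y \<in> carrier P"
    let ?y' = "y \<ominus>\<^bsub>P\<^esub> h (t y)"
    have c: "t y \<in> carrier M" "h (t y) \<in> carrier P" using y tD(1) hD(1) by auto
    have "t ?y' = \<zero>\<^bsub>M\<^esub>"
      using module_hom_minus[OF P.left_module_axioms M.left_module_axioms t(1) y c(2)] c t(2)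
      by (simp add: a_minus_def M.r_neg)
    then have "?y' \<in> ?N'" using y c by simp
    moreover have "y = h (t y) \<oplus>\<^bsub>P\<^esub> ?y'"
      using y c by (simp add: a_minus_def P.a_lcomm[of "h (t y)"] P.r_neg)
    ultimately show "y \<in> ?N <+>\<^bsub>P\<^esub> ?N'"
      using c unfolding set_add_def set_mult_def by auto
  qed
  ultimately show "direct_summand ?N P" unfolding direct_summand_def using N N' by blast
  show "module_isomorphic M (P\<lparr>carrier := ?N\<rparr>)"
    unfolding module_isomorphic_def
    using hD inj by (intro bexI[of _ h] module_homI) (auto simp: bij_betw_def)
qed

section \<open>Polynomials over a field and linear functionals\<close>

text \<open>
  The ideals of \<open>K[x]\<close> that occur below are given by closure properties; division with remainder by an
  element of least degree shows that each is generated by one of its members.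
\<close>

lemma poly_ideal_principal:
  fixes J :: "'k::field poly set"
  assumes "0 \<in> J" "\<And>p q. \<lbrakk>p \<in> J; q \<in> J\<rbrakk> \<Longrightarrow> p + q \<in> J" "\<And>p q. q \<in> J \<Longrightarrow> p * q \<in> J"
  obtains g where "g \<in> J" "\<And>q. q \<in> J \<Longrightarrow> g dvd q"
proof (cases "J = {0}")
  case True
  then show ?thesis using that[of 0] by auto
next
  case False
  then have "\<exists>p. p \<in> J \<and> p \<noteq> 0" using assms(1) by blast
  then obtain g where g: "g \<in> J" "g \<noteq> 0"
    and min: "\<And>p. \<lbrakk>p \<in> J; p \<noteq> 0\<rbrakk> \<Longrightarrow> degree g \<le> degree p"
    using ex_has_least_nat[of "\<lambda>p. p \<in> J \<and> p \<noteq> 0" _ degree] by blast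
  have "g dvd q" if "q \<in> J" for q
  proof -
    have "q mod g = q + (- (q div g)) * g"
      by (simp add: minus_div_mult_eq_mod[symmetric])
    then have "q mod g \<in> J" using assms(2)[OF that assms(3)[OF g(1)]] by metis
    then have "q mod g = 0" using min[of "q mod g"] degree_mod_less[of g q] g(2) by force
    then show ?thesis by (simp add: mod_eq_0_iff_dvd)
  qed
  then show ?thesis using that g(1) by blast
qed

lemma irreducible_poly_bezout:
  fixes f p :: "'k::field poly"
  assumes "irreducible f" "\<not> f dvd p"
  obtains a b where "a * p + b * f = 1"
proof -
  let ?J = "{a * p + b * f | a b. True}"
  obtain g where g: "g \<in> ?J" "\<And>q. q \<in> ?J \<Longrightarrow> g dvd q"
  proof (rule poly_ideal_principal[of ?J])
    show "0 \<in> ?J" by (auto intro: exI[of _ 0])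
  next
    fix q q' assume "q \<in> ?J" "q' \<in> ?J"
    then obtain a b a' b' where "q = a * p + b * f" "q' = a' * p + b' * f" by blast
    then have "q + q' = (a + a') * p + (b + b') * f" by (simp add: algebra_simps)
    then show "q + q' \<in> ?J" by blast
  next
    fix r q assume "q \<in> ?J"
    then obtain a b where "q = a * p + b * f" by blast
    then have "r * q = (r * a) * p + (r * b) * f" by (simp add: algebra_simps)
    then show "r * q \<in> ?J" by blast
  qed blast
  have "1 * p + 0 * f \<in> ?J" "0 * p + 1 * f \<in> ?J" by blast+
  then have "p \<in> ?J" "f \<in> ?J" by simp_all
  then have dvd: "g dvd p" "g dvd f" using g(2) by blast+
  then have "is_unit g" using irreducibleD'[OF assms(1)] assms(2) dvd_trans[of f g p] by blast
  then obtain u where "1 = g * u" by (rule dvdE)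
  moreover obtain a b where ab: "g = a * p + b * f" using g(1) by blast
  have "(u * a) * p + (u * b) * f = g * u" unfolding ab by (simp add: algebra_simps)
  ultimately have "(u * a) * p + (u * b) * f = 1" by simp
  then show ?thesis using that by blast
qed

lemma exists_irreducible_factor:
  fixes g :: "'k::field poly"
  assumes "\<not> is_unit g" "g \<noteq> 0"
  obtains f where "irreducible f" "f dvd g"
  using assms
proof (induction "degree g" arbitrary: g thesis rule: less_induct)
  case less
  show ?case
  proof (cases "irreducible g")
    case False
    then obtain a b where ab: "g = a * b" "\<not> is_unit a" "\<not> is_unit b"
      using less.prems by (auto simp: irreducible_def)
    then have "a \<noteq> 0" "b \<noteq> 0" using less.prems by auto
    then have "degree g = degree a + degree b" "degree b \<noteq> 0"
      using ab by (auto simp: degree_mult_eq is_unit_iff_degree)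
    then obtain f where "irreducible f" "f dvd a"
      using less.hyps[of a] ab \<open>a \<noteq> 0\<close> by auto
    then show ?thesis using less.prems(1) ab by (meson dvd_mult2)
  qed (use less.prems in auto)
qed

context vector_space
begin

text \<open>
  A functional given only on a subspace agrees, on a basis of it, with a linear functional on the whole
  space, hence on the span of that basis.
\<close>

lemma functional_extends:
  assumes S: "subspace S"
    and add: "\<And>x y. \<lbrakk>x \<in> S; y \<in> S\<rbrakk> \<Longrightarrow> f (x + y) = f x + f y"
    and scale: "\<And>a x. x \<in> S \<Longrightarrow> f (a *s x) = a * f x"
  obtains g where "\<And>x y. g (x + y) = g x + g y" "\<And>a x. g (a *s x) = a * g x"
    "\<And>x. x \<in> S \<Longrightarrow> g x = f x"
proof -
  interpret K: vector_space "(*) :: 'a \<Rightarrow> 'a \<Rightarrow> 'a" by unfold_locales (simp_all add: algebra_simps)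
  interpret pair: vector_space_pair scale "(*) :: 'a \<Rightarrow> 'a \<Rightarrow> 'a" ..
  obtain B where B: "B \<subseteq> S" "independent B" "S \<subseteq> span B" by (rule basis_exists)
  obtain g where "Vector_Spaces.linear scale (*) g" and gB: "\<forall>x\<in>B. g x = f x"
    using pair.linear_independent_extend[OF B(2)] by blast
  then interpret g: Vector_Spaces.linear scale "(*)" g by simp
  have f0: "f 0 = 0" using scale[of 0 0] subspace_0[OF S] by simp
  have "subspace {x \<in> S. g x = f x}"
    by (rule subspaceI)
      (use S f0 in \<open>auto simp: add scale g.add g.scale g.zero subspace_0 subspace_add subspace_scale\<close>)
  moreover have "B \<subseteq> {x \<in> S. g x = f x}" using B(1) gB by auto
  ultimately have "span B \<subseteq> {x \<in> S. g x = f x}" by (rule span_minimal[rotated])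
  then show ?thesis using that[of g] B(3) by (auto simp: g.add g.scale)
qed

end

section \<open>The algebra as \<open>K\<langle>x, y | x y = 1\<rangle>\<close>\<close>

lift_definition leavitt_letter :: "gen \<Rightarrow> 'k::field leavitt" is letter .

definition jac_x :: "'k::field leavitt" where
  "jac_x = leavitt_letter Gcs + leavitt_letter Gds"

definition jac_y :: "'k::field leavitt" where
  "jac_y = leavitt_letter Gc + leavitt_letter Gd"

abbreviation jac_w :: "'k::field leavitt" where
  "jac_w \<equiv> leavitt_letter Gw"

lemma leavitt_rel_refl: "leavitt_rel p p"
  using equivp_leavitt_rel by (rule equivp_reflp)

lemma leavitt_relI: "p - q \<in> relators \<Longrightarrow> leavitt_rel p q"
  using two_sided_ideal.generator[of "p - q" relators 1 1] by (simp add: leavitt_rel_def)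

lemma leavitt_relators:
  shows "leavitt_letter Gv + leavitt_letter Gw = (1 :: 'k::field leavitt)"
    and "leavitt_letter Gv * leavitt_letter Gw = (0 :: 'k leavitt)"
    and "leavitt_letter Gw * leavitt_letter Gv = (0 :: 'k leavitt)"
    and "leavitt_letter Gc = (leavitt_letter Gv * leavitt_letter Gc :: 'k leavitt)"
    and "leavitt_letter Gc = (leavitt_letter Gc * leavitt_letter Gv :: 'k leavitt)"
    and "leavitt_letter Gcs = (leavitt_letter Gv * leavitt_letter Gcs :: 'k leavitt)"
    and "leavitt_letter Gcs = (leavitt_letter Gcs * leavitt_letter Gv :: 'k leavitt)"
    and "leavitt_letter Gd = (leavitt_letter Gv * leavitt_letter Gd :: 'k leavitt)"
    and "leavitt_letter Gd = (leavitt_letter Gd * leavitt_letter Gw :: 'k leavitt)"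
    and "leavitt_letter Gds = (leavitt_letter Gw * leavitt_letter Gds :: 'k leavitt)"
    and "leavitt_letter Gds = (leavitt_letter Gds * leavitt_letter Gv :: 'k leavitt)"
    and "leavitt_letter Gcs * leavitt_letter Gc = (leavitt_letter Gv :: 'k leavitt)"
    and "leavitt_letter Gds * leavitt_letter Gd = (leavitt_letter Gw :: 'k leavitt)"
    and "leavitt_letter Gcs * leavitt_letter Gd = (0 :: 'k leavitt)"
    and "leavitt_letter Gds * leavitt_letter Gc = (0 :: 'k leavitt)"
    and "leavitt_letter Gc * leavitt_letter Gcs + leavitt_letter Gd * leavitt_letter Gds
      = (leavitt_letter Gv :: 'k leavitt)"
  by (transfer, rule leavitt_relI, simp add: relators_def Let_def; fail)+

text \<open>
  The loop and the exit together form one injective shift \<open>y = c + d\<close>, whose left inverse is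
  \<open>x = c\<^sup>* + d\<^sup>*\<close>; the vertex \<open>w\<close> is the defect of \<open>x\<close> as a right inverse.
\<close>

lemma jac_x_y: "jac_x * jac_y = (1 :: 'k::field leavitt)"
  using leavitt_relators(1)
  by (simp add: jac_x_def jac_y_def distrib_left distrib_right leavitt_relators(12-15) add.commute)

text \<open>
  Edges that do not compose have product zero, because the orthogonal vertices at their ends can be
  inserted between them.
\<close>

lemma mult_eq_zero_between:
  fixes a b e e' :: "'r::ring_1"
  assumes "a = a * e" "b = e' * b" "e * e' = 0"
  shows "a * b = 0"
proof -
  have "a * b = (a * e) * (e' * b)" using assms(1,2) by simp
  also have "\<dots> = a * (e * e') * b" by (simp only: mult.assoc)
  finally show ?thesis using assms(3) by simp
qed

lemma letter_mult_zero:
  shows "leavitt_letter Gc * leavitt_letter Gds = (0 :: 'k::field leavitt)"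
    and "leavitt_letter Gd * leavitt_letter Gcs = (0 :: 'k leavitt)"
  by (rule mult_eq_zero_between[OF leavitt_relators(5,10,2)])
    (rule mult_eq_zero_between[OF leavitt_relators(9,6,3)])

lemma letter_v_idem:
  "leavitt_letter Gv = (leavitt_letter Gv * leavitt_letter Gv :: 'k::field leavitt)"
  using arg_cong[OF leavitt_relators(1), of "\<lambda>r. leavitt_letter Gv * r", symmetric]
  unfolding distrib_left leavitt_relators(2) by simp

lemma jac_y_x: "jac_y * jac_x = 1 - (jac_w :: 'k::field leavitt)"
proof -
  have "jac_y * jac_x = (leavitt_letter Gv :: 'k leavitt)"
    by (simp add: jac_x_def jac_y_def distrib_left distrib_right letter_mult_zero leavitt_relators(16))
  then show ?thesis using leavitt_relators(1) by (simp add: eq_diff_eq)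
qed

lemma letter_v: "leavitt_letter Gv = (jac_y * jac_x :: 'k::field leavitt)"
  using leavitt_relators(1) by (metis jac_y_x add_diff_cancel_right')

lemma letter_w: "jac_w = (1 - jac_y * jac_x :: 'k::field leavitt)"
  by (simp add: jac_y_x)

lemma letter_c: "leavitt_letter Gc = (jac_y * jac_y * jac_x :: 'k::field leavitt)"
proof -
  have "leavitt_letter Gd * leavitt_letter Gv = (0 :: 'k leavitt)"
    by (rule mult_eq_zero_between[OF leavitt_relators(9) letter_v_idem leavitt_relators(3)])
  then have "jac_y * leavitt_letter Gv = (leavitt_letter Gc :: 'k leavitt)"
    by (simp add: jac_y_def distrib_right flip: leavitt_relators(5))
  then show ?thesis by (simp add: letter_v mult.assoc)
qed

lemma letter_d: "leavitt_letter Gd = (jac_y - jac_y * jac_y * jac_x :: 'k::field leavitt)"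
  unfolding letter_c[symmetric] by (simp add: jac_y_def)

lemma letter_cs: "leavitt_letter Gcs = (jac_y * jac_x * jac_x :: 'k::field leavitt)"
proof -
  have "leavitt_letter Gv * leavitt_letter Gds = (0 :: 'k leavitt)"
    by (rule mult_eq_zero_between[OF letter_v_idem leavitt_relators(10,2)])
  then have "leavitt_letter Gv * jac_x = (leavitt_letter Gcs :: 'k leavitt)"
    by (simp add: jac_x_def distrib_left flip: leavitt_relators(6))
  then show ?thesis by (simp add: letter_v)
qed

lemma letter_ds: "leavitt_letter Gds = (jac_x - jac_y * jac_x * jac_x :: 'k::field leavitt)"
  unfolding letter_cs[symmetric] by (simp add: jac_x_def)

lemma leavitt_c_eq: "leavitt_c = (jac_y * jac_y * jac_x :: 'k::field leavitt)"
proof -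
  have "leavitt_c = (leavitt_letter Gc :: 'k leavitt)" by transfer (rule leavitt_rel_refl)
  then show ?thesis by (simp add: letter_c)
qed

lemma jac_x_y_left: "jac_x * (jac_y * r) = (r :: 'k::field leavitt)"
  by (simp add: jac_x_y mult.assoc[symmetric])

lemma jac_x_y_power: "jac_x ^ n * jac_y ^ n = (1 :: 'k::field leavitt)"
proof (induction n)
  case (Suc n)
  have "jac_x ^ Suc n * jac_y ^ Suc n = jac_x ^ n * (jac_x * (jac_y * jac_y ^ n) :: 'k leavitt)"
    by (subst power_Suc2) (simp add: mult.assoc)
  then show ?case using Suc by (simp add: jac_x_y_left)
qed simp

lemma jac_w_y: "jac_w * jac_y = (0 :: 'k::field leavitt)"
  by (simp add: letter_w left_diff_distrib mult.assoc jac_x_y)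

lemma jac_x_w: "jac_x * jac_w = (0 :: 'k::field leavitt)"
  by (simp add: letter_w right_diff_distrib mult.assoc[symmetric] jac_x_y)

lemma jac_w_y_left: "jac_w * (jac_y * r) = (0 :: 'k::field leavitt)"
  by (simp add: jac_w_y mult.assoc[symmetric])

lemma jac_w_w: "jac_w * jac_w = (jac_w :: 'k::field leavitt)"
  by (subst (2) letter_w) (simp add: right_diff_distrib jac_w_y_left)

subsection \<open>Scalars and polynomial expressions\<close>

lemma scalar_add: "leavitt_scalar (a + b) = (leavitt_scalar a + leavitt_scalar b :: 'k::field leavitt)"
  by transfer (simp add: single_add leavitt_rel_refl)

lemma scalar_mult: "leavitt_scalar (a * b) = (leavitt_scalar a * leavitt_scalar b :: 'k::field leavitt)"
  by transfer (simp add: mult_single leavitt_rel_refl)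

lemma scalar_zero [simp]: "leavitt_scalar 0 = (0 :: 'k::field leavitt)"
  by transfer (simp add: leavitt_rel_refl)

lemma scalar_one [simp]: "leavitt_scalar 1 = (1 :: 'k::field leavitt)"
  by transfer (simp add: leavitt_rel_refl)

lemma scalar_central: "leavitt_scalar a * r = r * (leavitt_scalar a :: 'k::field leavitt)"
proof transfer
  fix a :: 'k and p :: "word \<Rightarrow>\<^sub>0 'k"
  have "Poly_Mapping.single 0 a * p = p * Poly_Mapping.single 0 a"
    by (induction p rule: free_algebra_induct)
      (simp_all add: mult_single distrib_left distrib_right mult.commute)
  then show "leavitt_rel (Poly_Mapping.single 0 a * p) (p * Poly_Mapping.single 0 a)"
    by (simp add: leavitt_rel_refl)
qed

lemma scalar_left_commute:
  "r * (leavitt_scalar a * s) = leavitt_scalar a * (r * s :: 'k::field leavitt)"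
  by (metis mult.assoc scalar_central)

text \<open>
  The same expression as the one that defines \<^const>\<open>eval_c\<close>, at an arbitrary element of the algebra.  Since
  scalars are central, it is a ring homomorphism in the polynomial.
\<close>

definition poly_at :: "'k::field leavitt \<Rightarrow> 'k poly \<Rightarrow> 'k leavitt" where
  "poly_at t p = (\<Sum>i\<le>degree p. leavitt_scalar (coeff p i) * t ^ i)"

lemma eval_c_eq: "eval_c p = poly_at leavitt_c p"
  by (simp add: eval_c_def poly_at_def)

lemma poly_at_0 [simp]: "poly_at t 0 = 0"
  by (simp add: poly_at_def)

lemma poly_at_pCons: "poly_at t (pCons a p) = leavitt_scalar a + t * poly_at t p"
proof (cases "p = 0")
  case True
  then show ?thesis by (simp add: poly_at_def)
next
  case False
  have "poly_at t (pCons a p) =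
      leavitt_scalar a + (\<Sum>i\<le>degree p. leavitt_scalar (coeff p i) * (t * t ^ i))"
    using False by (simp add: poly_at_def sum.atMost_Suc_shift del: sum.atMost_Suc)
  also have "\<dots> = leavitt_scalar a + t * poly_at t p"
    by (simp add: poly_at_def sum_distrib_left scalar_left_commute)
  finally show ?thesis .
qed

lemma poly_at_1 [simp]: "poly_at t 1 = 1"
  using poly_at_pCons[of t 1 0] by (simp add: one_pCons)

lemma poly_at_add: "poly_at t (p + q) = poly_at t p + poly_at t q"
proof (induction p arbitrary: q)
  case (pCons a p)
  then show ?case
    by (cases q) (simp add: poly_at_pCons scalar_add algebra_simps)
qed simp

lemma poly_at_smult: "poly_at t (smult a p) = leavitt_scalar a * poly_at t p"
  by (induction p)
    (simp_all add: poly_at_pCons scalar_mult distrib_left scalar_left_commute)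

lemma poly_at_mult: "poly_at t (p * q) = poly_at t p * poly_at t q"
  by (induction p)
    (simp_all add: poly_at_add poly_at_smult poly_at_pCons distrib_right mult.assoc)

lemma poly_at_commute: "poly_at t p * poly_at t q = poly_at t q * poly_at t p"
  by (metis poly_at_mult mult.commute)

lemma poly_at_X [simp]: "poly_at t [:0, 1:] = t"
  by (simp add: poly_at_pCons)

lemma poly_at_var_commute: "poly_at t p * t = t * poly_at t p"
  using poly_at_commute[of t p "[:0, 1:]"] by simp

lemma poly_at_monom: "poly_at t (monom a n) = leavitt_scalar a * t ^ n"
  by (induction n) (simp_all add: monom_0 monom_Suc poly_at_pCons scalar_left_commute)

subsection \<open>Induction and normal forms\<close>

text \<open>
  Every generator of the presentation is an expression in \<open>x\<close> and \<open>y\<close>, so a property that is stable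
  under linear combinations and under multiplication by \<open>x\<close> and \<open>y\<close> from the left holds everywhere.
\<close>

lemma leavitt_induct [case_names one scalar add x y]:
  fixes r :: "'k::field leavitt"
  assumes one: "P 1"
    and scalar: "\<And>a r. P r \<Longrightarrow> P (leavitt_scalar a * r)"
    and add: "\<And>r s. \<lbrakk>P r; P s\<rbrakk> \<Longrightarrow> P (r + s)"
    and x: "\<And>r. P r \<Longrightarrow> P (jac_x * r)"
    and y: "\<And>r. P r \<Longrightarrow> P (jac_y * r)"
  shows "P r"
proof -
  have diff: "P (r - s)" if "P r" "P s" for r s
  proof -
    have "leavitt_scalar (- 1) = (- 1 :: 'k leavitt)"
      using scalar_add[of "- 1 :: 'k" 1] by (simp add: add_eq_0_iff2)
    then show ?thesis using add[OF that(1) scalar[OF that(2), of "- 1"]] by simp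
  qed
  have letter: "P (leavitt_letter g * r)" if "P r" for g r
    using that
    by (cases g)
      (simp_all add: letter_v letter_w letter_c letter_d letter_cs letter_ds
        left_diff_distrib mult.assoc x y diff)
  have word: "P (abs_leavitt (Poly_Mapping.single (Word gs) 1))" for gs
  proof (induction gs)
    case Nil
    have "abs_leavitt (Poly_Mapping.single (Word []) 1) = (1 :: 'k leavitt)"
      by (simp add: one_leavitt.abs_eq flip: zero_word_def)
    then show ?case using one by simp
  next
    case (Cons g gs)
    have "(Poly_Mapping.single (Word (g # gs)) 1 :: word \<Rightarrow>\<^sub>0 'k) =
        letter g * Poly_Mapping.single (Word gs) 1"
      by (simp add: letter_def mult_single plus_word_def)
    then show ?case using letter[OF Cons] by (simp add: leavitt_letter.abs_eq times_leavitt.abs_eq)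
  qed
  have "P (abs_leavitt p)" for p
  proof (induction p rule: free_algebra_induct)
    case zero
    then show ?case using scalar[OF one, of 0] by (simp add: zero_leavitt.abs_eq)
  next
    case (single u a)
    have "(Poly_Mapping.single u a :: word \<Rightarrow>\<^sub>0 'k) =
        Poly_Mapping.single 0 a * Poly_Mapping.single u 1"
      by (simp add: mult_single)
    then have "abs_leavitt (Poly_Mapping.single u a) =
        leavitt_scalar a * abs_leavitt (Poly_Mapping.single u 1)"
      by (simp add: leavitt_scalar.abs_eq times_leavitt.abs_eq)
    then show ?case using scalar[OF word[of "letters u"], of a] by simp
  next
    case (add p q)
    then show ?case using assms(3) by (metis plus_leavitt.abs_eq)
  qed
  then show ?thesis by (metis Quotient3_abs_rep Quotient3_leavitt)
qed

text \<open>
  The algebra is spanned by the products \<open>y\<^sup>i x\<^sup>j\<close>.  This and the next two lemmas draw consequences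
  from that: \<open>x w = 0\<close> removes the powers of \<open>x\<close> in front of \<open>w\<close>, and multiplication by a high
  power of \<open>x\<close> from the left, or of \<open>y\<close> from the right, leaves only powers of that one element.
\<close>

lemma normal_form_w: "\<exists>p. r * jac_w = poly_at jac_y p * (jac_w :: 'k::field leavitt)"
proof (induction r rule: leavitt_induct)
  case one
  then show ?case by (intro exI[of _ 1]) simp
next
  case (scalar a r)
  then show ?case by (metis poly_at_smult mult.assoc)
next
  case (add r s)
  then show ?case by (metis poly_at_add distrib_right)
next
  case (x r)
  then obtain p where "r * jac_w = poly_at jac_y p * jac_w" by blast
  then show ?case
    by (cases p)
      (auto simp: mult.assoc poly_at_pCons distrib_left distrib_right scalar_left_commute
        jac_x_y_left jac_x_w)
next
  case (y r)
  then obtain p where "r * jac_w = poly_at jac_y p * jac_w" by blast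
  then have "jac_y * r * jac_w = poly_at jac_y (pCons 0 p) * jac_w"
    by (simp add: poly_at_pCons mult.assoc)
  then show ?case by blast
qed

lemma normal_form_left: "\<exists>n q. jac_x ^ n * r = poly_at jac_x (q :: 'k::field poly)"
proof (induction r rule: leavitt_induct)
  case one
  then show ?case by (intro exI[of _ 0] exI[of _ 1]) simp
next
  case (scalar a r)
  then show ?case by (metis poly_at_smult scalar_left_commute)
next
  case (add r s)
  then obtain n q n' q' where *: "jac_x ^ n * r = poly_at jac_x q" "jac_x ^ n' * s = poly_at jac_x q'"
    by blast
  have "jac_x ^ (n + n') * (r + s) = jac_x ^ n' * (jac_x ^ n * r) + jac_x ^ n * (jac_x ^ n' * s)"
    by (simp add: distrib_left mult.assoc[symmetric] power_add[symmetric] add.commute)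
  also have "\<dots> = poly_at jac_x (monom 1 n' * q + monom 1 n * q')"
    by (simp add: * poly_at_add poly_at_mult poly_at_monom)
  finally show ?case by blast
next
  case (x r)
  then obtain n q where "jac_x ^ n * r = poly_at jac_x q" by blast
  moreover have "jac_x ^ n * (jac_x * r) = jac_x * (jac_x ^ n * r)"
    by (metis mult.assoc power_commutes)
  ultimately have "jac_x ^ n * (jac_x * r) = poly_at jac_x (pCons 0 q)"
    by (simp add: poly_at_pCons)
  then show ?case by blast
next
  case (y r)
  then obtain n q where "jac_x ^ n * r = poly_at jac_x q" by blast
  then have "jac_x ^ Suc n * (jac_y * r) = poly_at jac_x q"
    by (simp only: power_Suc2 mult.assoc jac_x_y_left)
  then show ?case by blast
qed

lemma normal_form_right: "\<exists>n p. r * jac_y ^ n = poly_at jac_y (p :: 'k::field poly)"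
proof (induction r rule: leavitt_induct)
  case one
  then show ?case by (intro exI[of _ 0] exI[of _ 1]) simp
next
  case (scalar a r)
  then show ?case by (metis poly_at_smult mult.assoc)
next
  case (add r s)
  then obtain n p n' p' where *: "r * jac_y ^ n = poly_at jac_y p" "s * jac_y ^ n' = poly_at jac_y p'"
    by blast
  have "(r + s) * jac_y ^ (n + n') = r * jac_y ^ n * jac_y ^ n' + s * jac_y ^ n' * jac_y ^ n"
    by (simp add: distrib_right mult.assoc power_add[symmetric] add.commute)
  also have "\<dots> = poly_at jac_y (p * monom 1 n' + p' * monom 1 n)"
    by (simp add: * poly_at_add poly_at_mult poly_at_monom)
  finally show ?case by blast
next
  case (x r)
  then obtain n p where "r * jac_y ^ n = poly_at jac_y p" by blast
  then have "jac_x * r * jac_y ^ Suc n = jac_x * (poly_at jac_y p * jac_y)"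
    by (simp add: power_Suc2 mult.assoc del: power_Suc flip: \<open>r * jac_y ^ n = _\<close>)
  also have "\<dots> = poly_at jac_y p" by (simp add: poly_at_var_commute jac_x_y_left)
  finally show ?case by blast
next
  case (y r)
  then obtain n p where "r * jac_y ^ n = poly_at jac_y p" by blast
  then have "jac_y * r * jac_y ^ n = poly_at jac_y (pCons 0 p)"
    by (simp add: poly_at_pCons mult.assoc)
  then show ?case by blast
qed

text \<open>
  Reversing the coefficients: \<open>x\<^sup>n y\<^sup>i = x\<^bsup>n-i\<^esup>\<close> for \<open>i \<le> n\<close>.
\<close>

lemma poly_x_eq_poly_y:
  "\<exists>n p'. poly_at jac_x p = jac_x ^ n * poly_at jac_y p' \<and> (p \<noteq> 0 \<longrightarrow> p' \<noteq> 0)"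
proof -
  \<comment> \<open>The degree bound keeps the leading term that each step adds from cancelling.\<close>
  have "\<exists>n p'. poly_at jac_x p = jac_x ^ n * poly_at jac_y p' \<and> (p \<noteq> 0 \<longrightarrow> p' \<noteq> 0) \<and> degree p' \<le> n"
  proof (induction p)
    case 0
    then show ?case by (intro exI[of _ 0]) simp
  next
    case (pCons a p)
    then obtain n p' where *: "poly_at jac_x p = jac_x ^ n * poly_at jac_y p'" "p \<noteq> 0 \<Longrightarrow> p' \<noteq> 0"
      "degree p' \<le> n" by blast
    let ?p = "monom a (Suc n) + p'"
    have "poly_at jac_x (pCons a p) = jac_x ^ Suc n * poly_at jac_y ?p"
    proof -
      have "jac_x ^ Suc n * poly_at jac_y ?p =
          leavitt_scalar a * (jac_x ^ Suc n * jac_y ^ Suc n) + jac_x ^ Suc n * poly_at jac_y p'"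
        by (simp add: poly_at_add poly_at_monom distrib_left scalar_left_commute del: power_Suc)
      then show ?thesis unfolding jac_x_y_power by (simp add: poly_at_pCons *(1) mult.assoc)
    qed
    moreover have "?p \<noteq> 0"
    proof
      assume 0: "?p = 0"
      have "coeff p' (Suc n) = 0" using *(3) by (intro coeff_eq_0) simp
      then have "a = 0" using arg_cong[OF 0, of "\<lambda>q. coeff q (Suc n)"] by simp
      then show False using 0 *(2) pCons.hyps by simp
    qed
    moreover have "degree ?p \<le> Suc n"
      using *(3) by (intro degree_add_le) (simp_all add: degree_monom_le)
    ultimately show ?case by blast
  qed
  then show ?thesis by blast
qed

text \<open>
  An element fixed by \<open>w\<close> generates a copy of \<open>R w\<close>, in which the \<open>y\<^sup>i n\<close> are linearly independent:
  applying \<open>w\<close> isolates the constant coefficient of \<open>p(y) n\<close>, since \<open>w y = 0\<close>, and applying \<open>x\<close> then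
  lowers all exponents.
\<close>

lemma poly_at_y_zero:
  assumes "left_module M" "n \<in> carrier M" "jac_w \<odot>\<^bsub>M\<^esub> n = n" "n \<noteq> \<zero>\<^bsub>M\<^esub>"
    and "poly_at jac_y p \<odot>\<^bsub>M\<^esub> n = \<zero>\<^bsub>M\<^esub>"
  shows "p = 0"
  using assms(5)
proof (induction p)
  case (pCons a p)
  interpret left_module M by fact
  have "leavitt_scalar a \<odot>\<^bsub>M\<^esub> n = (jac_w * poly_at jac_y (pCons a p)) \<odot>\<^bsub>M\<^esub> n"
  proof -
    have "jac_w * poly_at jac_y (pCons a p) = leavitt_scalar a * jac_w"
      by (simp add: poly_at_pCons distrib_left jac_w_y_left scalar_central)
    then show ?thesis using assms(2,3) by (simp add: smult_assoc)
  qed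
  also have "\<dots> = \<zero>\<^bsub>M\<^esub>" using assms(2) pCons.prems by (simp add: smult_assoc smult_zero_right)
  finally have a: "leavitt_scalar a \<odot>\<^bsub>M\<^esub> n = \<zero>\<^bsub>M\<^esub>" .
  have "a = 0"
  proof (rule ccontr)
    assume "a \<noteq> 0"
    then have "n = (leavitt_scalar (inverse a) * leavitt_scalar a) \<odot>\<^bsub>M\<^esub> n"
      using assms(2) by (simp add: smult_one flip: scalar_mult)
    then show False using a assms(2,4) by (simp add: smult_assoc smult_zero_right)
  qed
  then have "poly_at jac_y p \<odot>\<^bsub>M\<^esub> n = (jac_x * poly_at jac_y (pCons a p)) \<odot>\<^bsub>M\<^esub> n"
    by (simp add: poly_at_pCons jac_x_y_left)
  also have "\<dots> = \<zero>\<^bsub>M\<^esub>" using assms(2) pCons.prems by (simp add: smult_assoc smult_zero_right)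
  finally show ?case using pCons.IH \<open>a = 0\<close> by simp
qed simp

section \<open>The module of formal series\<close>

lemma Y_module_sel [simp]:
  "carrier Y_module = UNIV" "zero Y_module = (\<lambda>_. 0)"
  "add Y_module = (\<lambda>y z n. y n + z n)" "module.smult Y_module = series_smult"
  by (simp_all add: Y_module_def)

lemma series_smult_add: "series_smult (r + s) y = (\<lambda>n. series_smult r y n + series_smult s y n)"
  by transfer (rule series_free_add)

lemma series_smult_mult: "series_smult (r * s) y = series_smult r (series_smult s y)"
  by transfer (rule series_free_mult)

lemma series_smult_one: "series_smult 1 y = y"
  by transfer simp

lemma series_smult_zero: "series_smult 0 y = (\<lambda>_. 0)"
  by transfer simp

lemma series_smult_add_right:
  "series_smult r (\<lambda>n. y n + z n) = (\<lambda>n. series_smult r y n + series_smult r z n)"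
  by transfer (rule series_free_add_right)

lemma series_smult_letter: "series_smult (leavitt_letter g) y = series_gen g y"
  by transfer (simp add: letter_def series_free_single series_word_def)

lemma series_smult_scalar: "series_smult (leavitt_scalar a) y = (\<lambda>n. a * y n)"
  by transfer (simp add: series_free_single)

lemma left_module_Y: "left_module Y_module"
  by (rule left_moduleI)
    (simp_all add: series_smult_add series_smult_mult series_smult_one series_smult_zero
      series_smult_add_right add_ac)

lemma series_smult_x: "series_smult jac_x y n = y (Suc n)"
  by (cases n) (simp_all add: jac_x_def series_smult_add series_smult_letter)

lemma series_smult_y: "series_smult jac_y y n = (case n of 0 \<Rightarrow> 0 | Suc i \<Rightarrow> y i)"
  by (auto simp: jac_y_def series_smult_add series_smult_letter split: nat.splits)

lemma series_smult_x_power: "series_smult (jac_x ^ k) y n = y (n + k)"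
  by (induction k arbitrary: n y) (simp_all add: series_smult_one series_smult_mult series_smult_x)

text \<open>
  \<open>Y\<close> is the \<open>K\<close>-dual of the right ideal \<open>w R\<close>, whose elements \<open>w x\<^sup>j\<close> correspond to the coefficients of
  a series.  A homomorphism \<open>\<phi>\<close> on a left ideal satisfies \<open>(\<phi> r)\<^sub>j = (\<phi> (x\<^sup>j r))\<^sub>0\<close> and
  \<open>(\<phi> r)\<^sub>0 = (\<phi> (w r))\<^sub>0\<close>, so it is determined by the functional \<open>r \<mapsto> (\<phi> r)\<^sub>0\<close>.  If \<open>\<Lambda>\<close> extends this
  functional to \<open>R\<close>, the series with coefficients \<open>\<Lambda> (w x\<^sup>j)\<close> represents \<open>\<phi>\<close>.
\<close>

lemma baer_Y: "baer_module (Y_module :: ('k::field leavitt, nat \<Rightarrow> 'k) module)"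
  unfolding baer_module_def
proof (intro conjI allI ballI impI)
  show "left_module Y_module" by (rule left_module_Y)
  fix I :: "'k leavitt set" and \<phi>
  assume \<phi>: "\<phi> \<in> module_hom (regular_module\<lparr>carrier := I\<rparr>) Y_module"
    and I: "left_submodule I regular_module"
  note hom = ideal_homD[OF \<phi>, unfolded Y_module_sel] and ideal = left_submoduleD[OF I, simplified]
  interpret vector_space "\<lambda>a (r :: 'k leavitt). leavitt_scalar a * r"
    by unfold_locales (simp_all add: distrib_left distrib_right scalar_add scalar_mult mult.assoc)
  obtain \<Lambda> :: "'k leavitt \<Rightarrow> 'k" where
    \<Lambda>_add: "\<And>r s. \<Lambda> (r + s) = \<Lambda> r + \<Lambda> s" and
    \<Lambda>_scale: "\<And>a r. \<Lambda> (leavitt_scalar a * r) = a * \<Lambda> r" and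
    \<Lambda>_I: "\<And>r. r \<in> I \<Longrightarrow> \<Lambda> r = \<phi> r 0"
  proof (rule functional_extends[of I "\<lambda>r. \<phi> r 0"])
    show "subspace I" by (rule subspaceI) (use ideal in auto)
  next
    fix g :: "'k leavitt \<Rightarrow> 'k"
    assume "\<And>r s. g (r + s) = g r + g s" "\<And>a r. g (leavitt_scalar a * r) = a * g r"
      "\<And>r. r \<in> I \<Longrightarrow> g r = \<phi> r 0"
    then show thesis by (rule that)
  qed (simp_all add: hom series_smult_scalar)
  have \<Lambda>_0: "\<Lambda> 0 = 0" using \<Lambda>_scale[of 0 0] by simp
  define m where "m j = \<Lambda> (jac_w * jac_x ^ j)" for j
  have m: "series_smult s m j = \<Lambda> (jac_w * jac_x ^ j * s)" for s j
  proof (induction s arbitrary: j rule: leavitt_induct)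
    case one
    then show ?case by (simp add: series_smult_one m_def)
  next
    case (scalar a r)
    then show ?case
      by (simp add: series_smult_mult series_smult_scalar scalar_left_commute \<Lambda>_scale)
  next
    case (add r s)
    then show ?case by (simp add: series_smult_add distrib_left \<Lambda>_add)
  next
    case (x r)
    then show ?case
      by (simp add: series_smult_mult series_smult_x power_Suc2 mult.assoc del: power_Suc)
  next
    case (y r)
    then show ?case
      by (cases j)
        (simp_all add: series_smult_mult series_smult_y jac_w_y_left \<Lambda>_0 power_Suc2 mult.assoc
          jac_x_y_left del: power_Suc)
  qed
  have "\<phi> r = series_smult r m" if r: "r \<in> I" for r
  proof
    fix j
    have xr: "jac_x ^ j * r \<in> I" using ideal(4)[OF r] .
    have "\<phi> r j = series_smult jac_w (\<phi> (jac_x ^ j * r)) 0"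
      by (simp add: hom(3)[OF r] series_smult_x_power series_smult_letter)
    also have "\<dots> = \<Lambda> (jac_w * (jac_x ^ j * r))"
      using \<Lambda>_I[OF ideal(4)[OF xr]] by (simp add: hom(3)[OF xr])
    finally show "\<phi> r j = series_smult r m j" by (simp add: m mult.assoc)
  qed
  then show "\<exists>m\<in>carrier Y_module. \<forall>r\<in>I. \<phi> r = r \<odot>\<^bsub>Y_module\<^esub> m" by auto
qed

section \<open>Modules on which the shift is invertible\<close>

text \<open>
  The assumption says that \<open>w = 1 - y x\<close> annihilates the module; as \<open>x y = 1\<close> holds anyway, \<open>x\<close> and \<open>y\<close>
  act as mutually inverse maps.
\<close>

locale laurent_module = left_module M
  for M :: "('k::field leavitt, 'a, 'z) module_scheme" (structure) +
  assumes y_x: "n \<in> carrier M \<Longrightarrow> jac_y \<odot> (jac_x \<odot> n) = n"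
begin

lemma y_x_power: "n \<in> carrier M \<Longrightarrow> (jac_y ^ k) \<odot> ((jac_x ^ k) \<odot> n) = n"
proof (induction k)
  case (Suc k)
  have "(jac_y ^ Suc k) \<odot> ((jac_x ^ Suc k) \<odot> n) =
      (jac_y ^ k) \<odot> (jac_y \<odot> (jac_x \<odot> ((jac_x ^ k) \<odot> n)))"
    using Suc.prems by (subst power_Suc2) (simp add: smult_assoc smult_closed)
  then show ?case using Suc by (simp add: y_x smult_closed)
qed (simp add: smult_one)

lemma x_y: "n \<in> carrier M \<Longrightarrow> jac_x \<odot> (jac_y \<odot> n) = n"
  by (simp add: jac_x_y smult_one flip: smult_assoc)

lemma x_y_power: "n \<in> carrier M \<Longrightarrow> (jac_x ^ k) \<odot> ((jac_y ^ k) \<odot> n) = n"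
proof (induction k)
  case (Suc k)
  have "(jac_x ^ Suc k) \<odot> ((jac_y ^ Suc k) \<odot> n) =
      (jac_x ^ k) \<odot> (jac_x \<odot> (jac_y \<odot> ((jac_y ^ k) \<odot> n)))"
    using Suc.prems by (subst power_Suc2) (simp add: smult_assoc smult_closed)
  then show ?case using Suc by (simp add: x_y smult_closed)
qed (simp add: smult_one)

lemma x_power_cancel:
  assumes "(jac_x ^ k) \<odot> m = (jac_x ^ k) \<odot> n" "m \<in> carrier M" "n \<in> carrier M"
  shows "m = n"
  using assms y_x_power by metis

text \<open>
  A left ideal \<open>I\<close> is replaced by the ideal of the \<open>q \<in> K[x]\<close> with \<open>q(x) \<in> I\<close>.  Every \<open>r \<in> I\<close> is led into
  it by a power of \<open>x\<close>, which can be undone in \<open>M\<close>, so it is enough to represent the homomorphism at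
  the generator of that ideal.
\<close>

lemma baer_if_divisible:
  assumes div: "\<And>p n. \<lbrakk>p \<noteq> 0; n \<in> carrier M\<rbrakk> \<Longrightarrow> \<exists>m\<in>carrier M. poly_at jac_y p \<odot> m = n"
  shows "baer_module M"
  unfolding baer_module_def
proof (intro conjI allI ballI impI)
  show "left_module M" by (rule left_module_axioms)
  fix I \<phi> assume \<phi>: "\<phi> \<in> module_hom (regular_module\<lparr>carrier := I\<rparr>) M"
    and I: "left_submodule I regular_module"
  note hom = ideal_homD[OF \<phi>] and ideal = left_submoduleD[OF I, simplified]
  obtain g where g: "poly_at jac_x g \<in> I" "\<And>q. poly_at jac_x q \<in> I \<Longrightarrow> g dvd q"
    by (rule poly_ideal_principal[of "{q. poly_at jac_x q \<in> I}"])
      (use ideal in \<open>auto simp: poly_at_add poly_at_mult\<close>)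
  obtain m where m: "m \<in> carrier M" "poly_at jac_x g \<odot> m = \<phi> (poly_at jac_x g)"
  proof (cases "g = 0")
    case True
    then show ?thesis
      using that[of \<zero>] ideal_hom_zero[OF left_module_axioms I \<phi>] by (simp add: smult_zero_right)
  next
    case False
    obtain k p where p: "poly_at jac_x g = jac_x ^ k * poly_at jac_y p" "p \<noteq> 0"
      using poly_x_eq_poly_y[of g] False by blast
    obtain m where "m \<in> carrier M" "poly_at jac_y p \<odot> m = (jac_y ^ k) \<odot> \<phi> (poly_at jac_x g)"
      using div[OF p(2)] hom(1)[OF g(1)] smult_closed by blast
    then show ?thesis
      using that[of m] hom(1)[OF g(1)] by (simp add: p(1) smult_assoc x_y_power)
  qed
  have "\<phi> r = r \<odot> m" if r: "r \<in> I" for r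
  proof -
    obtain k q where q: "jac_x ^ k * r = poly_at jac_x q" using normal_form_left by blast
    then have "g dvd q" using ideal(4)[OF r, of "jac_x ^ k"] g(2) by simp
    then obtain h where "q = h * g" by (metis dvdE mult.commute)
    with q have eq: "jac_x ^ k * r = poly_at jac_x h * poly_at jac_x g" by (simp add: poly_at_mult)
    have "(jac_x ^ k) \<odot> \<phi> r = \<phi> (poly_at jac_x h * poly_at jac_x g)"
      unfolding eq[symmetric] by (simp add: hom(3)[OF r])
    also have "\<dots> = (poly_at jac_x h * poly_at jac_x g) \<odot> m"
      using m by (simp add: hom(3)[OF g(1)] smult_assoc)
    also have "\<dots> = (jac_x ^ k) \<odot> (r \<odot> m)"
      unfolding eq[symmetric] using m(1) by (simp add: smult_assoc)
    finally show ?thesis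
      using x_power_cancel hom(1)[OF r] m(1) smult_closed by blast
  qed
  then show "\<exists>m\<in>carrier M. \<forall>r\<in>I. \<phi> r = r \<odot> m" using m(1) by blast
qed

end

text \<open>
  For \<open>p\<close> coprime to \<open>f\<close>, a relation \<open>a p + b f = 1\<close> gives \<open>n = p (a n) + b (f n)\<close>, and \<open>f n\<close> is annihilated by
  a smaller power of \<open>f\<close> than \<open>n\<close>.  A factor \<open>f\<close> of \<open>p\<close> is dealt with by the surjectivity of \<open>f\<close>.
\<close>

lemma (in laurent_module) primary_divisible:
  assumes irr: "irreducible f"
    and surj: "\<And>n. n \<in> carrier M \<Longrightarrow> \<exists>m\<in>carrier M. poly_at jac_y f \<odot> m = n"
    and tors: "\<And>n. n \<in> carrier M \<Longrightarrow> \<exists>i. poly_at jac_y (f ^ i) \<odot> n = \<zero>"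
    and p: "p \<noteq> 0" and n: "n \<in> carrier M"
  shows "\<exists>m\<in>carrier M. poly_at jac_y p \<odot> m = n"
proof -
  have coprime: "\<exists>m\<in>carrier M. poly_at jac_y p \<odot> m = n"
    if "\<not> f dvd p" "n \<in> carrier M" "poly_at jac_y (f ^ i) \<odot> n = \<zero>" for p n i
    using that(2,3)
  proof (induction i arbitrary: n)
    case 0
    then show ?case by (auto simp: smult_one smult_zero_right intro!: bexI[of _ \<zero>])
  next
    case (Suc i)
    obtain a b where ab: "a * p + b * f = 1" using irreducible_poly_bezout[OF irr \<open>\<not> f dvd p\<close>] .
    have "poly_at jac_y (f ^ i) \<odot> (poly_at jac_y f \<odot> n) = \<zero>"
      using Suc.prems by (simp add: poly_at_mult power_Suc2 smult_assoc del: power_Suc)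
    then obtain m where m: "m \<in> carrier M" "poly_at jac_y p \<odot> m = poly_at jac_y f \<odot> n"
      using Suc.IH[of "poly_at jac_y f \<odot> n"] Suc.prems(1) smult_closed by blast
    let ?m = "poly_at jac_y a \<odot> n \<oplus> poly_at jac_y b \<odot> m"
    have "poly_at jac_y p \<odot> ?m =
        poly_at jac_y (p * a) \<odot> n \<oplus> poly_at jac_y (p * b) \<odot> m"
      using Suc.prems(1) m(1) by (simp add: smult_r_distr smult_closed poly_at_mult smult_assoc)
    also have "poly_at jac_y (p * b) \<odot> m = poly_at jac_y (b * f) \<odot> n"
      using Suc.prems(1) m by (simp add: mult.commute[of p] poly_at_mult smult_assoc)
    also have "poly_at jac_y (p * a) \<odot> n \<oplus> poly_at jac_y (b * f) \<odot> n = n"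
      using Suc.prems(1) ab
      by (simp add: mult.commute[of p] smult_one flip: smult_l_distr poly_at_add)
    finally show ?case using Suc.prems(1) m(1) by (blast intro: smult_closed a_closed)
  qed
  from p n show ?thesis
  proof (induction "degree p" arbitrary: p n rule: less_induct)
    case less
    show ?case
    proof (cases "f dvd p")
      case False
      then show ?thesis using coprime tors less.prems(2) by blast
    next
      case True
      then obtain q where q: "p = f * q" by (rule dvdE)
      have "f \<noteq> 0" "\<not> is_unit f" "q \<noteq> 0" using irr less.prems q by (auto simp: irreducible_def)
      then have "degree q < degree p" by (simp add: q degree_mult_eq is_unit_iff_degree)
      moreover obtain n' where "n' \<in> carrier M" "poly_at jac_y f \<odot> n' = n"
        using surj[OF less.prems(2)] by blast
      moreover obtain m where "m \<in> carrier M" "poly_at jac_y q \<odot> m = n'"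
        using less.hyps[OF calculation(1) \<open>q \<noteq> 0\<close> calculation(2)] by blast
      ultimately show ?thesis by (auto simp: q poly_at_mult smult_assoc)
    qed
  qed
qed

lemma laurent_direct_sum:
  assumes "\<And>i. i \<in> I \<Longrightarrow> laurent_module (M i)"
  shows "laurent_module (direct_sum I M)"
proof -
  have lm: "left_module (M i)" if "i \<in> I" for i
    using assms[OF that] by (rule laurent_module.axioms)
  interpret left_module "direct_sum I M" by (rule left_module_direct_sum) (rule lm)
  show ?thesis
  proof (intro laurent_module.intro left_module_axioms laurent_module_axioms.intro)
    fix n assume "n \<in> carrier (direct_sum I M)"
    then have n: "n \<in> (\<Pi>\<^sub>E i\<in>I. carrier (M i))" by simp
    show "jac_y \<odot>\<^bsub>direct_sum I M\<^esub> (jac_x \<odot>\<^bsub>direct_sum I M\<^esub> n) = n"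
      using laurent_module.y_x[OF assms PiE_mem[OF n]] PiE_arb[OF n] by (simp add: fun_eq_iff)
  qed
qed

text \<open>
  Dividing zero components by choosing zero keeps the support finite.
\<close>

lemma direct_sum_divisible:
  assumes M: "\<And>i. i \<in> I \<Longrightarrow> left_module (M i)"
    and div: "\<And>i n. \<lbrakk>i \<in> I; n \<in> carrier (M i)\<rbrakk> \<Longrightarrow> \<exists>m\<in>carrier (M i). r \<odot>\<^bsub>M i\<^esub> m = n"
    and n: "n \<in> carrier (direct_sum I M)"
  shows "\<exists>m\<in>carrier (direct_sum I M). r \<odot>\<^bsub>direct_sum I M\<^esub> m = n"
proof -
  have nP: "n \<in> (\<Pi>\<^sub>E i\<in>I. carrier (M i))" and fin: "finite {i\<in>I. n i \<noteq> \<zero>\<^bsub>M i\<^esub>}" using n by auto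
  have "\<exists>m. m \<in> carrier (M i) \<and> r \<odot>\<^bsub>M i\<^esub> m = n i \<and> (n i = \<zero>\<^bsub>M i\<^esub> \<longrightarrow> m = \<zero>\<^bsub>M i\<^esub>)"
    if i: "i \<in> I" for i
  proof (cases "n i = \<zero>\<^bsub>M i\<^esub>")
    case True
    interpret left_module "M i" using M[OF i] .
    show ?thesis using True by (auto intro!: exI[of _ "\<zero>\<^bsub>M i\<^esub>"] simp: smult_zero_right)
  next
    case False
    then show ?thesis using div[OF i PiE_mem[OF nP i]] by blast
  qed
  then obtain m where m: "\<And>i. i \<in> I \<Longrightarrow> m i \<in> carrier (M i)"
    "\<And>i. i \<in> I \<Longrightarrow> r \<odot>\<^bsub>M i\<^esub> m i = n i" "\<And>i. \<lbrakk>i \<in> I; n i = \<zero>\<^bsub>M i\<^esub>\<rbrakk> \<Longrightarrow> m i = \<zero>\<^bsub>M i\<^esub>"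
    by metis
  have "finite {i\<in>I. restrict m I i \<noteq> \<zero>\<^bsub>M i\<^esub>}"
    by (rule finite_subset[OF _ fin]) (use m(3) in auto)
  then have "restrict m I \<in> carrier (direct_sum I M)" using m(1) by auto
  moreover have "r \<odot>\<^bsub>direct_sum I M\<^esub> restrict m I = n"
    using m(2) PiE_arb[OF nP] by (auto simp: fun_eq_iff)
  ultimately show ?thesis by blast
qed

section \<open>Quotients and direct limits\<close>

abbreviation ideal_coset :: "'r::ring_1 set \<Rightarrow> 'r \<Rightarrow> 'r set" where
  "ideal_coset L r \<equiv> L +>\<^bsub>regular_module\<^esub> r"

lemma mem_ideal_coset: "s \<in> ideal_coset L r \<longleftrightarrow> s - r \<in> L"
  by (auto simp: a_r_coset_def' intro: bexI[of _ "s - r"])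

context
  fixes L :: "'r::ring_1 set"
  assumes L: "left_submodule L regular_module"
begin

lemmas quotient_ideal = left_submoduleD[OF L, simplified]
lemmas quotient_ideal_minus = left_ideal_minus[OF L]

lemma ideal_coset_eq_iff: "ideal_coset L r = ideal_coset L s \<longleftrightarrow> r - s \<in> L"
proof
  assume "ideal_coset L r = ideal_coset L s"
  moreover have "r \<in> ideal_coset L r" using quotient_ideal(2) by (simp add: mem_ideal_coset)
  ultimately show "r - s \<in> L" by (simp add: mem_ideal_coset)
next
  assume rs: "r - s \<in> L"
  have "t - r \<in> L \<longleftrightarrow> t - s \<in> L" for t
    using quotient_ideal(3)[OF _ rs, of "t - r"] quotient_ideal_minus[OF _ rs, of "t - s"] by auto
  then show "ideal_coset L r = ideal_coset L s" by (auto simp: mem_ideal_coset)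
qed

lemma quotient_carrier: "carrier (quotient_module regular_module L) = range (ideal_coset L)"
  by (auto simp: quotient_module_def A_RCOSETS_def RCOSETS_def a_r_coset_def)

lemma quotient_zero: "\<zero>\<^bsub>quotient_module regular_module L\<^esub> = ideal_coset L 0"
  by (auto simp: quotient_module_def mem_ideal_coset)

lemma quotient_add:
  "ideal_coset L r \<oplus>\<^bsub>quotient_module regular_module L\<^esub> ideal_coset L s = ideal_coset L (r + s)"
proof -
  have "t \<in> ideal_coset L r <+>\<^bsub>regular_module\<^esub> ideal_coset L s \<longleftrightarrow> t \<in> ideal_coset L (r + s)" for t
  proof
    assume "t \<in> ideal_coset L r <+>\<^bsub>regular_module\<^esub> ideal_coset L s"
    then obtain a b where ab: "a - r \<in> L" "b - s \<in> L" "t = a + b"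
      unfolding set_add_def set_mult_def by (auto simp: mem_ideal_coset)
    have "t - (r + s) = (a - r) + (b - s)" using ab(3) by simp
    then show "t \<in> ideal_coset L (r + s)"
      using quotient_ideal(3)[OF ab(1,2)] by (simp only: mem_ideal_coset)
  next
    assume "t \<in> ideal_coset L (r + s)"
    then have "t - s \<in> ideal_coset L r" "s \<in> ideal_coset L s"
      using quotient_ideal(2) by (simp_all add: mem_ideal_coset algebra_simps)
    moreover have "t = (t - s) + s" by simp
    ultimately show "t \<in> ideal_coset L r <+>\<^bsub>regular_module\<^esub> ideal_coset L s"
      unfolding set_add_def set_mult_def by fastforce
  qed
  then show ?thesis by (auto simp: quotient_module_def)
qed

lemma UN_coset:
  assumes "\<And>s. s - r \<in> L \<Longrightarrow> F s = S"
  shows "(\<Union>s\<in>ideal_coset L r. F s) = S"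
proof -
  have "r \<in> ideal_coset L r" using quotient_ideal(2) by (simp add: mem_ideal_coset)
  moreover have "F s = S" if "s \<in> ideal_coset L r" for s
    using that assms by (simp add: mem_ideal_coset)
  ultimately show ?thesis by (intro UN_constant_eq ballI)
qed

lemma quotient_smult:
  "a \<odot>\<^bsub>quotient_module regular_module L\<^esub> ideal_coset L r = ideal_coset L (a * r)"
proof -
  have "ideal_coset L (a * s) = ideal_coset L (a * r)" if "s - r \<in> L" for s
    using quotient_ideal(4)[OF that, of a] by (simp add: ideal_coset_eq_iff right_diff_distrib)
  then show ?thesis by (simp add: quotient_module_def UN_coset)
qed

lemma left_module_quotient: "left_module (quotient_module regular_module L)"
  by (rule left_moduleI)
    (auto simp: quotient_carrier quotient_zero quotient_add quotient_smult algebra_simps)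

end

text \<open>
  By directedness finitely many elements of a direct limit are germs of elements of a single module
  of the system, in which the module axioms can be checked.
\<close>

locale directed_system =
  fixes I :: "'i::order set" and M :: "'i \<Rightarrow> ('r::ring_1, 'a, 'z) module_scheme"
    and \<psi> :: "'i \<Rightarrow> 'i \<Rightarrow> 'a \<Rightarrow> 'a"
  assumes nonempty: "I \<noteq> {}"
    and directed: "\<lbrakk>i \<in> I; j \<in> I\<rbrakk> \<Longrightarrow> \<exists>l\<in>I. i \<le> l \<and> j \<le> l"
    and module: "i \<in> I \<Longrightarrow> left_module (M i)"
    and hom: "\<lbrakk>i \<in> I; l \<in> I; i \<le> l\<rbrakk> \<Longrightarrow> \<psi> i l \<in> module_hom (M i) (M l)"
    and comp: "\<lbrakk>i \<in> I; j \<in> I; l \<in> I; i \<le> j; j \<le> l; x \<in> carrier (M i)\<rbrakk>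
      \<Longrightarrow> \<psi> j l (\<psi> i j x) = \<psi> i l x"
begin

abbreviation germ :: "'i \<Rightarrow> 'a \<Rightarrow> ('i \<times> 'a) set" where
  "germ i x \<equiv> limit_rel I M \<psi> `` {(i, x)}"

abbreviation "limit \<equiv> direct_limit I M \<psi>"

lemmas \<psi> = module_homD[OF hom]

lemma rel_iff:
  "((i, x), (j, y)) \<in> limit_rel I M \<psi> \<longleftrightarrow> i \<in> I \<and> x \<in> carrier (M i) \<and> j \<in> I \<and> y \<in> carrier (M j) \<and>
     (\<exists>l\<in>I. i \<le> l \<and> j \<le> l \<and> \<psi> i l x = \<psi> j l y)"
  by (simp add: limit_rel_def)

lemma equiv_rel: "equiv (SIGMA i:I. carrier (M i)) (limit_rel I M \<psi>)"
proof (rule equivI)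
  show "limit_rel I M \<psi> \<subseteq> (SIGMA i:I. carrier (M i)) \<times> (SIGMA i:I. carrier (M i))"
    by (auto simp: limit_rel_def)
  show "refl_on (SIGMA i:I. carrier (M i)) (limit_rel I M \<psi>)"
    by (auto simp: refl_on_def rel_iff)
  show "sym (limit_rel I M \<psi>)"
  proof (rule symI, clarify)
    fix i x j y assume "((i, x), (j, y)) \<in> limit_rel I M \<psi>"
    then have *: "i \<in> I" "x \<in> carrier (M i)" "j \<in> I" "y \<in> carrier (M j)"
      and "\<exists>l\<in>I. i \<le> l \<and> j \<le> l \<and> \<psi> i l x = \<psi> j l y" by (simp_all add: rel_iff)
    then obtain l where l: "l \<in> I" "i \<le> l" "j \<le> l" "\<psi> i l x = \<psi> j l y" by blast
    have "\<exists>l\<in>I. j \<le> l \<and> i \<le> l \<and> \<psi> j l y = \<psi> i l x"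
      by (intro bexI[of _ l] conjI l l(4)[symmetric])
    with * show "((j, y), (i, x)) \<in> limit_rel I M \<psi>" by (simp add: rel_iff)
  qed
  show "trans (limit_rel I M \<psi>)"
  proof (rule transI, clarsimp simp: rel_iff)
    fix i x j y k z l l'
    assume *: "i \<in> I" "x \<in> carrier (M i)" "j \<in> I" "y \<in> carrier (M j)" "k \<in> I" "z \<in> carrier (M k)"
      "l \<in> I" "i \<le> l" "j \<le> l" "\<psi> i l x = \<psi> j l y"
      "l' \<in> I" "j \<le> l'" "k \<le> l'" "\<psi> j l' y = \<psi> k l' z"
    then obtain m where m: "m \<in> I" "l \<le> m" "l' \<le> m" using directed by blast
    have "\<psi> i m x = \<psi> l m (\<psi> j l y)" using comp[of i l m x] * m by simp
    also have "\<dots> = \<psi> l' m (\<psi> k l' z)" using comp[of j l m y] comp[of j l' m y] * m by simp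
    also have "\<dots> = \<psi> k m z" using comp[of k l' m z] * m by simp
    finally have eq: "\<psi> i m x = \<psi> k m z" .
    have "i \<le> m" "k \<le> m" using * m by (meson order_trans)+
    with m(1) eq show "\<exists>m\<in>I. i \<le> m \<and> k \<le> m \<and> \<psi> i m x = \<psi> k m z" by blast
  qed
qed

lemma germ_eq_iff:
  assumes "i \<in> I" "x \<in> carrier (M i)" "j \<in> I" "y \<in> carrier (M j)"
  shows "germ i x = germ j y \<longleftrightarrow> (\<exists>l\<in>I. i \<le> l \<and> j \<le> l \<and> \<psi> i l x = \<psi> j l y)"
  using eq_equiv_class_iff[OF equiv_rel, of "(i, x)" "(j, y)"] assms by (simp add: rel_iff)

lemma germ_push:
  assumes "i \<in> I" "x \<in> carrier (M i)" "l \<in> I" "i \<le> l"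
  shows "germ i x = germ l (\<psi> i l x)"
  using assms comp[of i l l x] \<psi>(1)[of i l x] by (subst germ_eq_iff) auto

lemma limit_carrier: "carrier limit = {germ i x | i x. i \<in> I \<and> x \<in> carrier (M i)}"
  by (auto simp: direct_limit_def quotient_def)

lemma UN_germ:
  assumes "i \<in> I" "x \<in> carrier (M i)"
    and "\<And>j y l. \<lbrakk>j \<in> I; y \<in> carrier (M j); l \<in> I; i \<le> l; j \<le> l; \<psi> i l x = \<psi> j l y\<rbrakk> \<Longrightarrow> F j y = S"
  shows "(\<Union>(j, y)\<in>germ i x. F j y) = S"
proof -
  have eq: "F j y = S" if "(j, y) \<in> germ i x" for j y
    using that assms(3) by (auto simp: rel_iff)
  have "(i, x) \<in> germ i x" using assms(1,2) by (auto simp: rel_iff)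
  with eq have "F i x = S" "\<And>p. p \<in> germ i x \<Longrightarrow> (case p of (j, y) \<Rightarrow> F j y) = S" by auto
  with \<open>(i, x) \<in> germ i x\<close> show ?thesis by blast
qed

lemma limit_zero:
  assumes "i \<in> I"
  shows "\<zero>\<^bsub>limit\<^esub> = germ i \<zero>\<^bsub>M i\<^esub>"
proof -
  have "germ j \<zero>\<^bsub>M j\<^esub> = germ i \<zero>\<^bsub>M i\<^esub>" if "j \<in> I" for j
  proof -
    obtain l where l: "l \<in> I" "i \<le> l" "j \<le> l" using directed assms \<open>j \<in> I\<close> by blast
    have "\<psi> j l \<zero>\<^bsub>M j\<^esub> = \<zero>\<^bsub>M l\<^esub>" "\<psi> i l \<zero>\<^bsub>M i\<^esub> = \<zero>\<^bsub>M l\<^esub>"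
      using module_hom_zero module hom assms that l by blast+
    moreover have "\<zero>\<^bsub>M j\<^esub> \<in> carrier (M j)" "\<zero>\<^bsub>M i\<^esub> \<in> carrier (M i)"
      using module[OF that] module[OF assms]
      by (meson abelian_group.axioms(1) abelian_monoid.zero_closed left_module.axioms(1))+
    ultimately show ?thesis using assms that l by (subst germ_eq_iff) auto
  qed
  then have "(\<Union>j\<in>I. germ j \<zero>\<^bsub>M j\<^esub>) = germ i \<zero>\<^bsub>M i\<^esub>"
    by (intro UN_constant_eq[OF assms] ballI)
  then show ?thesis by (simp add: direct_limit_def)
qed

lemma limit_smult:
  assumes i: "i \<in> I" and x: "x \<in> carrier (M i)"
  shows "r \<odot>\<^bsub>limit\<^esub> germ i x = germ i (r \<odot>\<^bsub>M i\<^esub> x)"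
proof -
  have "germ j (r \<odot>\<^bsub>M j\<^esub> y) = germ i (r \<odot>\<^bsub>M i\<^esub> x)"
    if *: "j \<in> I" "y \<in> carrier (M j)" "l \<in> I" "i \<le> l" "j \<le> l" "\<psi> i l x = \<psi> j l y" for j y l
    using * \<psi>(3)[of i l x r] \<psi>(3)[of j l y r] i x
      left_module.smult_closed[OF module[OF i] x] left_module.smult_closed[OF module[OF *(1)] *(2)]
    by (subst germ_eq_iff) auto
  then show ?thesis by (simp add: direct_limit_def UN_germ[OF i x])
qed

lemma limit_add:
  assumes i: "i \<in> I" and x: "x \<in> carrier (M i)" and y: "y \<in> carrier (M i)"
  shows "germ i x \<oplus>\<^bsub>limit\<^esub> germ i y = germ i (x \<oplus>\<^bsub>M i\<^esub> y)"
proof -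
  have closed: "a \<oplus>\<^bsub>M j\<^esub> b \<in> carrier (M j)" if "j \<in> I" "a \<in> carrier (M j)" "b \<in> carrier (M j)" for j a b
    using module[OF that(1)] that
    by (meson abelian_group.axioms(1) abelian_monoid.a_closed left_module.axioms(1))
  have key: "germ l (\<psi> j l x' \<oplus>\<^bsub>M l\<^esub> \<psi> k l y') = germ i (x \<oplus>\<^bsub>M i\<^esub> y)"
    if x': "j \<in> I" "x' \<in> carrier (M j)" "l1 \<in> I" "i \<le> l1" "j \<le> l1" "\<psi> i l1 x = \<psi> j l1 x'"
      and y': "k \<in> I" "y' \<in> carrier (M k)" "l2 \<in> I" "i \<le> l2" "k \<le> l2" "\<psi> i l2 y = \<psi> k l2 y'"
      and l: "l \<in> I" "j \<le> l" "k \<le> l" for j x' l1 k y' l2 l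
  proof -
    obtain m' where "m' \<in> I" "l1 \<le> m'" "l2 \<le> m'" using directed x'(3) y'(3) by blast
    then obtain m where m: "m \<in> I" "l1 \<le> m" "l2 \<le> m" "l \<le> m"
      using directed[of m' l] l(1) order_trans by blast
    have im: "i \<le> m" using x'(4) m(2) by (rule order_trans)
    have cl: "\<psi> j l x' \<in> carrier (M l)" "\<psi> k l y' \<in> carrier (M l)"
      using \<psi>(1) x' y' l by blast+
    have "\<psi> l m (\<psi> j l x' \<oplus>\<^bsub>M l\<^esub> \<psi> k l y') = \<psi> j m x' \<oplus>\<^bsub>M m\<^esub> \<psi> k m y'"
      using \<psi>(2)[OF l(1) m(1,4) cl] comp[of j l m x'] comp[of k l m y'] x' y' l m by simp
    also have "\<dots> = \<psi> l1 m (\<psi> i l1 x) \<oplus>\<^bsub>M m\<^esub> \<psi> l2 m (\<psi> i l2 y)"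
      using comp[of j l1 m x'] comp[of k l2 m y'] x' y' m by simp
    also have "\<dots> = \<psi> i m (x \<oplus>\<^bsub>M i\<^esub> y)"
      using comp[of i l1 m x] comp[of i l2 m y] \<psi>(2)[OF i m(1) im x y] x' y' m i x y by simp
    finally show ?thesis
      using closed[OF l(1) cl] closed[OF i x y] l(1) i m(1,4) im by (subst germ_eq_iff) auto
  qed
  have "(\<Union>l\<in>{l\<in>I. j \<le> l \<and> k \<le> l}. germ l (\<psi> j l x' \<oplus>\<^bsub>M l\<^esub> \<psi> k l y')) = germ i (x \<oplus>\<^bsub>M i\<^esub> y)"
    if x': "j \<in> I" "x' \<in> carrier (M j)" "l1 \<in> I" "i \<le> l1" "j \<le> l1" "\<psi> i l1 x = \<psi> j l1 x'"
      and y': "k \<in> I" "y' \<in> carrier (M k)" "l2 \<in> I" "i \<le> l2" "k \<le> l2" "\<psi> i l2 y = \<psi> k l2 y'"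
    for j x' l1 k y' l2
    using key[OF x' y'] directed[OF x'(1) y'(1)] by blast
  then show ?thesis by (simp add: direct_limit_def UN_germ[OF i x] UN_germ[OF i y])
qed

lemma common_stage:
  assumes "X \<in> carrier limit" "Y \<in> carrier limit" "Z \<in> carrier limit"
  obtains i x y z where "i \<in> I" "x \<in> carrier (M i)" "y \<in> carrier (M i)" "z \<in> carrier (M i)"
    "X = germ i x" "Y = germ i y" "Z = germ i z"
proof -
  obtain i x j y k z where *: "i \<in> I" "x \<in> carrier (M i)" "X = germ i x"
    "j \<in> I" "y \<in> carrier (M j)" "Y = germ j y" "k \<in> I" "z \<in> carrier (M k)" "Z = germ k z"
    using assms unfolding limit_carrier by blast
  obtain m' where "m' \<in> I" "i \<le> m'" "j \<le> m'" using directed * by blast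
  then obtain m where m: "m \<in> I" "i \<le> m" "j \<le> m" "k \<le> m"
    using directed[of m' k] *(7) order_trans by blast
  show thesis
    by (rule that[OF m(1) \<psi>(1)[OF *(1) m(1,2) *(2)] \<psi>(1)[OF *(4) m(1,3) *(5)]
          \<psi>(1)[OF *(7) m(1,4) *(8)]])
      (simp_all add: *(3,6,9) germ_push[OF *(1,2) m(1,2)] germ_push[OF *(4,5) m(1,3)]
        germ_push[OF *(7,8) m(1,4)])
qed

lemma left_module_limit: "left_module limit"
proof -
  have mem: "germ i x \<in> carrier limit" if "i \<in> I" "x \<in> carrier (M i)" for i x
    using that by (auto simp: limit_carrier)
  show ?thesis
  proof (rule left_moduleI)
    obtain i where "i \<in> I" using nonempty by blast
    then interpret left_module "M i" by (rule module)
    show "\<zero>\<^bsub>limit\<^esub> \<in> carrier limit" using limit_zero[OF \<open>i \<in> I\<close>] mem[OF \<open>i \<in> I\<close>] by simp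
  next
    fix X Y Z assume "X \<in> carrier limit" "Y \<in> carrier limit" "Z \<in> carrier limit"
    then obtain i x y z where i: "i \<in> I" and c: "x \<in> carrier (M i)" "y \<in> carrier (M i)" "z \<in> carrier (M i)"
      and XYZ: "X = germ i x" "Y = germ i y" "Z = germ i z" by (rule common_stage)
    interpret left_module "M i" using i by (rule module)
    show "(X \<oplus>\<^bsub>limit\<^esub> Y) \<oplus>\<^bsub>limit\<^esub> Z = X \<oplus>\<^bsub>limit\<^esub> (Y \<oplus>\<^bsub>limit\<^esub> Z)"
      unfolding XYZ using c by (simp add: limit_add[OF i] a_assoc)
  next
    fix X Y r assume "X \<in> carrier limit" "Y \<in> carrier limit"
    then obtain i x y where i: "i \<in> I" and c: "x \<in> carrier (M i)" "y \<in> carrier (M i)"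
      and XY: "X = germ i x" "Y = germ i y" using common_stage[of X Y Y] by metis
    interpret left_module "M i" using i by (rule module)
    show "X \<oplus>\<^bsub>limit\<^esub> Y \<in> carrier limit"
      unfolding XY using c by (simp add: limit_add[OF i] mem[OF i])
    show "X \<oplus>\<^bsub>limit\<^esub> Y = Y \<oplus>\<^bsub>limit\<^esub> X"
      unfolding XY using c by (simp add: limit_add[OF i] a_comm)
    show "r \<odot>\<^bsub>limit\<^esub> (X \<oplus>\<^bsub>limit\<^esub> Y) = r \<odot>\<^bsub>limit\<^esub> X \<oplus>\<^bsub>limit\<^esub> r \<odot>\<^bsub>limit\<^esub> Y"
      unfolding XY using c by (simp add: limit_add[OF i] limit_smult[OF i] smult_r_distr smult_closed)
  next
    fix X r s assume "X \<in> carrier limit"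
    then obtain i x where i: "i \<in> I" and c: "x \<in> carrier (M i)" and X: "X = germ i x"
      by (auto simp: limit_carrier)
    interpret left_module "M i" using i by (rule module)
    show "\<zero>\<^bsub>limit\<^esub> \<oplus>\<^bsub>limit\<^esub> X = X"
      unfolding X limit_zero[OF i] using c by (simp add: limit_add[OF i])
    show "r \<odot>\<^bsub>limit\<^esub> X \<in> carrier limit"
      unfolding X using c by (simp add: limit_smult[OF i] mem[OF i] smult_closed)
    show "(r + s) \<odot>\<^bsub>limit\<^esub> X = r \<odot>\<^bsub>limit\<^esub> X \<oplus>\<^bsub>limit\<^esub> s \<odot>\<^bsub>limit\<^esub> X"
      unfolding X using c by (simp add: limit_add[OF i] limit_smult[OF i] smult_l_distr smult_closed)
    show "(r * s) \<odot>\<^bsub>limit\<^esub> X = r \<odot>\<^bsub>limit\<^esub> (s \<odot>\<^bsub>limit\<^esub> X)"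
      unfolding X using c by (simp add: limit_smult[OF i] smult_assoc smult_closed)
    show "1 \<odot>\<^bsub>limit\<^esub> X = X" unfolding X using c by (simp add: limit_smult[OF i] smult_one)
    show "0 \<odot>\<^bsub>limit\<^esub> X = \<zero>\<^bsub>limit\<^esub>"
      unfolding X limit_zero[OF i] using c by (simp add: limit_smult[OF i] smult_zero_left)
  qed
qed

end

section \<open>The left ideals generated by a polynomial in the loop\<close>

lemma jac_c_y: "leavitt_c * jac_y = (jac_y * jac_y :: 'k::field leavitt)"
  by (simp add: leavitt_c_eq mult.assoc jac_x_y)

lemma jac_w_c: "jac_w * leavitt_c = (0 :: 'k::field leavitt)"
  by (simp add: leavitt_c_eq mult.assoc jac_w_y_left)

lemma jac_w_x_c:
  "jac_w * jac_x ^ Suc j * leavitt_c = (if j = 0 then 0 else jac_w * (jac_x ^ j :: 'k::field leavitt))"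
proof -
  have "jac_w * jac_x ^ Suc j * leavitt_c = jac_w * jac_x ^ j * (jac_y * jac_x :: 'k leavitt)"
    by (simp only: leavitt_c_eq power_Suc2 mult.assoc jac_x_y_left)
  also have "\<dots> = (if j = 0 then 0 else jac_w * jac_x ^ j)"
  proof (cases j)
    case (Suc i)
    then show ?thesis by (simp add: power_Suc2 mult.assoc jac_x_y_left del: power_Suc)
  qed (simp add: jac_w_y_left)
  finally show ?thesis .
qed

text \<open>
  The ideals \<^const>\<open>left_ideal_of\<close> are those of the powers of one polynomial.  Two facts about
  \<open>R / R g(c)\<close> hold whenever \<open>g(0) \<noteq> 0\<close>: \<open>w\<close> annihilates it, and \<open>p(y)\<close> acts on it as right
  multiplication by \<open>p(c)\<close>.
\<close>

definition loop_ideal :: "'k::field poly \<Rightarrow> 'k leavitt set" where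
  "loop_ideal g = range (\<lambda>r. r * eval_c g)"

context
  fixes g :: "'k::field poly"
  assumes g0: "poly g 0 \<noteq> 0"
begin

lemma loop_ideal_submodule: "left_submodule (loop_ideal g) regular_module"
proof (rule left_module.left_submoduleI[OF left_module_regular])
  show "\<zero>\<^bsub>regular_module\<^esub> \<in> loop_ideal g"
    unfolding loop_ideal_def by (rule range_eqI[of _ _ 0]) simp
next
  fix a b assume "a \<in> loop_ideal g" "b \<in> loop_ideal g"
  then show "a \<oplus>\<^bsub>regular_module\<^esub> b \<in> loop_ideal g"
    unfolding loop_ideal_def by (auto simp flip: distrib_right)
next
  fix r a assume "a \<in> loop_ideal g"
  then show "r \<odot>\<^bsub>regular_module\<^esub> a \<in> loop_ideal g"
    unfolding loop_ideal_def by (auto simp flip: mult.assoc)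
qed simp

lemmas loop_ideal = left_submoduleD[OF loop_ideal_submodule, simplified]

lemma loop_ideal_right_c:
  assumes "a \<in> loop_ideal g"
  shows "a * poly_at leavitt_c p \<in> loop_ideal g"
proof -
  obtain r where "a = r * poly_at leavitt_c g" using assms by (auto simp: loop_ideal_def eval_c_eq)
  then have "a * poly_at leavitt_c p = (r * poly_at leavitt_c p) * eval_c g"
    by (simp add: eval_c_eq mult.assoc poly_at_commute[of leavitt_c g])
  then show ?thesis by (auto simp: loop_ideal_def)
qed

text \<open>
  \<open>a g(c)\<close> is congruent to \<open>g(0) a\<close> modulo the right multiples of \<open>a c\<close> by polynomials in \<open>c\<close>.
\<close>

lemma loop_ideal_c_cancel:
  assumes "a * leavitt_c \<in> loop_ideal g"
  shows "a \<in> loop_ideal g"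
proof -
  obtain k q where g: "g = pCons k q" by (cases g)
  have "a * eval_c g \<in> loop_ideal g" by (auto simp: loop_ideal_def)
  moreover have "a * eval_c g = leavitt_scalar k * a + a * leavitt_c * poly_at leavitt_c q"
    by (simp add: eval_c_eq g poly_at_pCons distrib_left mult.assoc scalar_central)
  ultimately have "leavitt_scalar k * a + a * leavitt_c * poly_at leavitt_c q
      - a * leavitt_c * poly_at leavitt_c q \<in> loop_ideal g"
    using left_ideal_minus[OF loop_ideal_submodule] loop_ideal_right_c[OF assms] by metis
  then have "leavitt_scalar k * a \<in> loop_ideal g" by simp
  then have "leavitt_scalar (inverse k) * (leavitt_scalar k * a) \<in> loop_ideal g"
    by (rule loop_ideal(4))
  moreover have "k \<noteq> 0" using g0 g by simp
  ultimately show ?thesis by (simp add: mult.assoc[symmetric] flip: scalar_mult)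
qed

text \<open>
  Right multiplication by \<open>c\<close> moves \<open>w x\<^bsup>j+1\<^esup>\<close> to \<open>w x\<^sup>j\<close> if \<open>j > 0\<close>, and sends \<open>w\<close> and \<open>w x\<close> to
  zero, so the powers are reached one after the other by cancelling \<open>c\<close>.
\<close>

lemma w_x_power_in_loop_ideal: "jac_w * jac_x ^ j \<in> loop_ideal g"
proof (induction j)
  case 0
  then show ?case using loop_ideal(2) by - (rule loop_ideal_c_cancel, simp add: jac_w_c)
next
  case (Suc j)
  then show ?case using loop_ideal(2) by - (rule loop_ideal_c_cancel, simp only: jac_w_x_c, simp)
qed

text \<open>
  The general power of \<open>x\<close> in the proof makes the induction on \<open>r\<close> go through: \<open>w x\<^sup>j y\<close> and \<open>w x\<^sup>j x\<close>
  are again of the form \<open>w x\<^sup>i\<close>, or zero.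
\<close>

lemma w_in_loop_ideal: "jac_w * r \<in> loop_ideal g"
proof -
  have "jac_w * jac_x ^ j * r \<in> loop_ideal g" for j
  proof (induction r arbitrary: j rule: leavitt_induct)
    case one
    then show ?case using w_x_power_in_loop_ideal by simp
  next
    case (scalar a r)
    then show ?case using loop_ideal(4) by (simp add: scalar_left_commute)
  next
    case (add r s)
    then show ?case using loop_ideal(3) by (simp add: distrib_left)
  next
    case (x r)
    then show ?case using x[of "Suc j"] by (simp add: power_Suc2 mult.assoc del: power_Suc)
  next
    case (y r)
    then show ?case using loop_ideal(2)
      by (cases j) (simp_all add: power_Suc2 mult.assoc jac_x_y_left jac_w_y_left del: power_Suc)
  qed
  from this[of 0] show ?thesis by simp
qed

lemma y_x_mod_loop_ideal: "jac_y * (jac_x * r) - r \<in> loop_ideal g"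
  using loop_ideal(4)[OF w_in_loop_ideal, of "- 1" r]
  by (simp add: mult.assoc[symmetric] jac_y_x left_diff_distrib)

text \<open>
  For \<open>r = 1\<close> the difference is \<open>d = d w\<close>.  Left multiplication by \<open>y\<close> commutes with that by \<open>x\<close> modulo the
  ideal, because \<open>w R\<close> is contained in it, so the congruence is inherited by \<open>x r\<close> and by \<open>y r\<close>.
\<close>

lemma y_mod_loop_ideal: "jac_y * r - r * leavitt_c \<in> loop_ideal g"
proof (induction r rule: leavitt_induct)
  case one
  have "leavitt_letter Gd = leavitt_letter Gd * (jac_w * 1 :: 'k leavitt)"
    using leavitt_relators(9) by simp
  then have "leavitt_letter Gd \<in> loop_ideal g" using loop_ideal(4)[OF w_in_loop_ideal] by metis
  then show ?case by (simp add: leavitt_c_eq letter_d)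
next
  case (scalar a r)
  then show ?case using loop_ideal(4)[OF scalar, of "leavitt_scalar a"]
    by (simp add: right_diff_distrib mult.assoc scalar_left_commute)
next
  case (add r s)
  then show ?case using loop_ideal(3)[OF add] by (simp add: algebra_simps)
next
  case (x r)
  have "jac_x * (jac_y * r - r * leavitt_c) \<in> loop_ideal g" using x by (rule loop_ideal(4))
  then have "r - jac_x * r * leavitt_c \<in> loop_ideal g"
    by (simp add: right_diff_distrib jac_x_y_left mult.assoc)
  then show ?case using loop_ideal(3)[OF y_x_mod_loop_ideal[of r]] by force
next
  case (y r)
  then show ?case using loop_ideal(4)[OF y, of jac_y] by (simp add: right_diff_distrib mult.assoc)
qed

lemma poly_y_mod_loop_ideal: "poly_at jac_y p * r - r * eval_c p \<in> loop_ideal g"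
proof (induction p)
  case 0
  then show ?case using loop_ideal(2) by (simp add: eval_c_eq)
next
  case (pCons a p)
  have "poly_at jac_y (pCons a p) * r - r * eval_c (pCons a p) =
      jac_y * (poly_at jac_y p * r - r * eval_c p) +
      (jac_y * (r * eval_c p) - (r * eval_c p) * leavitt_c)"
    by (simp add: eval_c_eq poly_at_pCons algebra_simps scalar_central poly_at_var_commute)
  then show ?case using loop_ideal(3)[OF loop_ideal(4)[OF pCons.IH] y_mod_loop_ideal] by simp
qed

end

section \<open>The modules \<open>U\<^sup>f\<close>\<close>

lemma eval_c_mult: "eval_c (p * q) = eval_c p * eval_c q"
  by (simp add: eval_c_eq poly_at_mult)

lemma left_ideal_of_eq: "left_ideal_of f n = loop_ideal (f ^ n)"
  by (simp add: left_ideal_of_def loop_ideal_def)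

definition prufer_class ::
    "'k::field poly \<Rightarrow> nat \<Rightarrow> 'k leavitt \<Rightarrow> (nat \<times> 'k leavitt set) set" where
  "prufer_class f i r =
     limit_rel {1..} (M_module f) (M_map f) `` {(i, ideal_coset (left_ideal_of f i) r)}"

context
  fixes f :: "'k::field poly"
  assumes f: "f \<in> F_polys"
begin

lemma F_polys_irreducible: "irreducible f" and F_polys_power_at_zero: "poly (f ^ n) 0 \<noteq> 0"
  using f by (auto simp: F_polys_def)

lemmas left_ideal_of_submodule = loop_ideal_submodule[OF F_polys_power_at_zero, folded left_ideal_of_eq]
lemmas left_ideal_of_D = left_submoduleD[OF left_ideal_of_submodule, simplified]

lemma M_map_coset:
  assumes "i \<le> l"
  shows "M_map f i l (ideal_coset (left_ideal_of f i) r) =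
    ideal_coset (left_ideal_of f l) (r * eval_c (f ^ (l - i)))"
proof -
  have "ideal_coset (left_ideal_of f l) (s * eval_c (f ^ (l - i))) =
      ideal_coset (left_ideal_of f l) (r * eval_c (f ^ (l - i)))"
    if sr: "s - r \<in> left_ideal_of f i" for s
  proof -
    obtain t where "s - r = t * eval_c (f ^ i)" using sr by (auto simp: left_ideal_of_def)
    then have "(s - r) * eval_c (f ^ (l - i)) = t * eval_c (f ^ l)"
      using assms by (simp add: mult.assoc flip: eval_c_mult power_add)
    then have "s * eval_c (f ^ (l - i)) - r * eval_c (f ^ (l - i)) \<in> left_ideal_of f l"
      by (auto simp: left_ideal_of_def left_diff_distrib)
    then show ?thesis by (simp add: ideal_coset_eq_iff[OF left_ideal_of_submodule])
  qed
  then show ?thesis by (simp add: M_map_def UN_coset[OF left_ideal_of_submodule])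
qed

lemma M_module_carrier: "carrier (M_module f n) = range (ideal_coset (left_ideal_of f n))"
  by (simp add: M_module_def quotient_carrier[OF left_ideal_of_submodule])

lemma M_module_zero: "\<zero>\<^bsub>M_module f n\<^esub> = ideal_coset (left_ideal_of f n) 0"
  by (simp add: M_module_def quotient_zero[OF left_ideal_of_submodule])

lemma M_module_smult:
  "a \<odot>\<^bsub>M_module f n\<^esub> ideal_coset (left_ideal_of f n) r = ideal_coset (left_ideal_of f n) (a * r)"
  by (simp add: M_module_def quotient_smult[OF left_ideal_of_submodule])

lemma M_module_add:
  "ideal_coset (left_ideal_of f n) r \<oplus>\<^bsub>M_module f n\<^esub> ideal_coset (left_ideal_of f n) s =
    ideal_coset (left_ideal_of f n) (r + s)"
  by (simp add: M_module_def quotient_add[OF left_ideal_of_submodule])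

lemma directed_system_M: "directed_system {1..} (M_module f) (M_map f)"
proof (rule directed_system.intro)
  show "left_module (M_module f i)" for i :: nat
    unfolding M_module_def by (rule left_module_quotient[OF left_ideal_of_submodule])
  show "\<exists>l\<in>{1..}. i \<le> l \<and> j \<le> l" if "i \<in> {1..}" "j \<in> {1..}" for i j :: nat
    by (rule bexI[of _ "max i j"]) (use that in auto)
  show "M_map f i l \<in> module_hom (M_module f i) (M_module f l)"
    if "i \<in> {1..}" "l \<in> {1..}" "i \<le> l" for i l
    by (rule module_homI)
      (auto simp: M_module_carrier M_module_smult M_module_add M_map_coset[OF that(3)] mult.assoc
        distrib_right)
  show "M_map f j l (M_map f i j X) = M_map f i l X"
    if "i \<le> j" "j \<le> l" "X \<in> carrier (M_module f i)" for i j l X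
    using that
    by (auto simp: M_module_carrier M_map_coset mult.assoc simp flip: eval_c_mult power_add)
qed simp

interpretation U: directed_system "{1..}" "M_module f" "M_map f"
  by (rule directed_system_M)

lemma coset_carrier: "ideal_coset (left_ideal_of f i) r \<in> carrier (M_module f i)"
  by (simp add: M_module_carrier)

lemma U_carrier: "carrier (U_module f) = {prufer_class f i r | i r. i \<ge> 1}"
  unfolding U_module_def U.limit_carrier prufer_class_def by (auto simp: M_module_carrier)

lemma U_zero: "i \<ge> 1 \<Longrightarrow> \<zero>\<^bsub>U_module f\<^esub> = prufer_class f i 0"
  using U.limit_zero[of i] by (simp add: U_module_def M_module_zero prufer_class_def)

lemma U_smult: "i \<ge> 1 \<Longrightarrow> a \<odot>\<^bsub>U_module f\<^esub> prufer_class f i r = prufer_class f i (a * r)"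
  using U.limit_smult[of i "ideal_coset (left_ideal_of f i) r" a]
  by (simp add: U_module_def coset_carrier M_module_smult prufer_class_def)

lemma prufer_class_push:
  "\<lbrakk>i \<ge> 1; i \<le> l\<rbrakk> \<Longrightarrow> prufer_class f i r = prufer_class f l (r * eval_c (f ^ (l - i)))"
  using U.germ_push[of i "ideal_coset (left_ideal_of f i) r" l]
  by (simp add: prufer_class_def coset_carrier M_map_coset)

lemma prufer_class_cong: "r - s \<in> left_ideal_of f i \<Longrightarrow> prufer_class f i r = prufer_class f i s"
  using ideal_coset_eq_iff[OF left_ideal_of_submodule, of i r s] by (simp add: prufer_class_def)

lemma left_module_U: "left_module (U_module f)"
  unfolding U_module_def by (rule U.left_module_limit)

lemma laurent_U: "laurent_module (U_module f)"
proof (intro laurent_module.intro laurent_module_axioms.intro left_module_U)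
  fix n assume "n \<in> carrier (U_module f)"
  then obtain i r where "i \<ge> 1" "n = prufer_class f i r" by (auto simp: U_carrier)
  then show "jac_y \<odot>\<^bsub>U_module f\<^esub> (jac_x \<odot>\<^bsub>U_module f\<^esub> n) = n"
    using prufer_class_cong[OF y_x_mod_loop_ideal[OF F_polys_power_at_zero, folded left_ideal_of_eq]]
    by (simp add: U_smult)
qed

text \<open>
  \<open>f(y)\<close> is surjective because it carries the class of \<open>r\<close> at stage \<open>i + 1\<close> to the class of \<open>r f(c)\<close>
  there, which is the image of the class of \<open>r\<close> at stage \<open>i\<close>; and \<open>f\<^sup>i(y)\<close> annihilates stage \<open>i\<close>.
\<close>

lemma U_divisible:
  assumes "p \<noteq> 0" "n \<in> carrier (U_module f)"
  shows "\<exists>m\<in>carrier (U_module f). poly_at jac_y p \<odot>\<^bsub>U_module f\<^esub> m = n"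
proof (rule laurent_module.primary_divisible[OF laurent_U F_polys_irreducible _ _ assms])
  note mod_L = poly_y_mod_loop_ideal[OF F_polys_power_at_zero, folded left_ideal_of_eq]
  fix n assume "n \<in> carrier (U_module f)"
  then obtain i r where i: "i \<ge> 1" and n: "n = prufer_class f i r" by (auto simp: U_carrier)
  have "poly_at jac_y f \<odot>\<^bsub>U_module f\<^esub> prufer_class f (Suc i) r = prufer_class f (Suc i) (r * eval_c f)"
    using mod_L by (simp add: U_smult prufer_class_cong)
  also have "\<dots> = n" using prufer_class_push[OF i, of "Suc i" r] by (simp add: n)
  finally show "\<exists>m\<in>carrier (U_module f). poly_at jac_y f \<odot>\<^bsub>U_module f\<^esub> m = n"
    by (intro bexI[of _ "prufer_class f (Suc i) r"]) (auto simp: U_carrier)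
  have "poly_at jac_y (f ^ i) * r - 0 =
      (poly_at jac_y (f ^ i) * r - r * eval_c (f ^ i)) + r * eval_c (f ^ i)" by simp
  also have "\<dots> \<in> left_ideal_of f i"
    by (rule left_ideal_of_D(3)[OF mod_L]) (simp add: left_ideal_of_def)
  finally have "poly_at jac_y (f ^ i) \<odot>\<^bsub>U_module f\<^esub> n = \<zero>\<^bsub>U_module f\<^esub>"
    using prufer_class_cong i by (simp add: n U_smult U_zero[OF i])
  then show "\<exists>i. poly_at jac_y (f ^ i) \<odot>\<^bsub>U_module f\<^esub> n = \<zero>\<^bsub>U_module f\<^esub>" by blast
qed

text \<open>
  \<open>c = y (1 - w)\<close> and \<open>w y = 0\<close>, so \<open>c\<close> and \<open>y\<close> agree on multiples of \<open>y\<close>.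
\<close>

lemma poly_c_y: "eval_c p * jac_y = jac_y * poly_at jac_y p"
proof (induction p)
  case (pCons a p)
  have "leavitt_c * eval_c p * jac_y = eval_c p * leavitt_c * jac_y"
    by (simp add: eval_c_eq poly_at_var_commute)
  also have "\<dots> = eval_c p * jac_y * jac_y" by (simp add: mult.assoc jac_c_y)
  also have "\<dots> = jac_y * (jac_y * poly_at jac_y p)"
    by (simp add: pCons.IH mult.assoc poly_at_var_commute)
  finally show ?case
    by (simp add: eval_c_eq poly_at_pCons distrib_left distrib_right scalar_central)
qed (simp add: eval_c_eq)

lemma F_polys_not_dvd_monom: "\<not> f dvd monom 1 n"
proof
  assume "f dvd monom 1 n"
  then show False
  proof (induction n)
    case 0
    then show ?case using F_polys_irreducible by (simp add: irreducible_def monom_0 one_pCons)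
  next
    case (Suc n)
    from Suc.prems obtain q where q: "monom 1 (Suc n) = f * q" by (rule dvdE)
    then have "poly f 0 * poly q 0 = 0" by (metis poly_mult poly_monom power_0_Suc mult_zero_right)
    then have "poly q 0 = 0" using F_polys_power_at_zero[of 1] by simp
    then obtain q' where "q = pCons 0 q'" by (cases q) simp
    then have "monom 1 n = f * q'" using q by (simp add: monom_Suc)
    then show ?case using Suc.IH by simp
  qed
qed

lemma jac_w_nonzero: "jac_w \<noteq> (0 :: 'k leavitt)"
proof
  assume "jac_w = (0 :: 'k leavitt)"
  then have "series_smult jac_w (\<lambda>_. 1 :: 'k) 0 = 0" by (simp add: series_smult_zero)
  then show False by (simp add: series_smult_letter)
qed

lemma poly_at_y_inject: "poly_at jac_y p = poly_at jac_y (q :: 'k poly) \<longleftrightarrow> p = q"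
proof
  assume "poly_at jac_y p = poly_at jac_y q"
  then have "poly_at jac_y (p - q) = 0"
    using poly_at_add[of jac_y "p - q" q] by simp
  then have "p - q = 0"
    using poly_at_y_zero[OF left_module_regular, of jac_w "p - q"] jac_w_nonzero
    by (simp add: jac_w_w)
  then show "p = q" by simp
qed simp

text \<open>
  If the class vanished at stage \<open>l\<close>, then \<open>f\<^bsup>l-1\<^esup>(c) = r f\<^sup>l(c)\<close> for some \<open>r\<close>.  Multiplied by a high
  power of \<open>y\<close> from the right, this becomes an equation between polynomials in \<open>y\<close>, which says that
  \<open>f\<close> divides a power of the variable.
\<close>

lemma prufer_generator_nonzero: "prufer_class f 1 1 \<noteq> \<zero>\<^bsub>U_module f\<^esub>"
proof
  assume "prufer_class f 1 1 = \<zero>\<^bsub>U_module f\<^esub>"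
  then have "prufer_class f 1 1 = prufer_class f 1 0" by (simp add: U_zero[of 1])
  then obtain l where l: "l \<ge> 1" and eq: "M_map f 1 l (ideal_coset (left_ideal_of f 1) 1) =
      M_map f 1 l (ideal_coset (left_ideal_of f 1) 0)"
    unfolding prufer_class_def by (subst (asm) U.germ_eq_iff) (auto simp: coset_carrier)
  then have "eval_c (f ^ (l - 1)) \<in> left_ideal_of f l"
    by (simp only: M_map_coset[OF l] ideal_coset_eq_iff[OF left_ideal_of_submodule]) simp
  then obtain r where r: "eval_c (f ^ (l - 1)) = r * eval_c (f ^ l)"
    by (auto simp: left_ideal_of_def)
  obtain n p where p: "r * jac_y ^ n = poly_at jac_y p" using normal_form_right by blast
  have shift: "eval_c q * jac_y ^ Suc n = jac_y ^ Suc n * poly_at jac_y q" for q :: "'k poly"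
  proof -
    have "eval_c q * jac_y ^ Suc n = jac_y * (poly_at jac_y q * jac_y ^ n)"
      by (simp add: mult.assoc[symmetric] poly_c_y)
    also have "poly_at jac_y q * jac_y ^ n = jac_y ^ n * poly_at jac_y q"
      using poly_at_commute[of jac_y q "monom 1 n"] by (simp add: poly_at_monom)
    finally show ?thesis by (simp add: mult.assoc)
  qed
  have y_Suc: "jac_y ^ Suc n = poly_at jac_y (monom 1 (Suc n) :: 'k poly)"
    by (simp only: poly_at_monom scalar_one mult_1_left)
  have "poly_at jac_y (monom 1 (Suc n) * f ^ (l - 1)) = eval_c (f ^ (l - 1)) * jac_y ^ Suc n"
    by (simp only: poly_at_mult shift y_Suc[symmetric])
  also have "\<dots> = r * jac_y ^ Suc n * poly_at jac_y (f ^ l)"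
    by (simp only: r mult.assoc shift)
  also have "\<dots> = poly_at jac_y (p * [:0, 1:] * f ^ l)"
    by (simp only: power_Suc2 mult.assoc[symmetric] p poly_at_mult poly_at_X)
  finally have "monom 1 (Suc n) * f ^ (l - 1) = (p * [:0, 1:] * f) * f ^ (l - 1)"
    using l by (simp add: poly_at_y_inject mult.assoc power_eq_if)
  moreover have "f ^ (l - 1) \<noteq> 0" using F_polys_irreducible by auto
  ultimately have "monom 1 (Suc n) = p * [:0, 1:] * f" by (metis mult_right_cancel)
  then have "f dvd monom 1 (Suc n)" by (metis dvd_triv_right)
  then show False using F_polys_not_dvd_monom by blast
qed

lemma prufer_generator_killed:
  "poly_at jac_y f \<odot>\<^bsub>U_module f\<^esub> prufer_class f 1 1 = \<zero>\<^bsub>U_module f\<^esub>"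
proof -
  have "poly_at jac_y f * 1 - 0 = (poly_at jac_y f * 1 - 1 * eval_c f) + 1 * eval_c (f ^ 1)" by simp
  also have "\<dots> \<in> left_ideal_of f 1"
    by (rule left_ideal_of_D(3)[OF poly_y_mod_loop_ideal[OF F_polys_power_at_zero, folded left_ideal_of_eq]])
      (unfold left_ideal_of_def, rule rangeI)
  finally show ?thesis using prufer_class_cong by (simp add: U_smult U_zero[of 1])
qed

end

section \<open>The module \<open>C\<close> is an injective cogenerator\<close>

lemma laurent_sum_U: "laurent_module (direct_sum F_polys U_module)"
  by (rule laurent_direct_sum) (rule laurent_U)

lemma baer_C: "baer_module C_module"
  unfolding C_module_def
proof (rule baer_binary_direct_sum[OF baer_Y])
  show "baer_module (direct_sum F_polys U_module)"
    by (rule laurent_module.baer_if_divisible[OF laurent_sum_U])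
      (rule direct_sum_divisible[OF left_module_U U_divisible])
qed

lemma left_module_C: "left_module C_module"
  using baer_C unfolding baer_module_def by (rule conjunct1)

lemma poly_dvd_kills:
  assumes "left_module M" "n \<in> carrier M" "poly_at t p \<odot>\<^bsub>M\<^esub> n = \<zero>\<^bsub>M\<^esub>" "p dvd q"
  shows "poly_at t q \<odot>\<^bsub>M\<^esub> n = \<zero>\<^bsub>M\<^esub>"
proof -
  interpret left_module M by fact
  obtain s where "q = p * s" using assms(4) by (rule dvdE)
  then have "q = s * p" by simp
  then show ?thesis using assms(2,3) by (simp add: poly_at_mult smult_assoc smult_zero_right)
qed

text \<open>
  \<open>r = p(y) y\<^bsup>-k\<^esup>\<close> as far as its action on \<open>M\<close> is concerned, and powers of \<open>y\<close> commute with \<open>p(y)\<close>.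
\<close>

lemma (in laurent_module) kills_iff_poly_kills:
  assumes r: "r * jac_y ^ k = poly_at jac_y p" and n: "n \<in> carrier M"
  shows "r \<odot> n = \<zero> \<longleftrightarrow> poly_at jac_y p \<odot> n = \<zero>"
proof -
  have c: "(jac_x ^ k) \<odot> n \<in> carrier M" using n by (rule smult_closed)
  have eq: "r \<odot> n = poly_at jac_y p \<odot> ((jac_x ^ k) \<odot> n)"
    using y_x_power[OF n, of k] c by (simp add: smult_assoc flip: r)
  have comm: "(jac_y ^ k) \<odot> (poly_at jac_y p \<odot> ((jac_x ^ k) \<odot> n)) = poly_at jac_y p \<odot> n"
  proof -
    have "jac_y ^ k * poly_at jac_y p = poly_at jac_y p * jac_y ^ k"
      using poly_at_commute[of jac_y p "monom 1 k"] by (simp add: poly_at_monom)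
    then have "(jac_y ^ k) \<odot> (poly_at jac_y p \<odot> ((jac_x ^ k) \<odot> n)) =
        poly_at jac_y p \<odot> ((jac_y ^ k) \<odot> ((jac_x ^ k) \<odot> n))"
      using c by (simp flip: smult_assoc)
    then show ?thesis using y_x_power[OF n] by simp
  qed
  show ?thesis
  proof
    assume "r \<odot> n = \<zero>"
    then show "poly_at jac_y p \<odot> n = \<zero>" using comm eq by (simp add: smult_zero_right)
  next
    assume "poly_at jac_y p \<odot> n = \<zero>"
    then have "(jac_y ^ k) \<odot> (r \<odot> n) = \<zero>" using comm eq by simp
    then have "(jac_x ^ k) \<odot> ((jac_y ^ k) \<odot> (r \<odot> n)) = \<zero>" by (simp add: smult_zero_right)
    then show "r \<odot> n = \<zero>" using x_y_power[OF smult_closed[OF n]] by simp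
  qed
qed

lemma (in left_module) cyclic_submodule:
  assumes "m \<in> carrier M"
  shows "left_submodule (range (\<lambda>r. r \<odot> m)) M"
proof (rule left_submoduleI)
  show "\<zero> \<in> range (\<lambda>r. r \<odot> m)"
    using smult_zero_left[OF assms] by (metis rangeI)
qed (use assms in \<open>auto simp: smult_closed simp flip: smult_l_distr smult_assoc\<close>)

text \<open>
  The polynomials \<open>p\<close> with \<open>p(y) m = 0\<close> are the multiples of some \<open>g\<close>.  Unless \<open>g = 0\<close>, it is not a unit and
  not divisible by the variable, since \<open>y\<close> is invertible on \<open>M\<close>; so in any case it has an irreducible
  factor with nonzero constant coefficient, which becomes a member \<open>f\<close> of \<^const>\<open>F_polys\<close> after scaling.  The
  generator of the first stage of \<open>U\<^sup>f\<close> is annihilated by \<open>f(y)\<close>, hence by \<open>g(y)\<close>.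
\<close>

lemma U_element_with_annihilator:
  fixes M :: "('k::field leavitt, 'a, 'z) module_scheme"
  assumes M: "laurent_module M" and m: "m \<in> carrier M" "m \<noteq> \<zero>\<^bsub>M\<^esub>"
  obtains f u where "f \<in> F_polys" "u \<in> carrier (U_module f)" "u \<noteq> \<zero>\<^bsub>U_module f\<^esub>"
    "\<And>r. r \<odot>\<^bsub>M\<^esub> m = \<zero>\<^bsub>M\<^esub> \<Longrightarrow> r \<odot>\<^bsub>U_module f\<^esub> u = \<zero>\<^bsub>U_module f\<^esub>"
proof -
  interpret M: laurent_module M by fact
  obtain g where g: "poly_at jac_y g \<odot>\<^bsub>M\<^esub> m = \<zero>\<^bsub>M\<^esub>"
    "\<And>p. poly_at jac_y p \<odot>\<^bsub>M\<^esub> m = \<zero>\<^bsub>M\<^esub> \<Longrightarrow> g dvd p"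
    by (rule poly_ideal_principal[of "{p. poly_at jac_y p \<odot>\<^bsub>M\<^esub> m = \<zero>\<^bsub>M\<^esub>}"])
      (use m in \<open>auto simp: poly_at_add poly_at_mult M.smult_zero_left M.smult_l_distr
        M.smult_assoc M.smult_zero_right\<close>)
  have "\<exists>f. irreducible f \<and> poly f 0 \<noteq> 0 \<and> f dvd g"
  proof (cases "g = 0")
    case True
    \<comment> \<open>Any irreducible polynomial with nonzero constant coefficient will do.\<close>
    obtain f where f: "irreducible f" "f dvd [:1, 1 :: 'k:]"
      by (rule exists_irreducible_factor[of "[:1, 1:]"]) (auto simp: is_unit_iff_degree)
    from f(2) obtain q where "[:1, 1:] = f * q" by (rule dvdE)
    then have "poly f 0 * poly q 0 = 1" by (metis poly_mult poly_pCons mult_zero_left add_0_right)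
    then show ?thesis using True f(1) by auto
  next
    case False
    have "\<not> is_unit g"
    proof
      assume "is_unit g"
      then have "poly_at jac_y 1 \<odot>\<^bsub>M\<^esub> m = \<zero>\<^bsub>M\<^esub>"
        using poly_dvd_kills[OF M.left_module_axioms m(1) g(1)] by blast
      then show False using m by (simp add: M.smult_one)
    qed
    then obtain f where f: "irreducible f" "f dvd g"
      by (rule exists_irreducible_factor[OF _ False])
    have "poly f 0 \<noteq> 0"
    proof
      assume "poly f 0 = 0"
      then have "poly g 0 = 0" using f(2) by (auto elim!: dvdE)
      then obtain q where q: "g = pCons 0 q" by (cases g) simp
      have "jac_y \<odot>\<^bsub>M\<^esub> (poly_at jac_y q \<odot>\<^bsub>M\<^esub> m) = \<zero>\<^bsub>M\<^esub>"
        using g(1) m(1) by (simp add: q poly_at_pCons M.smult_assoc)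
      then have "poly_at jac_y q \<odot>\<^bsub>M\<^esub> m = \<zero>\<^bsub>M\<^esub>"
        using M.x_y[of "poly_at jac_y q \<odot>\<^bsub>M\<^esub> m"] m(1)
        by (simp add: M.smult_zero_right M.smult_closed)
      then have "g dvd q" by (rule g(2))
      then have "degree g \<le> degree q" using False q by (intro dvd_imp_degree_le) auto
      then show False using False q by auto
    qed
    then show ?thesis using f by blast
  qed
  then obtain f0 where f0: "irreducible f0" "poly f0 0 \<noteq> 0" "f0 dvd g" by blast
  define f where "f = smult (- inverse (poly f0 0)) f0"
  have c: "[:- inverse (poly f0 0):] dvd 1" using f0(2) by (subst is_unit_iff_degree) simp_all
  have f_eq: "f = [:- inverse (poly f0 0):] * f0" by (simp add: f_def)
  have "irreducible f" unfolding f_eq using f0(1) irreducible_mult_unit_left[OF c] by blast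
  then have f: "f \<in> F_polys" "f dvd g"
    using f0(2,3) by (auto simp: f_def F_polys_def smult_dvd_iff)
  interpret U: laurent_module "U_module f" by (rule laurent_U[OF f(1)])
  let ?u = "prufer_class f 1 1"
  have u: "?u \<in> carrier (U_module f)" using U_carrier[OF f(1)] by auto
  have "r \<odot>\<^bsub>U_module f\<^esub> ?u = \<zero>\<^bsub>U_module f\<^esub>" if "r \<odot>\<^bsub>M\<^esub> m = \<zero>\<^bsub>M\<^esub>" for r
  proof -
    obtain k p where p: "r * jac_y ^ k = poly_at jac_y p" using normal_form_right by blast
    then have "g dvd p" using that M.kills_iff_poly_kills[OF p m(1)] g(2) by blast
    then have "f dvd p" using f(2) by (rule dvd_trans[rotated])
    then show ?thesis
      using U.kills_iff_poly_kills[OF p u]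
        poly_dvd_kills[OF U.left_module_axioms u prufer_generator_killed[OF f(1)]] by blast
  qed
  then show thesis using that[OF f(1) u prufer_generator_nonzero[OF f(1)]] by blast
qed

text \<open>
  By injectivity of \<open>C\<close> it suffices to find, for \<open>m\<close> or a multiple of it, a nonzero element of \<open>C\<close> with
  at least the same annihilator.
\<close>

lemma C_cogenerator:
  fixes M :: "('k::field leavitt, 'a, 'z) module_scheme"
  assumes M: "left_module M" and m: "m \<in> carrier M" "m \<noteq> \<zero>\<^bsub>M\<^esub>"
  shows "\<exists>h\<in>module_hom M C_module. h m \<noteq> \<zero>\<^bsub>C_module\<^esub>"
proof -
  interpret M: left_module M by fact
  let ?S = "direct_sum F_polys U_module :: ('k leavitt, _) module"
  interpret S: laurent_module ?S by (rule laurent_sum_U)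
  show ?thesis
  proof (cases "\<exists>r. jac_w \<odot>\<^bsub>M\<^esub> (r \<odot>\<^bsub>M\<^esub> m) \<noteq> \<zero>\<^bsub>M\<^esub>")
    case True
    then obtain r where r: "jac_w \<odot>\<^bsub>M\<^esub> (r \<odot>\<^bsub>M\<^esub> m) \<noteq> \<zero>\<^bsub>M\<^esub>" by blast
    define n where "n = (jac_w * r) \<odot>\<^bsub>M\<^esub> m"
    have n: "n \<in> carrier M" "jac_w \<odot>\<^bsub>M\<^esub> n = n" "n \<noteq> \<zero>\<^bsub>M\<^esub>"
      using r m(1) M.smult_assoc[of "r \<odot>\<^bsub>M\<^esub> m" jac_w jac_w]
      by (simp_all add: n_def M.smult_assoc M.smult_closed jac_w_w)
    \<comment> \<open>The series \<open>w\<close>.\<close>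
    let ?y = "\<lambda>i. if i = 0 then 1 else 0 :: 'k"
    let ?c = "(?y, \<zero>\<^bsub>?S\<^esub>)"
    have c: "?c \<in> carrier C_module" using S.zero_closed by (simp add: C_module_def)
    have wy: "series_smult jac_w ?y = ?y" by (auto simp: series_smult_letter)
    have "a \<odot>\<^bsub>C_module\<^esub> ?c = \<zero>\<^bsub>C_module\<^esub>" if "a \<odot>\<^bsub>M\<^esub> n = \<zero>\<^bsub>M\<^esub>" for a
    proof -
      obtain p where p: "a * jac_w = poly_at jac_y p * jac_w" using normal_form_w by blast
      have "poly_at jac_y p \<odot>\<^bsub>M\<^esub> n = (poly_at jac_y p * jac_w) \<odot>\<^bsub>M\<^esub> n"
        using n by (simp add: M.smult_assoc)
      also have "\<dots> = \<zero>\<^bsub>M\<^esub>" using n that by (simp add: M.smult_assoc flip: p)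
      finally have "p = 0" by (rule poly_at_y_zero[OF M n])
      then have "a * jac_w = 0" using p by simp
      then have "series_smult a ?y = (\<lambda>_. 0)"
        using series_smult_mult[of a jac_w ?y] wy by (simp add: series_smult_zero)
      then show ?thesis
        using S.smult_zero_right[of a] by (simp add: C_module_def)
    qed
    then obtain h where h: "h \<in> module_hom M C_module" "h n = ?c"
      using baer_extends_cyclic[OF baer_C M n(1) c] by blast
    have "?y \<noteq> (\<lambda>_. 0)" by (auto simp: fun_eq_iff)
    then have "h n \<noteq> \<zero>\<^bsub>C_module\<^esub>" unfolding h(2) by (simp add: C_module_def)
    moreover have "h n = (jac_w * r) \<odot>\<^bsub>C_module\<^esub> h m"
      unfolding n_def using module_homD(3)[OF h(1) m(1)] .
    ultimately have "h m \<noteq> \<zero>\<^bsub>C_module\<^esub>"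
      using left_module.smult_zero_right[OF left_module_C] by metis
    then show ?thesis using h(1) by blast
  next
    case False
    let ?B = "M\<lparr>carrier := range (\<lambda>r. r \<odot>\<^bsub>M\<^esub> m)\<rparr>"
    have B: "left_module ?B" by (rule left_module_restrict[OF M M.cyclic_submodule[OF m(1)]])
    have "laurent_module ?B"
    proof (intro laurent_module.intro laurent_module_axioms.intro B)
      fix b assume "b \<in> carrier ?B"
      then obtain r where b: "b = r \<odot>\<^bsub>M\<^esub> m" by auto
      then have "b \<in> carrier M" "jac_w \<odot>\<^bsub>M\<^esub> b = \<zero>\<^bsub>M\<^esub>" using False m(1) M.smult_closed by auto
      then have "(jac_y * jac_x) \<odot>\<^bsub>M\<^esub> b = b"
        by (simp add: jac_y_x M.smult_diff M.smult_one a_minus_def)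
      then show "jac_y \<odot>\<^bsub>?B\<^esub> (jac_x \<odot>\<^bsub>?B\<^esub> b) = b"
        using \<open>b \<in> carrier M\<close> by (simp add: M.smult_assoc)
    qed
    moreover have "m \<in> carrier ?B"
      using M.smult_one[OF m(1), symmetric] by (auto intro: range_eqI)
    moreover have "m \<noteq> \<zero>\<^bsub>?B\<^esub>" using m(2) by simp
    ultimately obtain f u where f: "f \<in> F_polys" and u: "u \<in> carrier (U_module f)"
      "u \<noteq> \<zero>\<^bsub>U_module f\<^esub>"
      and ann: "\<And>r. r \<odot>\<^bsub>?B\<^esub> m = \<zero>\<^bsub>?B\<^esub> \<Longrightarrow> r \<odot>\<^bsub>U_module f\<^esub> u = \<zero>\<^bsub>U_module f\<^esub>"
      by (rule U_element_with_annihilator) blast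
    define s where "s = (\<lambda>e\<in>F_polys. if e = f then u else \<zero>\<^bsub>U_module e\<^esub>)"
    have zero_closed: "\<zero>\<^bsub>U_module e\<^esub> \<in> carrier (U_module e)" if "e \<in> F_polys" for e :: "'k poly"
      using left_module_U[OF that]
      by (meson abelian_group.axioms(1) abelian_monoid.zero_closed left_module.axioms(1))
    have "{e \<in> F_polys. s e \<noteq> \<zero>\<^bsub>U_module e\<^esub>} \<subseteq> {f}" by (auto simp: s_def)
    then have "finite {e \<in> F_polys. s e \<noteq> \<zero>\<^bsub>U_module e\<^esub>}" by (rule finite_subset) simp
    then have "s \<in> carrier ?S" using u(1) zero_closed by (auto simp: s_def)
    then have c: "((\<lambda>_. 0), s) \<in> carrier C_module" by (simp add: C_module_def)
    have "s f \<noteq> \<zero>\<^bsub>U_module f\<^esub>" using f u(2) by (simp add: s_def)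
    then have s0: "s \<noteq> \<zero>\<^bsub>?S\<^esub>" using f by auto
    have "r \<odot>\<^bsub>C_module\<^esub> ((\<lambda>_. 0), s) = \<zero>\<^bsub>C_module\<^esub>" if "r \<odot>\<^bsub>M\<^esub> m = \<zero>\<^bsub>M\<^esub>" for r
    proof -
      have "r \<odot>\<^bsub>U_module f\<^esub> u = \<zero>\<^bsub>U_module f\<^esub>" using ann that by simp
      then have "r \<odot>\<^bsub>?S\<^esub> s = \<zero>\<^bsub>?S\<^esub>"
        using left_module.smult_zero_right[OF left_module_U] by (auto simp: s_def fun_eq_iff)
      moreover have "series_smult r (\<lambda>_. 0) = (\<lambda>_. 0 :: 'k)"
        using left_module.smult_zero_right[OF left_module_Y, of r] by simp
      ultimately show ?thesis unfolding C_module_def by simp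
    qed
    then obtain h where "h \<in> module_hom M C_module" "h m = ((\<lambda>_. 0), s)"
      using baer_extends_cyclic[OF baer_C M m(1) c] by blast
    moreover have "((\<lambda>_. 0), s) \<noteq> \<zero>\<^bsub>C_module\<^esub>" using s0 unfolding C_module_def by simp
    ultimately show ?thesis by (intro bexI[of _ h]) simp_all
  qed
qed

text \<open>
  Enough homomorphisms to \<open>C\<close> exist to separate the elements of a module, so their product is an
  embedding; one factor for each element suffices.
\<close>

lemma embeds_in_power_of_C:
  fixes M :: "('k::field leavitt, 'm, 'z) module_scheme" and e :: "'m \<Rightarrow> 'i"
  assumes M: "left_module M" and e: "inj e"
  obtains I :: "'i set" and h where "h \<in> module_hom M (direct_product I (\<lambda>_. C_module))"
    "inj_on h (carrier M)"
proof -
  interpret M: left_module M by fact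
  obtain k where k: "\<And>z. \<lbrakk>z \<in> carrier M; z \<noteq> \<zero>\<^bsub>M\<^esub>\<rbrakk> \<Longrightarrow> k z \<in> module_hom M C_module"
    "\<And>z. \<lbrakk>z \<in> carrier M; z \<noteq> \<zero>\<^bsub>M\<^esub>\<rbrakk> \<Longrightarrow> k z z \<noteq> \<zero>\<^bsub>C_module\<^esub>"
    using C_cogenerator[OF M] by metis
  define I where "I = e ` (carrier M - {\<zero>\<^bsub>M\<^esub>})"
  define h where "h x = (\<lambda>i\<in>I. k (inv_into UNIV e i) x)" for x
  have kI: "k (inv_into UNIV e i) \<in> module_hom M C_module" if i: "i \<in> I" for i
  proof -
    obtain z where "z \<in> carrier M" "z \<noteq> \<zero>\<^bsub>M\<^esub>" "i = e z" using i unfolding I_def by blast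
    then show ?thesis using k(1) inv_f_f[OF e] by simp
  qed
  have "h \<in> module_hom M (direct_product I (\<lambda>_. C_module))"
  proof (rule module_homI)
    show "h x \<in> carrier (direct_product I (\<lambda>_. C_module))" if "x \<in> carrier M" for x
      using module_homD(1)[OF kI that] by (simp add: h_def)
    show "h (x \<oplus>\<^bsub>M\<^esub> y) = h x \<oplus>\<^bsub>direct_product I (\<lambda>_. C_module)\<^esub> h y"
      if "x \<in> carrier M" "y \<in> carrier M" for x y
      unfolding h_def direct_product_sel
      by (rule restrict_ext) (simp add: module_homD(2)[OF kI that])
    show "h (r \<odot>\<^bsub>M\<^esub> x) = r \<odot>\<^bsub>direct_product I (\<lambda>_. C_module)\<^esub> h x"
      if "x \<in> carrier M" for r x
      unfolding h_def direct_product_sel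
      by (rule restrict_ext) (simp add: module_homD(3)[OF kI that])
  qed
  moreover have "inj_on h (carrier M)"
  proof (rule inj_onI, rule ccontr)
    fix x y assume x: "x \<in> carrier M" and y: "y \<in> carrier M" and eq: "h x = h y" and ne: "x \<noteq> y"
    let ?z = "x \<ominus>\<^bsub>M\<^esub> y"
    have z: "?z \<in> carrier M" "?z \<noteq> \<zero>\<^bsub>M\<^esub>" using x y ne M.minus_eq_zeroD by auto
    have "k ?z x = k ?z y"
      using fun_cong[OF eq, of "e ?z"] z inv_f_f[OF e] by (simp add: h_def I_def)
    moreover have "k ?z ?z = k ?z x \<ominus>\<^bsub>C_module\<^esub> k ?z y"
      by (rule module_hom_minus[OF M left_module_C k(1)[OF z] x y])
    moreover interpret C: left_module "C_module :: ('k leavitt, _) module" by (rule left_module_C)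
    have "k ?z y \<in> carrier C_module" using module_homD(1)[OF k(1)[OF z] y] .
    ultimately show False using k(2)[OF z] by (simp add: a_minus_def C.r_neg)
  qed
  ultimately show thesis by (rule that)
qed

(* The types 'b (carriers of the test modules in the definition of injectivity) and 'i (indices of
   the direct product) are arbitrary; the assumptions only say that they are large enough. *)
theorem corollary32:
  fixes M :: "('k::field leavitt, 'm) module"
  assumes "left_module M"
    and "\<exists>e :: 'k leavitt \<Rightarrow> 'b. inj e"
    and "\<exists>e :: 'm \<Rightarrow> 'i. inj e"
  shows "injective_module TYPE('b) M \<longleftrightarrow>
    (\<exists>(I :: 'i set) N.
       direct_summand N (direct_product I (\<lambda>_. C_module)) \<and>
       module_isomorphic M ((direct_product I (\<lambda>_. C_module))\<lparr>carrier := N\<rparr>))"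
proof
  assume inj: "injective_module TYPE('b) M"
  obtain e :: "'k leavitt \<Rightarrow> 'b" where "inj e" using assms(2) by blast
  with inj have baer: "baer_module M" by (rule injective_imp_baer)
  obtain e' :: "'m \<Rightarrow> 'i" where "inj e'" using assms(3) by blast
  then obtain I :: "'i set" and h where h: "h \<in> module_hom M (direct_product I (\<lambda>_. C_module))"
    "inj_on h (carrier M)" using embeds_in_power_of_C[OF assms(1)] by blast
  have "left_module (direct_product I (\<lambda>_. C_module))"
    by (rule left_module_direct_product) (rule left_module_C)
  from baer_embedding_splits[OF baer this h]
  show "\<exists>(I :: 'i set) N. direct_summand N (direct_product I (\<lambda>_. C_module)) \<and>
       module_isomorphic M ((direct_product I (\<lambda>_. C_module))\<lparr>carrier := N\<rparr>)" by blast
next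
  assume "\<exists>(I :: 'i set) N. direct_summand N (direct_product I (\<lambda>_. C_module)) \<and>
       module_isomorphic M ((direct_product I (\<lambda>_. C_module))\<lparr>carrier := N\<rparr>)"
  then obtain I :: "'i set" and N where
    N: "direct_summand N (direct_product I (\<lambda>_. C_module))"
    and iso: "module_isomorphic M ((direct_product I (\<lambda>_. C_module))\<lparr>carrier := N\<rparr>)" by blast
  have "baer_module (direct_product I (\<lambda>_. C_module))"
    by (rule baer_direct_product) (rule baer_C)
  from baer_isomorphic[OF baer_direct_summand[OF this N] assms(1) iso]
  show "injective_module TYPE('b) M" by (rule baer_imp_injective)
qed

end
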